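(* Let $n\ge2$ and let $0=\lambda_0<\lambda_1<\lambda_2<\cdots$ be the distinct eigenvalues of the Neumann Laplacian on the Vicsek set $\mathcal{VS}_n$. For $1\le j\le n-1$, $$w_n(\lambda_{2j-1}^-)=\frac{4j-3}{(\lambda_{2j-1})^{\alpha_n}},\qquad w_n(\lambda_{2j-1})=\frac{4j-1}{(\lambda_{2j-1})^{\alpha_n}},\qquad w_n(\lambda_{2j})=\frac{4j}{(\lambda_{2j})^{\alpha_n}},$$ where $w_n$ is the limiting Weyl ratio on $\mathcal{VS}_n$.
   Context: Vicsek set. For $n\ge2$, $\mathcal{VS}_n$ is the self-similar set in the unit square generated by the $4n-3$ orientation-preserving homotheties $F_i$ of ratio $1/(2n-1)$ that map the unit square onto the $4n-3$ subsquares lying along the two diagonals of the $(2n-1)\times(2n-1)$ grid of subsquares. $V_0$ is the set of the four corners, $\Gamma_0$ the complete graph on $V_0$; $V_m=\bigcup_iF_i(V_{m-1})$, and $\Gamma_m$ is the graph on $V_m$ in which two vertices are adjacent iff both are corners of a common $m$-cell. The graph Laplacian is $\Delta_mu(x)=\frac1{\deg x}\sum_{y\sim x}(u(y)-u(x))$ for all $x\in V_m$ (Neumann boundary conditions). Put $\rho_n=(4n-3)(2n-1)$. The Neumann Laplacian on $\mathcal{VS}_n$ is $\Delta u=\lim_m\rho_n^m\Delta_mu$; eigenvalues are those of $-\Delta$. Spectral decimation (known description of the spectrum). Let $U_k$ be the Chebyshev polynomials of the second kind, $g_n(\lambda)=U_{n-1}(3\lambda-1)-U_{n-2}(3\lambda-1)$,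 $h_n(\lambda)=U_{n-1}(3\lambda-1)-3U_{n-2}(3\lambda-1)$ and $R(\lambda)=\lambda g_n(\lambda)h_n(\lambda)$. Let $\phi_1<\cdots<\phi_{2n-1}$ be the inverse branches of $R$ on $[0,4/3]$ ($\phi_j$ is increasing for $j$ odd, decreasing for $j$ even). The eigenvalues are exactly the numbers of the forms: (a) ($0$-series) $\lim_{m\to\infty}\rho_n^m\phi_{w_m}\circ\cdots\circ\phi_{w_1}(0)$, where all but finitely many $w_j$ equal $1$, and the first $w_j\ne1$ (if any) is odd; these have multiplicity $1$; (b) ($4/3$-series, born on level $k\ge0$) $\lim_{m\to\infty}\rho_n^{m+k}\phi_{w_m}\circ\cdots\circ\phi_{w_1}(4/3)$, where all but finitely many $w_j$ equal $1$, $w_1$ is odd and $w_1\ne2n-1$; these have multiplicity $2(4n-3)^k+1$. Weyl ratio. Let $m(\lambda)$ denote the multiplicity of the eigenvalue $\lambda$, $N_n(t)=\sum_{\lambda_j\le t}m(\lambda_j)$ the eigenvalue counting function, $\alpha_n=\frac{\log(4n-3)}{\log\rho_n}$, and $W_n(t)=N_n(t)/t^{\alpha_n}$ for $t>0$. The limit $w_n(t)=\lim_{k\to\infty}W_n(\rho_n^kt)$ exists (a known theorem of Kigami and Lapidus). $w_n$ may have jump discontinuities, and $w_n(t^-)=\lim_{s\to t^-}w_n(s)$. *)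

theory Defs
  imports "HOL-Analysis.Analysis" "HOL-Library.Function_Algebras"
begin

section \<open>The Vicsek set and its approximating graphs\<close>

text \<open>Subsquares of the grid of side \<open>2 * n - 1\<close> are named by their lower left corner; the two
  conditions describe the two diagonals, which share the central subsquare.\<close>

definition vs_offsets :: "nat \<Rightarrow> (nat \<times> nat) set" where
  "vs_offsets n = {(a, b). a < 2 * n - 1 \<and> b < 2 * n - 1 \<and> (a = b \<or> a + b = 2 * n - 2)}"

definition vs_map :: "nat \<Rightarrow> nat \<times> nat \<Rightarrow> real \<times> real \<Rightarrow> real \<times> real" where
  "vs_map n c x = (1 / (2 * real n - 1)) *\<^sub>R ((real (fst c), real (snd c)) + x)"

definition vicsek_set :: "nat \<Rightarrow> (real \<times> real) set" where
  "vicsek_set n =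
     (THE K. compact K \<and> K \<noteq> {} \<and> K = (\<Union>c\<in>vs_offsets n. vs_map n c ` K))"

definition square_corners :: "(real \<times> real) set" where
  "square_corners = {0, 1} \<times> {0, 1}"

primrec vs_vertices :: "nat \<Rightarrow> nat \<Rightarrow> (real \<times> real) set" where
  "vs_vertices n 0 = square_corners"
| "vs_vertices n (Suc m) = (\<Union>c\<in>vs_offsets n. vs_map n c ` vs_vertices n m)"

text \<open>An \<open>m\<close>-cell is represented by the set of its four corners.\<close>

primrec vs_cells :: "nat \<Rightarrow> nat \<Rightarrow> (real \<times> real) set set" where
  "vs_cells n 0 = {square_corners}"
| "vs_cells n (Suc m) = (\<Union>c\<in>vs_offsets n. (\<lambda>C. vs_map n c ` C) ` vs_cells n m)"

definition vs_neighbours :: "nat \<Rightarrow> nat \<Rightarrow> real \<times> real \<Rightarrow> (real \<times> real) set" where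
  "vs_neighbours n m x = {y. y \<noteq> x \<and> (\<exists>C\<in>vs_cells n m. x \<in> C \<and> y \<in> C)}"

definition graph_laplacian ::
    "nat \<Rightarrow> nat \<Rightarrow> (real \<times> real \<Rightarrow> real) \<Rightarrow> real \<times> real \<Rightarrow> real" where
  "graph_laplacian n m u x =
     (\<Sum>y\<in>vs_neighbours n m x. u y - u x) / real (card (vs_neighbours n m x))"


section \<open>The Neumann Laplacian and its spectrum\<close>

definition vs_rho :: "nat \<Rightarrow> real" where
  "vs_rho n = (4 * real n - 3) * (2 * real n - 1)"

text \<open>\<open>neumann_laplacian n u f\<close> says that \<open>u\<close> is in the domain of the Laplacian and is mapped to
  \<open>f\<close>. As usual for Laplacians on fractals, \<open>u\<close> and \<open>f\<close> are continuous and the limit of the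
  rescaled graph Laplacians is uniform over the vertices (with merely pointwise limits, kinks of
  \<open>u\<close> at points that are not vertices would go unnoticed). The vertices include the boundary
  \<open>square_corners\<close>, which is the Neumann condition. The functions matter only on the Vicsek set.\<close>

definition neumann_laplacian ::
    "nat \<Rightarrow> (real \<times> real \<Rightarrow> real) \<Rightarrow> (real \<times> real \<Rightarrow> real) \<Rightarrow> bool" where
  "neumann_laplacian n u f \<longleftrightarrow>
     continuous_on (vicsek_set n) u \<and> continuous_on (vicsek_set n) f \<and>
     (\<forall>e>0. \<forall>\<^sub>F m in sequentially. \<forall>x\<in>vs_vertices n m.
        \<bar>vs_rho n ^ m * graph_laplacian n m u x - f x\<bar> < e)"

text \<open>Functions on the Vicsek set are represented by functions on the plane that vanish outside
  it, so that the eigenspaces have the right dimension.\<close>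

definition eigenspace :: "nat \<Rightarrow> real \<Rightarrow> (real \<times> real \<Rightarrow> real) set" where
  "eigenspace n t =
     {u. (\<forall>x. x \<notin> vicsek_set n \<longrightarrow> u x = 0) \<and> neumann_laplacian n u (\<lambda>x. - t * u x)}"

definition eigenvalues :: "nat \<Rightarrow> real set" where
  "eigenvalues n = {t. \<exists>u\<in>eigenspace n t. \<exists>x. u x \<noteq> 0}"

interpretation plane_fun: vector_space "\<lambda>(c::real) (u :: real \<times> real \<Rightarrow> real) x. c * u x"
  by unfold_locales (auto simp: fun_eq_iff algebra_simps)

definition eig_multiplicity :: "nat \<Rightarrow> real \<Rightarrow> nat" where
  "eig_multiplicity n t = plane_fun.dim (eigenspace n t)"


section \<open>The Weyl ratio\<close>

definition eig_counting :: "nat \<Rightarrow> real \<Rightarrow> nat" where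
  "eig_counting n t = (\<Sum>s\<in>{s\<in>eigenvalues n. s \<le> t}. eig_multiplicity n s)"

definition vs_alpha :: "nat \<Rightarrow> real" where
  "vs_alpha n = ln (4 * real n - 3) / ln (vs_rho n)"

definition weyl_ratio :: "nat \<Rightarrow> real \<Rightarrow> real" where
  "weyl_ratio n t = real (eig_counting n t) / t powr vs_alpha n"

definition weyl_limit :: "nat \<Rightarrow> real \<Rightarrow> real" where
  "weyl_limit n t = lim (\<lambda>k. weyl_ratio n (vs_rho n ^ k * t))"

end

theory Submission
  imports Defs
begin

text \<open>
  Let \<open>R\<close> be the decimation polynomial. Extending functions from level \<open>m\<close> to level \<open>m + 1\<close> by
  solving the eigenvalue equation for \<open>l\<close> inside each \<open>m\<close>-cell turns \<open>R l\<close>-eigenfunctions into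
  \<open>l\<close>-eigenfunctions. The extensions, the constants and the functions whose sum over each cell is 0
  (eigenvalue \<open>4 / 3\<close>) account for as many dimensions as there are vertices, which determines
  the spectra of all graphs: with \<open>N = (4 * n - 3) ^ m\<close>, below the ends of the bands there are exactly
  \<open>(4 * j - 3) * N\<close>, \<open>(4 * j - 1) * N + 1\<close> or \<open>4 * j * N + 1\<close> eigenvalues of level \<open>m + 1\<close>,
  and a left neighbourhood of an upper end with \<open>R = 4 / 3\<close> contains none because level \<open>m\<close>
  has none just below \<open>4 / 3\<close>.

  The adjoint of extension is restriction. Since the extension is positive on the first band,
  restricting an approximate eigenfunction multiplies the error only by \<open>R l / l\<close>; iterating this
  towards level \<open>m\<close> shows that an eigenfunction on the fractal restricts to an exact
  eigenfunction on level \<open>m\<close>. Conversely, repeated extension along the first inverse branch of \<open>R\<close>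
  converges uniformly. So the eigenspaces of the fractal and of the graph are isomorphic, and
  the eigenvalues up to \<open>\<rho> ^ k * t\<close> are counted on level \<open>k + 1\<close>.
\<close>

section \<open>Dimensions of subspaces\<close>

text \<open>The eigenvalues in question are \<open>vs_rho n * Psi z\<close>, where \<open>z\<close>
  is an end \<open>zp j\<close> or \<open>tp j\<close> of a band. Counting at
  \<open>vs_rho n ^ k\<close> times such a number means counting graph eigenvalues up to the fixed
  \<open>z\<close> on level k + 1, and division by (4 n - 3)^k leaves the leading coefficient. On
  the graphs only lower bounds are constructed, so one preimage per band from the intermediate value
  theorem is enough. Monotonicity of R is used on the first band alone, through whose inverse the
  fractal eigenvalues are transported. The delicate direction is that a limit equation on the
  fractal forces an exact equation on a graph. An error e in the rescaled equation on level m + i is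
  an error of order e / rho^(m+i) on that graph. The factors R l / l telescope to z /
  \<open>zeta i z\<close>, which is of order rho^i, so on level m an error of order e remains, and e
  is arbitrary. The sign of the eigenvalues and the eigenvalue 0 come from the given enumeration.
  The multiplicity of 0 is an additive constant that disappears in the limit.\<close>

context vector_space
begin

lemma independent_Un_disjoint_span:
  assumes A: "independent A" and B: "independent B" and AB: "span A \<inter> span B \<subseteq> {0}"
  shows "independent (A \<union> B)"
proof
  assume "dependent (A \<union> B)"
  then obtain t u v where t: "finite t" "t \<subseteq> A \<union> B" "(\<Sum>v\<in>t. scale (u v) v) = 0"
    and v: "v \<in> t" "u v \<noteq> 0"
    unfolding dependent_explicit by blast
  let ?a = "\<Sum>v\<in>t \<inter> A. scale (u v) v" and ?b = "\<Sum>v\<in>t - A. scale (u v) v"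
  have sum0: "?a + ?b = 0"
    using t(1,3) by (metis sum.Int_Diff)
  have a: "?a \<in> span A"
    by (intro span_sum span_scale span_base) auto
  have b: "?b \<in> span B"
    using t(2) by (intro span_sum span_scale span_base) auto
  have "?a = - ?b"
    using sum0 by (simp add: add_eq_0_iff2)
  then have "?a \<in> span B"
    using b span_neg by metis
  then have a0: "?a = 0"
    using a AB by blast
  then have b0: "?b = 0"
    using sum0 by simp
  show False
  proof (cases "v \<in> A")
    case True
    then show ?thesis
      using independentD[OF A _ _ a0, of v] v t(1) by simp
  next
    case False
    then show ?thesis
      using independentD[OF B _ _ b0, of v] v t(1,2) by blast
  qed
qed

lemma independent_card_le_dim_in_span:
  assumes "finite D" "V \<subseteq> span D" "B \<subseteq> V" "independent B"
  shows "finite B" "card B \<le> dim V"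
proof -
  obtain C where C: "C \<subseteq> V" "independent C" "V \<subseteq> span C" "card C = dim V"
    using basis_exists[of V] by blast
  have "finite C"
    using independent_span_bound[OF assms(1) C(2)] C(1) assms(2) by blast
  moreover have "B \<subseteq> span C"
    using C(3) assms(3) by blast
  ultimately have "finite B \<and> card B \<le> card C"
    using independent_span_bound[OF _ assms(4)] by blast
  then show "finite B" "card B \<le> dim V"
    using C(4) by auto
qed

lemma dim_mono_in_span:
  assumes "finite D" "V \<subseteq> span D" "W \<subseteq> V"
  shows "dim W \<le> dim V"
proof -
  obtain C where C: "C \<subseteq> W" "independent C" "W \<subseteq> span C" "card C = dim W"
    using basis_exists[of W] by blast
  show ?thesis
    using independent_card_le_dim_in_span(2)[OF assms(1,2) _ C(2)] C(1,4) assms(3) by auto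
qed

text \<open>The hypothesis \<open>dis\<close> is independence of the family of subspaces. It is met
  by eigenspaces for different eigenvalues, which are orthogonal, and bounds the sum of all
  multiplicities by the number of vertices.\<close>

lemma sum_dim_le:
  assumes Z: "finite Z" and D: "finite D" and V: "\<And>z. z \<in> Z \<Longrightarrow> V z \<subseteq> span D"
    and dis: "\<And>z Y. z \<in> Z \<Longrightarrow> Y \<subseteq> Z - {z} \<Longrightarrow> span (V z) \<inter> span (\<Union>(V ` Y)) \<subseteq> {0}"
  shows "(\<Sum>z\<in>Z. dim (V z)) \<le> card D"
proof -
  have "\<exists>B. independent B \<and> B \<subseteq> \<Union>(V ` Y) \<and> card B = (\<Sum>z\<in>Y. dim (V z))" if "Y \<subseteq> Z" for Y
    using finite_subset[OF that Z] that
  proof (induction Y rule: finite_induct)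
    case empty
    then show ?case
      using independent_empty by (auto intro!: exI[of _ "{}"])
  next
    case (insert z Y)
    then obtain B where B: "independent B" "B \<subseteq> \<Union>(V ` Y)" "card B = (\<Sum>z\<in>Y. dim (V z))"
      by auto
    obtain C where C: "C \<subseteq> V z" "independent C" "V z \<subseteq> span C" "card C = dim (V z)"
      by (rule basis_exists)
    have dj: "span C \<inter> span B \<subseteq> {0}"
    proof -
      have "span C \<subseteq> span (V z)" "span B \<subseteq> span (\<Union>(V ` Y))"
        using B C span_mono by auto
      moreover have "span (V z) \<inter> span (\<Union>(V ` Y)) \<subseteq> {0}"
        using insert by (intro dis) auto
      ultimately show ?thesis
        by blast
    qed
    have "0 \<notin> C"
      using C(2) dependent_zero by blast
    then have "C \<inter> B = {}"
      using dj span_base by blast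
    moreover have "finite C" "finite B"
    proof -
      show "finite C"
        using independent_span_bound[OF D C(2)] C(1) V[of z] insert.prems by blast
      have "B \<subseteq> span D"
        using B(2) V insert by blast
      then show "finite B"
        using independent_span_bound[OF D B(1)] by blast
    qed
    ultimately have "card (C \<union> B) = (\<Sum>z\<in>insert z Y. dim (V z))"
      using B C insert by (simp add: card_Un_disjoint)
    moreover have "independent (C \<union> B)"
      using C B dj by (intro independent_Un_disjoint_span)
    ultimately show ?case
      using B(2) C(1) by (intro exI[of _ "C \<union> B"]) auto
  qed
  then obtain B where B: "independent B" "B \<subseteq> \<Union>(V ` Z)" "card B = (\<Sum>z\<in>Z. dim (V z))"
    by blast
  have "B \<subseteq> span D"
    using B(2) V by blast
  then have "card B \<le> card D"
    using independent_span_bound[OF D B(1)] by blast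
  then show ?thesis
    using B(3) by simp
qed

text \<open>Turns an equality of multiplicities into surjectivity of the extension map onto an
  eigenspace.\<close>

lemma eq_of_dim_eq_in_span:
  assumes "finite D" "V \<subseteq> span D" "W \<subseteq> V" "subspace W" "dim V \<le> dim W"
  shows "W = V"
proof (rule ccontr)
  assume "W \<noteq> V"
  then obtain v where v: "v \<in> V" "v \<notin> W"
    using assms(3) by blast
  obtain C where C: "C \<subseteq> W" "independent C" "W \<subseteq> span C" "card C = dim W"
    using basis_exists[of W] by blast
  have "span C = W"
    using C assms(4) by (simp add: span_subspace)
  then have "independent (insert v C)"
    using v C independent_insertI by blast
  moreover have "insert v C \<subseteq> V"
    using v C assms(3) by auto
  ultimately have *: "finite (insert v C)" "card (insert v C) \<le> dim V"
    using independent_card_le_dim_in_span[OF assms(1,2), of "insert v C"] by simp_all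
  then have "card (insert v C) = Suc (card C)"
    using v(2) C(1) by (metis card_insert_disjoint finite_insert in_mono)
  then show False
    using * C assms(5) by simp
qed

lemma dim_kernel_functional:
  assumes D: "finite D" "V \<subseteq> span D" and V: "subspace V"
    and f: "\<And>x y. f (x + y) = f x + f y" "\<And>c x. f (scale c x) = c * f x"
  shows "dim V \<le> Suc (dim {x \<in> V. f x = 0})"
proof (cases "\<exists>x\<in>V. f x \<noteq> 0")
  case False
  then have "{x \<in> V. f x = 0} = V"
    by auto
  then show ?thesis
    by simp
next
  case True
  then obtain w where w: "w \<in> V" "f w \<noteq> 0"
    by auto
  let ?W = "{x \<in> V. f x = 0}"
  obtain C where C: "C \<subseteq> ?W" "independent C" "?W \<subseteq> span C" "card C = dim ?W"
    using basis_exists[of ?W] by blast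
  have "C \<subseteq> span D"
    using C(1) D(2) by auto
  then have "finite C"
    using independent_span_bound[OF D(1) C(2)] by blast
  have "V \<subseteq> span (insert w C)"
  proof
    fix x assume x: "x \<in> V"
    let ?y = "x - scale (f x / f w) w"
    have "?y \<in> V"
      using subspace_diff[OF V x subspace_scale[OF V w(1)]] .
    moreover have "f (?y + scale (f x / f w) w) = f ?y + f x"
      using w by (simp only: f) simp
    then have "f ?y = 0"
      by simp
    ultimately have "?y \<in> span C"
      using C(3) by auto
    then have "?y + scale (f x / f w) w \<in> span (insert w C)"
      using span_mono[of C "insert w C"] by (meson in_mono insertI1 span_add span_base span_scale subset_insertI)
    then show "x \<in> span (insert w C)"
      by simp
  qed
  then have "dim V \<le> card (insert w C)"
    using \<open>finite C\<close> by (intro dim_le_card) auto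
  also have "\<dots> \<le> Suc (card C)"
    by (simp add: card_insert_le_m1 \<open>finite C\<close> card_insert_if)
  finally show ?thesis
    using C(4) by simp
qed

text \<open>Each functional costs at most one dimension. The functionals will be the cell sums, one
  for each cell.\<close>

lemma dim_kernel_functionals:
  assumes D: "finite D" "V \<subseteq> span D" and V: "subspace V" and I: "finite I"
    and f: "\<And>i x y. f i (x + y) = f i x + f i y" "\<And>i c x. f i (scale c x) = c * f i x"
  shows "dim V \<le> card I + dim {x \<in> V. \<forall>i\<in>I. f i x = 0}"
  using I
proof (induction I rule: finite_induct)
  case (insert i I)
  let ?W = "{x \<in> V. \<forall>i\<in>I. f i x = 0}"
  have f0: "f j 0 = 0" for j
    using f(2)[of j 0 0] by simp
  have "dim ?W \<le> Suc (dim {x \<in> ?W. f i x = 0})"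
    using D V f by (intro dim_kernel_functional)
      (auto simp: subspace_def f0)
  also have "{x \<in> ?W. f i x = 0} = {x \<in> V. \<forall>i\<in>insert i I. f i x = 0}"
    by auto
  finally show ?case
    using insert by simp
qed simp

end

lemma (in vector_space_pair) dim_le_of_injective:
  assumes f: "Vector_Spaces.linear s1 s2 f" "inj_on f V" "f ` V \<subseteq> W" and V: "vs1.subspace V"
    and D: "finite D" "W \<subseteq> vs2.span D"
  shows "vs1.dim V \<le> vs2.dim W"
proof -
  obtain B where B: "B \<subseteq> V" "vs1.independent B" "V \<subseteq> vs1.span B" "card B = vs1.dim V"
    using vs1.basis_exists[of V] by blast
  have sB: "vs1.span B = V"
    using B V by (simp add: vs1.span_subspace)
  have "vs2.independent (f ` B)"
    using f B sB by (intro linear_independent_injective_image) auto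
  then have "card (f ` B) \<le> vs2.dim W"
    using D f(3) B(1) by (intro vs2.independent_card_le_dim_in_span(2)[of D W "f ` B"]) auto
  moreover have "card (f ` B) = card B"
    using f(2) B(1) by (meson card_image inj_on_subset)
  ultimately show ?thesis
    using B(4) by simp
qed

text \<open>The source may be infinite-dimensional as far as is known at this point. This matters
  for the eigenspaces on the fractal, whose finite dimension is only a consequence.\<close>

lemma (in vector_space_pair) dim_eq_of_bij:
  assumes f: "Vector_Spaces.linear s1 s2 f" "inj_on f V" and V: "vs1.subspace V"
  shows "vs1.dim V = vs2.dim (f ` V)"
proof -
  obtain B where B: "B \<subseteq> V" "vs1.independent B" "V \<subseteq> vs1.span B" "card B = vs1.dim V"
    using vs1.basis_exists[of V] by blast
  have sB: "vs1.span B = V"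
    using B V by (simp add: vs1.span_subspace)
  have "vs2.independent (f ` B)"
    using f B sB by (intro linear_independent_injective_image) auto
  moreover have "vs2.span (f ` B) = f ` V"
    using linear_span_image[OF f(1)] sB by simp
  ultimately have "vs2.dim (f ` V) = card (f ` B)"
    by (metis vs2.dim_span_eq_card_independent)
  also have "card (f ` B) = card B"
    using f(2) B(1) by (meson card_image inj_on_subset)
  finally show ?thesis
    using B(4) by simp
qed

section \<open>Chebyshev polynomials and spectral bands\<close>

text \<open>In terms of the Chebyshev polynomials of the second kind, \<open>chebB s l\<close> is
  \<open>U\<close> of index \<open>s - 1\<close> at \<open>1 - 3 * l\<close>, and \<open>chebG s = chebB s + chebB (s - 1)\<close>.\<close>

fun chebB :: "nat \<Rightarrow> real \<Rightarrow> real" where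
  "chebB 0 l = 0"
| "chebB (Suc 0) l = 1"
| "chebB (Suc (Suc s)) l = (2 - 6 * l) * chebB (Suc s) l - chebB s l"

fun chebG :: "nat \<Rightarrow> real \<Rightarrow> real" where
  "chebG 0 l = -1"
| "chebG (Suc 0) l = 1"
| "chebG (Suc (Suc s)) l = (2 - 6 * l) * chebG (Suc s) l - chebG s l"

lemma linear_recursion_unique:
  fixes f g :: "nat \<Rightarrow> real"
  assumes "f 0 = g 0" "f 1 = g 1"
    and "\<And>s. f (Suc (Suc s)) = c * f (Suc s) - f s" "\<And>s. g (Suc (Suc s)) = c * g (Suc s) - g s"
  shows "f s = g s"
proof -
  have "f s = g s \<and> f (Suc s) = g (Suc s)"
    by (induction s) (use assms in auto)
  then show ?thesis by simp
qed

lemma chebG_Suc: "chebG (Suc s) l = chebB (Suc s) l + chebB s l"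
  by (rule linear_recursion_unique[where c = "2 - 6 * l"]) (simp_all add: algebra_simps)

text \<open>The transfer matrix of the recursion has determinant 1, so this quadratic form of two
  consecutive values is preserved and keeps its initial value.\<close>

lemma chebB_cassini:
  "chebB (Suc s) l ^ 2 + chebB s l ^ 2 - (2 - 6 * l) * chebB (Suc s) l * chebB s l = 1"
proof (induction s)
  case (Suc s)
  have "chebB (Suc (Suc s)) l ^ 2 + chebB (Suc s) l ^ 2
        - (2 - 6 * l) * chebB (Suc (Suc s)) l * chebB (Suc s) l
      = chebB (Suc s) l ^ 2 + chebB s l ^ 2 - (2 - 6 * l) * chebB (Suc s) l * chebB s l"
    by (simp add: power2_eq_square algebra_simps)
  then show ?case
    using Suc by simp
qed simp

lemma continuous_on_chebB [continuous_intros]: "continuous_on A (chebB s)"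
proof -
  have "continuous_on A (chebB s) \<and> continuous_on A (chebB (Suc s))"
    by (induction s) (auto intro!: continuous_intros)
  then show ?thesis by simp
qed

lemma continuous_on_chebG [continuous_intros]: "continuous_on A (chebG s)"
proof -
  have "continuous_on A (chebG s) \<and> continuous_on A (chebG (Suc s))"
    by (induction s) (auto intro!: continuous_intros)
  then show ?thesis by simp
qed

lemma chebB_0: "chebB s 0 = real s"
proof -
  have "chebB s 0 = real s \<and> chebB (Suc s) 0 = real (Suc s)"
    by (induction s) auto
  then show ?thesis by simp
qed

lemma chebG_0: "chebG s 0 = 2 * real s - 1"
proof -
  have "chebG s 0 = 2 * real s - 1 \<and> chebG (Suc s) 0 = 2 * real (Suc s) - 1"
    by (induction s) auto
  then show ?thesis by simp
qed

text \<open>Taylor expansion at 0 with a continuous quotient. It yields a linear bound for the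
  deviation of R l / l from its value at 0.\<close>

lemma chebB_expansion: "\<exists>q. continuous_on UNIV q \<and> (\<forall>l. chebB s l = real s + l * q l)"
proof -
  have "(\<exists>q. continuous_on UNIV q \<and> (\<forall>l. chebB s l = real s + l * q l))
     \<and> (\<exists>q. continuous_on UNIV q \<and> (\<forall>l. chebB (Suc s) l = real (Suc s) + l * q l))"
  proof (induction s)
    case 0
    show ?case
      by (auto intro!: exI[of _ "\<lambda>_. 0"])
  next
    case (Suc s)
    then obtain q1 q2 where q: "continuous_on UNIV q1" "\<forall>l. chebB s l = real s + l * q1 l"
      "continuous_on UNIV q2" "\<forall>l. chebB (Suc s) l = real (Suc s) + l * q2 l"
      by blast
    have "continuous_on UNIV (\<lambda>l. 2 * q2 l - 6 * (real (Suc s) + l * q2 l) - q1 l)"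
      using q by (intro continuous_intros)
    moreover have "\<forall>l. chebB (Suc (Suc s)) l
        = real (Suc (Suc s)) + l * (2 * q2 l - 6 * (real (Suc s) + l * q2 l) - q1 l)"
      using q by (simp add: algebra_simps)
    ultimately show ?case
      using q(3,4) by blast
  qed
  then show ?thesis by simp
qed

section \<open>Trigonometric form: with 3 l = 1 - cos t the recursion coefficient 2 - 6 l becomes 2
  cos t\<close>

definition node :: "real \<Rightarrow> real" where
  "node t = (1 - cos t) / 3"

lemma node_factor: "2 - 6 * node t = 2 * cos t"
  by (simp add: node_def field_simps)

lemma node_rec:
  "chebB (Suc (Suc s)) (node t) = 2 * cos t * chebB (Suc s) (node t) - chebB s (node t)"
  "chebG (Suc (Suc s)) (node t) = 2 * cos t * chebG (Suc s) (node t) - chebG s (node t)"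
  by (simp_all add: node_factor)

lemma sin_step: "sin (a + (real (Suc (Suc s))) * t) = 2 * cos t * sin (a + real (Suc s) * t) - sin (a + real s * t)"
proof -
  have "sin (a + real (Suc s) * t + t) + sin (a + real (Suc s) * t - t)
      = 2 * cos t * sin (a + real (Suc s) * t)"
    by (simp add: sin_add sin_diff)
  then show ?thesis
    by (simp add: algebra_simps)
qed

lemma cos_step: "cos (a + (real (Suc (Suc s))) * t) = 2 * cos t * cos (a + real (Suc s) * t) - cos (a + real s * t)"
proof -
  have "cos (a + real (Suc s) * t + t) + cos (a + real (Suc s) * t - t)
      = 2 * cos t * cos (a + real (Suc s) * t)"
    by (simp add: cos_add cos_diff)
  then show ?thesis
    by (simp add: algebra_simps)
qed

text \<open>The closed form sin((s - 1/2) t) / sin(t / 2), multiplied out so that zeros of the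
  denominator need no exception.\<close>

lemma chebG_node: "chebG s (node t) * sin (t / 2) = sin ((real s - 1/2) * t)"
proof -
  have "chebG s (node t) * sin (t / 2) = sin (- (t/2) + real s * t)"
  proof (rule linear_recursion_unique[where c = "2 * cos t"])
    show "sin (- (t / 2) + real (Suc (Suc s)) * t) =
        2 * cos t * sin (- (t / 2) + real (Suc s) * t) - sin (- (t / 2) + real s * t)" for s
      by (rule sin_step)
  qed (simp_all add: node_rec algebra_simps del: chebB.simps(3) chebG.simps(3))
  then show ?thesis
    by (simp add: algebra_simps)
qed

lemma chebB_diff_node:
  "(chebB (Suc s) (node t) - chebB s (node t)) * cos (t / 2) = cos ((real s + 1/2) * t)"
proof -
  have "(chebB (Suc s) (node t) - chebB s (node t)) * cos (t / 2) = cos (t/2 + real s * t)"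
  proof (rule linear_recursion_unique[where c = "2 * cos t"])
    show "cos (t / 2 + real (Suc (Suc s)) * t) =
        2 * cos t * cos (t / 2 + real (Suc s) * t) - cos (t / 2 + real s * t)" for s
      by (rule cos_step)
    \<comment> \<open>This is cos(3t/2) = (2 cos t - 1) cos(t/2), the second initial value.\<close>
    have "cos (- (t/2) + real (Suc (Suc 0)) * t) = 2 * cos t * cos (- (t/2) + real (Suc 0) * t) - cos (- (t/2) + real 0 * t)"
      by (rule cos_step)
    then show "(chebB (Suc 1) (node t) - chebB 1 (node t)) * cos (t / 2) = cos (t / 2 + real 1 * t)"
      by (simp add: node_rec algebra_simps del: chebB.simps(3) chebG.simps(3) add: power2_eq_square power3_eq_cube)
  qed (simp_all add: node_rec algebra_simps del: chebB.simps(3) chebG.simps(3))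
  then show ?thesis
    by (simp add: algebra_simps)
qed

text \<open>The classical relation between the two kinds of Chebyshev polynomials, U minus U two
  places earlier being 2 T. It carries the monotonicity of cosines over to
  \<open>chebB\<close>.\<close>

lemma chebB_two_step: "chebB (Suc (Suc s)) (node t) - chebB s (node t) = 2 * cos (real (Suc s) * t)"
proof -
  have "chebB (Suc (Suc s)) (node t) - chebB s (node t) = 2 * cos (t + real s * t)"
  proof (rule linear_recursion_unique[where c = "2 * cos t"])
    show "2 * cos (t + real (Suc (Suc s)) * t) =
        2 * cos t * (2 * cos (t + real (Suc s) * t)) - 2 * cos (t + real s * t)" for s
      using cos_step[of t s t] by (simp add: algebra_simps)
    have "cos (2 * t) = 2 * cos t ^ 2 - 1"
      by (rule cos_double_cos)
    then show "chebB (Suc (Suc 1)) (node t) - chebB 1 (node t) = 2 * cos (t + real 1 * t)"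
      by (simp add: node_rec algebra_simps del: chebB.simps(3) chebG.simps(3) add: power2_eq_square)
  qed (simp_all add: node_rec algebra_simps del: chebB.simps(3) chebG.simps(3))
  then show ?thesis
    by (simp add: algebra_simps)
qed

text \<open>The left side is the polynomial \<open>ep\<close> for n = s + 1. As a positive
  combination of cosines it is seen to be nonincreasing on the first band.\<close>

lemma chebG_corner_node:
  "(4 - 6 * node t) * chebG (Suc s) (node t) - 4 * chebG s (node t)
     = 2 * cos (real (Suc s) * t) + 6 * cos (real s * t)"
proof -
  have "(4 - 6 * node t) * chebG (Suc s) (node t) - 4 * chebG s (node t)
     = 2 * cos (t + real s * t) + 6 * cos (0 + real s * t)"
  proof (rule linear_recursion_unique[where c = "2 * cos t"])
    show "2 * cos (t + real (Suc (Suc s)) * t) + 6 * cos (0 + real (Suc (Suc s)) * t) =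
        2 * cos t * (2 * cos (t + real (Suc s) * t) + 6 * cos (0 + real (Suc s) * t))
        - (2 * cos (t + real s * t) + 6 * cos (0 + real s * t))" for s
      using cos_step[of t s t] cos_step[of 0 s t] by (simp add: algebra_simps)
    have e: "4 - 6 * node t = 2 + 2 * cos t"
      using node_factor[of t] by simp
    show "(4 - 6 * node t) * chebG (Suc 0) (node t) - 4 * chebG 0 (node t)
       = 2 * cos (t + real 0 * t) + 6 * cos (0 + real 0 * t)"
      by (simp add: e)
    have "cos (2 * t) = 2 * cos t ^ 2 - 1"
      by (rule cos_double_cos)
    then show "(4 - 6 * node t) * chebG (Suc 1) (node t) - 4 * chebG 1 (node t)
       = 2 * cos (t + real 1 * t) + 6 * cos (0 + real 1 * t)"
      unfolding e by (simp add: node_rec algebra_simps power2_eq_square del: chebB.simps(3) chebG.simps(3))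
  qed (simp_all add: node_rec algebra_simps del: chebB.simps(3) chebG.simps(3))
  then show ?thesis
    by (simp add: algebra_simps)
qed

text \<open>By \<open>chebB_two_step\<close>, \<open>chebB s\<close> is built up by adding terms 2
  cos(k t) with k < s, and each of these decreases as long as k t stays below pi.\<close>

lemma chebB_node_antimono:
  assumes "0 \<le> t" "t \<le> t'" "real s * t' \<le> pi"
  shows "chebB s (node t') \<le> chebB s (node t)"
proof -
  have *: "cos (real k * t') \<le> cos (real k * t)" if "real k * t' \<le> pi" for k
    using assms that by (intro cos_monotone_0_pi_le) (auto intro: mult_left_mono)
  \<comment> \<open>The recursion reaches back two places, so the claim carries the successor along,
    guarded by its own range condition.\<close>
  have "chebB s (node t') \<le> chebB s (node t)
      \<and> (real (Suc s) * t' \<le> pi \<longrightarrow> chebB (Suc s) (node t') \<le> chebB (Suc s) (node t))"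
    if "real s * t' \<le> pi" for s
    using that
  proof (induction s rule: less_induct)
    case (less s)
    show ?case
    proof (cases s)
      case 0
      then show ?thesis by simp
    next
      case (Suc r)
      have le: "real r * t' \<le> pi"
        using less.prems Suc assms by (simp add: algebra_simps) 
      have IH: "chebB r (node t') \<le> chebB r (node t)" "chebB s (node t') \<le> chebB s (node t)"
        using less.IH[of r] le less.prems Suc by auto
      have "chebB (Suc s) (node t') = chebB r (node t') + 2 * cos (real s * t')"
        "chebB (Suc s) (node t) = chebB r (node t) + 2 * cos (real s * t)"
        using chebB_two_step[of r] Suc by (metis add.commute diff_add_cancel)+
      then show ?thesis
        using IH *[of s] less.prems by auto
    qed
  qed
  then show ?thesis
    using assms(3) by blast
qed

lemma chebB_node_nonneg:
  assumes "0 \<le> t" "t < pi" "real s * t \<le> pi"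
  shows "0 \<le> chebB s (node t)"
proof (cases "t = 0")
  case True
  then show ?thesis
    by (simp add: node_def chebB_0)
next
  case False
  have "chebB s (node t) * sin t = sin (0 + real s * t)" for s
  proof (rule linear_recursion_unique[where c = "2 * cos t"])
    show "sin (0 + real (Suc (Suc s)) * t) = 2 * cos t * sin (0 + real (Suc s) * t) - sin (0 + real s * t)" for s
      by (rule sin_step)
  qed (simp_all add: node_rec algebra_simps del: chebB.simps(3) chebG.simps(3))
  then have "chebB s (node t) * sin t = sin (real s * t)"
    by simp
  moreover have "0 \<le> sin (real s * t)" "0 < sin t"
    using assms False by (auto intro!: sin_ge_zero sin_gt_zero)
  ultimately show ?thesis
    by (metis mult_less_0_iff not_less)
qed

text \<open>The product form of the sign condition covers rising and falling branches alike, and R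
  alternates between the two.\<close>

lemma IVT_strict:
  fixes f :: "real \<Rightarrow> real"
  assumes "continuous_on UNIV f" "a < b" "(f a - y) * (f b - y) < 0"
  shows "\<exists>x. a < x \<and> x < b \<and> f x = y"
proof -
  have c: "continuous_on {a..b} f"
    using assms(1) continuous_on_subset by blast
  have "\<exists>x. a \<le> x \<and> x \<le> b \<and> f x = y"
  proof (cases "f a < y")
    case True
    then have "y < f b"
      using assms(3) by (simp add: mult_less_0_iff)
    then show ?thesis
      using IVT'[of f a y b] c True assms(2) by auto
  next
    case False
    then have "y < f a" "f b < y"
      using assms(3) by (auto simp: mult_less_0_iff)
    then show ?thesis
      using IVT2'[of f b y a] c assms(2) by auto
  qed
  then obtain x where "a \<le> x" "x \<le> b" "f x = y"
    by auto
  moreover have "x \<noteq> a" "x \<noteq> b"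
    using assms(3) \<open>f x = y\<close> by auto
  ultimately show ?thesis
    by force
qed

lemma abs_diff_halves: "\<bar>z - x\<bar> \<le> d / 2 \<Longrightarrow> \<bar>z - y\<bar> \<le> d / 2 \<Longrightarrow> \<bar>x - y\<bar> \<le> d"
  for x y z d :: real
  by linarith

lemma abs_diff_halves': "\<bar>x - z\<bar> \<le> d / 2 \<Longrightarrow> \<bar>y - z\<bar> \<le> d / 2 \<Longrightarrow> \<bar>x - y\<bar> \<le> d"
  for x y z d :: real
  by linarith

lemma half_distrib: "(a + 1 / 2) * d = a * d + d / 2" for a d :: real
  by (simp add: algebra_simps)

lemma half_distrib': "(a + 1) * d = (a + 1 / 2) * d + d / 2" for a d :: real
  by (simp add: algebra_simps)

section \<open>The decimation polynomial and its factors\<close>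

locale vicsek =
  fixes n :: nat
  assumes n_ge_2: "2 \<le> n"
begin

text \<open>Up to the common sign \<open>(-1) ^ (n - 1)\<close>, which comes from the change of argument from
  \<open>3 * l - 1\<close> to \<open>1 - 3 * l\<close>, \<open>gp\<close> and \<open>kp\<close> are the polynomials \<open>g\<close> and \<open>h\<close> of the
  context, so \<open>dec\<close> is \<open>R\<close>. The zeros of \<open>hp\<close> are the ends \<open>R = 4 / 3\<close> of the odd bands
  but the last one.\<close>

definition gp :: "real \<Rightarrow> real" where "gp l = chebG n l"

definition hp :: "real \<Rightarrow> real" where "hp l = chebB n l - chebB (n - 1) l"

definition kp :: "real \<Rightarrow> real" where "kp l = chebB n l + 3 * chebB (n - 1) l"

text \<open>The coefficient left for the central subcell after its four legs are eliminated: the sum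
  over that subcell, times \<open>ep l\<close>, is \<open>2 * kap l\<close> times the sum over the
  parent cell.\<close>

definition ep :: "real \<Rightarrow> real" where "ep l = (4 - 6 * l) * chebG n l - 4 * chebG (n - 1) l"

definition kap :: "real \<Rightarrow> real" where "kap l = 4 - 3 * l"

definition dec :: "real \<Rightarrow> real" where "dec l = l * gp l * kp l"

lemma Suc_n1: "Suc (n - 1) = n" "Suc (Suc (n - 2)) = n" "n - 1 = Suc (n - 2)"
  using n_ge_2 by auto

lemma gp_eq: "gp l = chebB n l + chebB (n - 1) l"
  using chebG_Suc[of "n - 1" l] Suc_n1(1) by (simp add: gp_def)

lemma cassini: "chebB n l ^ 2 + chebB (n - 1) l ^ 2 - (2 - 6 * l) * chebB n l * chebB (n - 1) l = 1"
  using chebB_cassini[of "n - 1" l] Suc_n1(1) by simp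

lemma ep_eq: "ep l = (8 - 6 * l) * chebB n l - (8 - 18 * l) * chebB (n - 1) l"
proof -
  have 1: "chebG (n - 1) l = chebB (n - 1) l + chebB (n - 2) l"
    using chebG_Suc[of "n - 2" l] Suc_n1(3) by simp
  have 2: "chebB n l = (2 - 6 * l) * chebB (n - 1) l - chebB (n - 2) l"
    using chebB.simps(3)[of "n - 2" l] Suc_n1(2,3) by simp
  show ?thesis
    unfolding ep_def gp_eq[of l, unfolded gp_def] 1 2 by (simp add: algebra_simps)
qed

text \<open>The Cassini identity makes 8 - 6 R factor. So R = 4/3 exactly where \<open>ep\<close> or
  \<open>hp\<close> vanishes, and zeros of \<open>hp\<close> with \<open>ep\<close> nonzero are the
  places to which eigenfunctions for 4/3 can be extended.\<close>

lemma ep_hp: "ep l * hp l = 8 - 6 * dec l"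
proof -
  define b where "b = chebB n l"
  define c where "c = chebB (n - 1) l"
  have "b^2 + c^2 - (2 - 6 * l) * b * c = 1"
    unfolding b_def c_def by (rule cassini)
  then have "((8 - 6 * l) * b - (8 - 18 * l) * c) * (b - c) = 8 - 6 * (l * (b + c) * (b + 3 * c))"
    by algebra
  then show ?thesis
    by (simp add: ep_eq hp_def dec_def gp_eq kp_def b_def c_def)
qed

lemma continuous_on_combos [continuous_intros]:
  "continuous_on A gp" "continuous_on A hp" "continuous_on A kp" "continuous_on A ep"
  "continuous_on A dec" "continuous_on A kap"
  unfolding gp_def[abs_def] hp_def[abs_def] kp_def[abs_def] ep_def[abs_def] dec_def[abs_def] kap_def[abs_def]
  by (intro continuous_intros)+

lemma dec_0: "dec 0 = 0"
  by (simp add: dec_def)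

lemma combos_0: "gp 0 = 2 * real n - 1" "kp 0 = 4 * real n - 3" "ep 0 = 8" "hp 0 = 1"
  using n_ge_2 by (simp_all add: gp_def kp_def ep_def hp_def chebB_0 chebG_0 of_nat_diff)

text \<open>In other words R l = rho l + O(l^2): the renormalization constant is the derivative of R
  at 0.\<close>

lemma gp_kp_expansion:
  "\<exists>q. continuous_on UNIV q \<and> (\<forall>l. gp l * kp l = vs_rho n + l * q l)"
proof -
  obtain q1 where q1: "continuous_on UNIV q1" "\<forall>l. chebB n l = real n + l * q1 l"
    using chebB_expansion by blast
  obtain q2 where q2: "continuous_on UNIV q2" "\<forall>l. chebB (n - 1) l = real (n - 1) + l * q2 l"
    using chebB_expansion by blast
  let ?g = "2 * real n - 1" and ?k = "4 * real n - 3"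
  let ?q = "\<lambda>l. ?g * (q1 l + 3 * q2 l) + ?k * (q1 l + q2 l) + l * (q1 l + q2 l) * (q1 l + 3 * q2 l)"
  have "continuous_on UNIV ?q"
    using q1 q2 by (intro continuous_intros)
  moreover have "gp l * kp l = vs_rho n + l * ?q l" for l
  proof -
    have r: "real (n - 1) = real n - 1"
      using n_ge_2 by (simp add: of_nat_diff)
    show ?thesis
      unfolding gp_eq kp_def q1(2)[rule_format] q2(2)[rule_format] r vs_rho_def by (simp add: algebra_simps)
  qed
  ultimately show ?thesis
    by blast
qed

section \<open>Zeros of \<open>hp\<close> (odd k) and \<open>gp\<close> (even k) at the angles k pi
  / (2 n - 1)\<close>

definition ang :: "nat \<Rightarrow> real" where "ang k = real k * pi / (2 * real n - 1)"

lemma ang_0: "ang 0 = 0"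
  by (simp add: ang_def)

lemma ang_less: "i < k \<Longrightarrow> ang i < ang k"
  using n_ge_2 by (simp add: ang_def divide_strict_right_mono)

lemma ang_nonneg: "0 \<le> ang k"
  using n_ge_2 by (simp add: ang_def)

lemma ang_le_pi: "k \<le> 2 * n - 1 \<Longrightarrow> ang k \<le> pi"
proof -
  assume "k \<le> 2 * n - 1"
  then have "real k \<le> 2 * real n - 1"
    using n_ge_2 by linarith
  then have "real k * pi \<le> (2 * real n - 1) * pi"
    by (intro mult_right_mono) auto
  then show ?thesis
    using n_ge_2 unfolding ang_def by (subst pos_divide_le_eq) (auto simp: algebra_simps)
qed

lemma ang_1_le: "ang 1 \<le> pi / 3"
proof -
  have "1 / (2 * real n - 1) \<le> 1 / 3"
    using n_ge_2 by (intro divide_left_mono) auto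
  then have "pi * (1 / (2 * real n - 1)) \<le> pi * (1 / 3)"
    by (intro mult_left_mono) auto
  then show ?thesis
    by (simp add: ang_def)
qed

lemma ang_half: "(real n - 1/2) * ang k = real k * pi / 2"
  using n_ge_2 by (simp add: ang_def field_simps)

abbreviation nd :: "nat \<Rightarrow> real" where "nd k \<equiv> node (ang k)"

lemma nd_less: "i < k \<Longrightarrow> k \<le> 2 * n - 1 \<Longrightarrow> nd i < nd k"
  unfolding node_def using ang_less[of i k] ang_nonneg[of i] ang_le_pi[of k]
  by (simp add: cos_monotone_0_pi)

lemma nd_0: "nd 0 = 0"
  by (simp add: node_def ang_0)

lemma node_le: "node t \<le> 2 / 3"
  unfolding node_def by (rule divide_right_mono) (use cos_ge_minus_one[of t] in auto)

lemma nd_1_le: "nd 1 \<le> 1 / 6"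
proof -
  have "cos (pi / 3) \<le> cos (ang 1)"
    using ang_1_le ang_nonneg[of 1] by (intro cos_monotone_0_pi_le) auto
  then show ?thesis
    by (simp add: node_def cos_60)
qed

lemma hp_node: "hp (node t) * cos (t / 2) = cos ((real n - 1/2) * t)"
proof -
  have "real (n - 1) + 1/2 = real n - 1/2"
    using n_ge_2 by (simp add: of_nat_diff)
  then show ?thesis
    using chebB_diff_node[of "n - 1" t] unfolding Suc_n1(1) hp_def by simp
qed

lemma gp_node: "gp (node t) * sin (t / 2) = sin ((real n - 1/2) * t)"
  unfolding gp_def by (rule chebG_node)

lemma ep_node: "ep (node t) = 2 * cos (real n * t) + 6 * cos (real (n - 1) * t)"
  using chebG_corner_node[of t "n - 1"] unfolding Suc_n1(1) ep_def .

lemma half_ang: assumes "k < 2 * n - 1" shows "0 \<le> ang k / 2" "ang k / 2 < pi / 2"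
  using ang_less[OF assms] ang_le_pi[of "2 * n - 1"] ang_nonneg[of k] by auto

lemma cos_half_ang: assumes "k < 2 * n - 1" shows "0 < cos (ang k / 2)"
  using half_ang[OF assms] by (intro cos_gt_zero_pi) auto

lemma sin_half_ang: assumes "0 < k" "k < 2 * n - 1" shows "0 < sin (ang k / 2)"
  using half_ang[OF assms(2)] ang_less[of 0 k] assms ang_0 by (intro sin_gt_zero) auto

text \<open>At this angle the cosine in \<open>hp_node\<close> vanishes and the sine in
  \<open>gp_node\<close> is (-1)^j. Since R is positive there, \<open>kp\<close> has the same sign
  as \<open>gp\<close>; these signs locate the zeros of \<open>kp\<close>.\<close>

lemma nd_odd:
  assumes "j \<le> n - 2"
  shows "hp (nd (2 * j + 1)) = 0" "dec (nd (2 * j + 1)) = 4 / 3" "0 < (-1) ^ j * gp (nd (2 * j + 1))"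
    "0 < (-1) ^ j * kp (nd (2 * j + 1))" "gp (nd (2 * j + 1)) \<noteq> 0" "ep (nd (2 * j + 1)) \<noteq> 0"
proof -
  let ?k = "2 * j + 1"
  have k: "0 < ?k" "?k < 2 * n - 1" "?k \<le> 2 * n - 1"
    using assms n_ge_2 by auto
  have ps: "(real n - 1/2) * ang ?k = real (Suc (2 * j)) * pi / 2"
    using ang_half[of ?k] by simp
  show h0: "hp (nd ?k) = 0"
  proof -
    have "cos ((real n - 1/2) * ang ?k) = 0"
      unfolding ps using sin_cos_npi[of j] cos_pi_eq_zero[of j] by (simp add: mult.commute)
    then show ?thesis
      using hp_node[of "ang ?k"] cos_half_ang[OF k(2)] by (metis less_irrefl mult_eq_0_iff)
  qed
  then show d: "dec (nd ?k) = 4 / 3"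
    using ep_hp[of "nd ?k"] by simp
  have "gp (nd ?k) * sin (ang ?k / 2) = (-1) ^ j"
    unfolding gp_node ps by (rule sin_cos_npi)
  then have "((-1) ^ j * gp (nd ?k)) * sin (ang ?k / 2) = 1"
    by (simp add: mult.assoc)
  then have "0 < ((-1) ^ j * gp (nd ?k)) * sin (ang ?k / 2)"
    by simp
  then show g: "0 < (-1) ^ j * gp (nd ?k)"
    using sin_half_ang[OF k(1,2)] zero_less_mult_pos2 by blast
  then show "gp (nd ?k) \<noteq> 0"
    by auto
  have pos: "0 < nd ?k"
    using nd_less[OF k(1,3)] nd_0 by simp
  have "nd ?k * (((-1) ^ j * gp (nd ?k)) * ((-1) ^ j * kp (nd ?k))) = 4 / 3"
    using d unfolding dec_def by (simp add: mult.assoc mult.left_commute)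
  then have "0 < nd ?k * (((-1) ^ j * gp (nd ?k)) * ((-1) ^ j * kp (nd ?k)))"
    by simp
  then show "0 < (-1) ^ j * kp (nd ?k)"
    using pos g by (metis zero_less_mult_pos)
  have "chebB n (nd ?k) = chebB (n - 1) (nd ?k)"
    using h0 by (simp add: hp_def)
  then have "ep (nd ?k) = 6 * nd ?k * gp (nd ?k)"
    unfolding ep_eq gp_eq by (simp add: algebra_simps)
  then show "ep (nd ?k) \<noteq> 0"
    using pos g by auto
qed

lemma nd_even:
  assumes "0 < j" "j \<le> n - 1"
  shows "dec (nd (2 * j)) = 0" "(-1) ^ j * kp (nd (2 * j)) < 0"
proof -
  let ?k = "2 * j"
  have k: "0 < ?k" "?k < 2 * n - 1"
    using assms by auto
  have ps: "(real n - 1/2) * ang ?k = real j * pi"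
    using ang_half[of ?k] by simp
  have g0: "gp (nd ?k) = 0"
    using gp_node[of "ang ?k"] sin_half_ang[OF k] unfolding ps sin_npi by (metis less_irrefl mult_eq_0_iff)
  then show "dec (nd ?k) = 0"
    by (simp add: dec_def)
  have "hp (nd ?k) * cos (ang ?k / 2) = (-1) ^ j"
    unfolding hp_node ps by (rule cos_npi)
  then have "((-1) ^ j * hp (nd ?k)) * cos (ang ?k / 2) = 1"
    by (simp add: mult.assoc)
  then have "0 < ((-1) ^ j * hp (nd ?k)) * cos (ang ?k / 2)"
    by simp
  then have "0 < (-1) ^ j * hp (nd ?k)"
    using cos_half_ang[OF k(2)] zero_less_mult_pos2 by blast
  moreover have "kp (nd ?k) = - hp (nd ?k)"
    using g0 unfolding gp_eq kp_def hp_def by simp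
  ultimately show "(-1) ^ j * kp (nd (2 * j)) < 0"
    by simp
qed

text \<open>At 4/3 the recursion coefficient is -6, so the values alternate in sign and their
  absolute values grow at least fivefold.\<close>

lemma chebB_top:
  "1 \<le> (-1) ^ s * chebB (Suc s) (4/3) \<and> 5 * ((-1) ^ s * chebB (Suc s) (4/3)) \<le> (-1) ^ Suc s * chebB (Suc (Suc s)) (4/3)"
  by (induction s) (auto simp: algebra_simps)

text \<open>Since R already exceeds 4/3 at 4/3, the last band ends strictly below 4/3. The gap left
  there is the source of the left limits.\<close>

lemma top_values: "4 / 3 < dec (4 / 3)" "0 < (-1) ^ (n - 1) * kp (4 / 3)"
proof -
  define b where "b = (-1) ^ (n - 1) * chebB n (4/3)"
  define c where "c = (-1) ^ (n - 2) * chebB (n - 1) (4/3)"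
  have bc: "1 \<le> c" "5 * c \<le> b"
    using chebB_top[of "n - 2"] unfolding b_def c_def by (simp_all only: Suc_n1)
  have m: "(-1) ^ (n - 1) = - ((-1::real) ^ (n - 2))"
    using Suc_n1(3) by (metis mult_minus1 power_Suc)
  have g: "(-1) ^ (n - 1) * gp (4/3) = b - c"
    unfolding gp_eq b_def c_def m by (simp add: algebra_simps)
  have k: "(-1) ^ (n - 1) * kp (4/3) = b - 3 * c"
    unfolding kp_def b_def c_def m by (simp add: algebra_simps)
  show "0 < (-1) ^ (n - 1) * kp (4 / 3)"
    unfolding k using bc by simp
  have "dec (4/3) = (4/3) * (((-1) ^ (n - 1) * gp (4/3)) * ((-1) ^ (n - 1) * kp (4/3)))"
    unfolding dec_def by (simp add: mult.assoc mult.left_commute)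
  also have "\<dots> = (4/3) * ((b - c) * (b - 3 * c))"
    unfolding g k ..
  also have "\<dots> > 4 / 3"
  proof -
    have "4 * 2 \<le> (b - c) * (b - 3 * c)"
      using bc by (intro mult_mono) auto
    then show ?thesis by simp
  qed
  finally show "4 / 3 < dec (4 / 3)" .
qed

text \<open>At a zero of \<open>gp\<close> the polynomial \<open>kp\<close> equals -
  \<open>hp\<close>, whose sign is known from \<open>hp_node\<close>. It is opposite to the sign of
  \<open>kp\<close> at the next top of a band, or at 4/3 for the last band.\<close>

lemma kp_root:
  assumes "0 < j" "j \<le> n - 1"
  shows "\<exists>x. nd (2 * j) < x \<and> x < (if j = n - 1 then 4 / 3 else nd (2 * j + 1)) \<and> kp x = 0"
proof -
  have neg: "(-1) ^ j * kp (nd (2 * j)) < 0"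
    using nd_even(2)[OF assms] .
  have gen: "\<exists>x. nd (2 * j) < x \<and> x < c \<and> kp x = 0" if c: "nd (2 * j) < c" "0 < (-1) ^ j * kp c" for c
  proof (rule IVT_strict)
    have "((-1) ^ j * kp (nd (2 * j))) * ((-1) ^ j * kp c) < 0"
      using neg c(2) by (rule mult_neg_pos)
    then show "(kp (nd (2 * j)) - 0) * (kp c - 0) < 0"
      by (simp add: mult.assoc mult.left_commute)
  qed (use c in \<open>auto intro: continuous_intros\<close>)
  show ?thesis
  proof (cases "j = n - 1")
    case True
    have "nd (2 * j) < 4 / 3"
      using node_le[of "ang (2 * j)"] by simp
    then show ?thesis
      using gen[of "4 / 3"] top_values(2) True by simp
  next
    case False
    have "nd (2 * j) < nd (2 * j + 1)"
      using assms False n_ge_2 by (intro nd_less) auto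
    moreover have "0 < (-1) ^ j * kp (nd (2 * j + 1))"
      using assms False by (intro nd_odd(4)) auto
    ultimately show ?thesis
      using gen[of "nd (2 * j + 1)"] False by simp
  qed
qed

text \<open>\<open>zp j\<close> and \<open>tp j\<close> are the ends \<open>\<phi> (2 * j + 1) 0\<close> and \<open>\<phi> (2 * j + 1) (4 / 3)\<close> of the odd bands.\<close>

definition zp :: "nat \<Rightarrow> real" where
  "zp j = (if j = 0 then 0 else
     (SOME x. nd (2 * j) < x \<and> x < (if j = n - 1 then 4 / 3 else nd (2 * j + 1)) \<and> kp x = 0))"

lemma zp_pos:
  assumes "0 < j" "j \<le> n - 1"
  shows "nd (2 * j) < zp j" "zp j < 4 / 3" "j < n - 1 \<Longrightarrow> zp j < nd (2 * j + 1)" "kp (zp j) = 0"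
proof -
  have *: "nd (2 * j) < zp j \<and> zp j < (if j = n - 1 then 4 / 3 else nd (2 * j + 1)) \<and> kp (zp j) = 0"
    using someI_ex[OF kp_root[OF assms]] assms unfolding zp_def by simp
  then show "nd (2 * j) < zp j" "j < n - 1 \<Longrightarrow> zp j < nd (2 * j + 1)" "kp (zp j) = 0"
    by auto
  show "zp j < 4 / 3"
    using * node_le[of "ang (2 * j + 1)"] by (auto split: if_splits)
qed

lemma dec_zp: "j \<le> n - 1 \<Longrightarrow> dec (zp j) = 0"
  using zp_pos(4)[of j] by (cases "j = 0") (auto simp: zp_def dec_def)

lemma tp_last: "\<exists>x. zp (n - 1) < x \<and> x < 4 / 3 \<and> dec x = 4 / 3"
proof -
  have "0 < n - 1" using n_ge_2 by simp
  then show ?thesis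
    using zp_pos(2)[of "n - 1"] dec_zp[of "n - 1"] top_values(1)
    by (intro IVT_strict) (auto intro: continuous_intros simp: mult_less_0_iff)
qed

definition tp :: "nat \<Rightarrow> real" where
  "tp j = (if j < n - 1 then nd (2 * j + 1) else (SOME x. zp (n - 1) < x \<and> x < 4 / 3 \<and> dec x = 4 / 3))"

lemma tp_last_props: "zp (n - 1) < tp (n - 1)" "tp (n - 1) < 4 / 3" "dec (tp (n - 1)) = 4 / 3"
  using someI_ex[OF tp_last] by (auto simp: tp_def)

lemma dec_tp: "j \<le> n - 1 \<Longrightarrow> dec (tp j) = 4 / 3"
proof (cases "j < n - 1")
  case True
  then show ?thesis
    using nd_odd(2)[of j] by (simp add: tp_def)
next
  case False
  assume "j \<le> n - 1"
  then show ?thesis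
    using tp_last_props False by (metis le_neq_implies_less)
qed

lemma zp_less_tp: "j \<le> n - 1 \<Longrightarrow> zp j < tp j"
proof -
  assume j: "j \<le> n - 1"
  consider "j = n - 1" | "0 < j" "j < n - 1" | "j = 0" "j < n - 1"
    using j by linarith
  then show ?thesis
  proof cases
    case 3
    then show ?thesis
      using nd_less[of 0 1] nd_0 n_ge_2 by (simp add: zp_def tp_def)
  qed (use zp_pos(3)[of j] j tp_last_props in \<open>auto simp: tp_def\<close>)
qed

lemma tp_less_nd: "j < n - 1 \<Longrightarrow> tp j < nd (2 * (j + 1))"
  using nd_less[of "2 * j + 1" "2 * (j + 1)"] by (simp add: tp_def)

lemma tp_less: "j \<le> n - 1 \<Longrightarrow> tp j < 4 / 3"
  using tp_last_props node_le[of "ang (2 * j + 1)"] by (cases "j = n - 1") (auto simp: tp_def)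

text \<open>The three denominators that occur in \<open>base\<close>, \<open>leg\<close> and
  \<open>ext\<close>.\<close>

definition nonsing :: "real \<Rightarrow> bool" where
  "nonsing l \<longleftrightarrow> kap l \<noteq> 0 \<and> gp l \<noteq> 0 \<and> ep l \<noteq> 0"

lemma nonsing_generic: "dec l \<noteq> 0 \<Longrightarrow> dec l \<noteq> 4 / 3 \<Longrightarrow> l < 4 / 3 \<Longrightarrow> nonsing l"
  using ep_hp[of l] by (auto simp: nonsing_def kap_def dec_def)

lemma nonsing_zp: "j \<le> n - 1 \<Longrightarrow> nonsing (zp j)"
proof -
  assume j: "j \<le> n - 1"
  have "ep (zp j) * hp (zp j) = 8"
    using ep_hp[of "zp j"] dec_zp[OF j] by simp
  then have e: "ep (zp j) \<noteq> 0" "hp (zp j) \<noteq> 0"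
    by auto
  have "gp (zp j) \<noteq> 0"
  proof (cases "j = 0")
    case True
    then show ?thesis
      using combos_0(1) n_ge_2 by (auto simp: zp_def)
  next
    case False
    then have "kp (zp j) = 0"
      using zp_pos(4)[of j] j by simp
    then have "gp (zp j) = -2 * chebB (n - 1) (zp j)" "hp (zp j) = -4 * chebB (n - 1) (zp j)"
      unfolding kp_def gp_eq hp_def by auto
    then show ?thesis
      using e(2) by auto
  qed
  moreover have "kap (zp j) \<noteq> 0"
    using zp_less_tp[OF j] tp_less[OF j] by (simp add: kap_def)
  ultimately show ?thesis
    using e by (simp add: nonsing_def)
qed

text \<open>The last band is different: the zeros of \<open>hp\<close> all belong to the earlier
  tops, so at \<open>tp (n - 1)\<close> it is \<open>ep\<close> that vanishes. This is the condition
  that the first branch of the 4/3-series is not 2 n - 1.\<close>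

lemma nonsing_tp: "j < n - 1 \<Longrightarrow> nonsing (tp j)"
  using nd_odd(5,6)[of j] tp_less[of j] by (simp add: nonsing_def kap_def tp_def)

lemma band_odd:
  assumes "j \<le> n - 1" "0 < y" "y < 4 / 3"
  shows "\<exists>x. zp j < x \<and> x < tp j \<and> dec x = y"
  using assms zp_less_tp[of j] dec_zp[of j] dec_tp[of j]
  by (intro IVT_strict) (auto intro: continuous_intros simp: mult_less_0_iff)

text \<open>R falls to 0 at the zero \<open>nd (2 * (j + 1))\<close> of \<open>gp\<close>, strictly
  before \<open>zp (j + 1)\<close>. The longer interval tiles the line together with the odd
  bands.\<close>

lemma band_even:
  assumes "j < n - 1" "0 < y" "y < 4 / 3"
  shows "\<exists>x. tp j < x \<and> x < zp (j + 1) \<and> dec x = y"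
proof -
  have "\<exists>x. tp j < x \<and> x < nd (2 * (j + 1)) \<and> dec x = y"
    using assms tp_less_nd[of j] nd_even(1)[of "j + 1"] dec_tp[of j]
    by (intro IVT_strict) (auto intro: continuous_intros simp: mult_less_0_iff)
  then show ?thesis
    using zp_pos(1)[of "j + 1"] assms(1) by force
qed

lemma tp_less_zp: "j < n - 1 \<Longrightarrow> tp j < zp (j + 1)"
  using tp_less_nd[of j] zp_pos(1)[of "j + 1"] by force

lemma zp_0: "zp 0 = 0"
  by (simp add: zp_def)

lemma tp_0: "tp 0 = nd 1"
  using n_ge_2 by (simp add: tp_def)

section \<open>Signs and monotonicity on the first band\<close>

lemma first_band_angle:
  assumes "0 \<le> l" "l \<le> tp 0"
  obtains t where "0 \<le> t" "t \<le> ang 1" "l = node t"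
proof
  have l: "0 \<le> l" "l \<le> 1 / 6"
    using assms nd_1_le tp_0 by auto
  let ?t = "arccos (1 - 3 * l)"
  show "0 \<le> ?t"
    using l by (intro arccos_lbound) auto
  show n: "l = node ?t"
    using l by (simp add: node_def)
  show "?t \<le> ang 1"
  proof (rule ccontr)
    assume "\<not> ?t \<le> ang 1"
    then have "cos ?t < cos (ang 1)"
      using l ang_nonneg[of 1] by (intro cos_monotone_0_pi) (auto intro: arccos_ubound)
    then show False
      using n assms(2) tp_0 by (simp add: node_def)
  qed
qed

lemma first_band_bounds:
  assumes "0 \<le> t" "t \<le> ang 1"
  shows "t < pi" "real n * t \<le> pi" "(real n - 1/2) * t \<le> pi / 2" "t / 2 \<le> pi / 6"
proof -
  have "(real n - 1/2) * t \<le> (real n - 1/2) * ang 1"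
    using assms n_ge_2 by (intro mult_left_mono) auto
  also have "\<dots> = pi / 2"
    using ang_half[of 1] by simp
  finally show t: "(real n - 1/2) * t \<le> pi / 2" .
  show t2: "t / 2 \<le> pi / 6" "t < pi"
    using ang_1_le assms pi_gt_zero by linarith+
  show "real n * t \<le> pi"
    using t t2 by (simp add: algebra_simps)
qed

text \<open>These are the signs of all coefficients in \<open>leg\<close> and \<open>base\<close>.
  They make the extension a positive operator on the first band.\<close>

lemma first_band_nonneg:
  assumes "0 \<le> l" "l \<le> tp 0"
  shows "s \<le> n \<Longrightarrow> 0 \<le> chebB s l" "1 \<le> s \<Longrightarrow> s \<le> n \<Longrightarrow> 0 < chebG s l" "0 \<le> hp l"
    "0 < gp l" "0 < kp l" "0 < ep l"
proof -
  obtain t where t: "0 \<le> t" "t \<le> ang 1" "l = node t"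
    using first_band_angle[OF assms] .
  note b = first_band_bounds[OF t(1,2)]
  show B: "0 \<le> chebB s l" if "s \<le> n" for s
  proof -
    have "real s * t \<le> real n * t"
      using that t by (intro mult_right_mono) auto
    then show ?thesis
      using t b by (auto intro: chebB_node_nonneg)
  qed
  show G: "0 < chebG s l" if "1 \<le> s" "s \<le> n" for s
  proof (cases "t = 0")
    case True
    then show ?thesis
      using t that by (simp add: node_def chebG_0)
  next
    case False
    have "(real s - 1/2) * t \<le> (real n - 1/2) * t"
      using that t by (intro mult_right_mono) auto
    then have "0 < sin ((real s - 1/2) * t)"
      using b(3) that t False pi_half_less_two pi_gt_zero
      by (intro sin_gt_zero mult_pos_pos) (simp, simp, linarith)
    moreover have "0 < sin (t / 2)"
      using t False b by (intro sin_gt_zero) auto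
    ultimately show ?thesis
      using chebG_node[of s t] t(3) by (metis zero_less_mult_pos2)
  qed
  have c: "0 < cos (t / 2)"
    using b t by (intro cos_gt_zero_pi) auto
  have "0 \<le> cos ((real n - 1/2) * t)"
    using b t n_ge_2 by (intro cos_ge_zero) (auto intro: order_trans[of _ 0])
  then show h: "0 \<le> hp l"
    using hp_node[of t] t(3) c by (metis mult_neg_pos not_less)
  show g: "0 < gp l"
    using G[of n] n_ge_2 by (simp add: gp_def)
  then have b0: "0 < chebB n l"
    using gp_eq[of l] h B[of "n - 1"] by (simp add: hp_def)
  then show "0 < kp l"
    using B[of "n - 1"] by (simp add: kp_def)
  have "l \<le> 1 / 6"
    using assms tp_0 nd_1_le by simp
  \<comment> \<open>Both summands are nonnegative for l in the first band. They vanish together only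
    if l = 0 and \<open>hp l\<close> = 0, which contradicts \<open>hp 0\<close> = 1.\<close>
  have "ep l = (8 - 6 * l) * hp l + 12 * l * chebB (n - 1) l"
    unfolding ep_eq hp_def by (simp add: algebra_simps)
  moreover have "0 \<le> (8 - 6 * l) * hp l" "0 \<le> 12 * l * chebB (n - 1) l"
    using h B[of "n - 1"] assms(1) \<open>l \<le> 1 / 6\<close> by auto
  moreover have "ep l \<noteq> 0"
  proof
    assume "ep l = 0"
    then have "(8 - 6 * l) * hp l = 0" "12 * l * chebB (n - 1) l = 0"
      using calculation by linarith+
    then have "hp l = 0" "l * chebB (n - 1) l = 0"
      using \<open>l \<le> 1 / 6\<close> by auto
    then show False
      using b0 combos_0(4) by (auto simp: hp_def)
  qed
  ultimately show "0 < ep l"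
    by linarith
qed

text \<open>In the half angle h, \<open>hp\<close> is cos(M h) / cos h with M = 2 n - 1. The
  quotients are cross-multiplied, and the addition formulas turn the products into cosines of M h' +
  h, M h' - h, M h + h' and M h - h', which can be compared one by one.\<close>

lemma hp_strict_antimono:
  assumes "0 \<le> t" "t < t'" "t' \<le> ang 1"
  shows "hp (node t') < hp (node t)"
proof -
  note b = first_band_bounds[of t'] and b0 = first_band_bounds[of t]
  have c: "0 < cos (t / 2)" "0 < cos (t' / 2)"
    using b b0 assms by (auto intro!: cos_gt_zero_pi)
  let ?M = "2 * real n - 1"
  define h h' where "h = t / 2" and "h' = t' / 2"
  have hh: "0 \<le> h" "h < h'" "?M * h' \<le> pi / 2" "h' \<le> pi / 6"
    using assms b by (auto simp: h_def h'_def algebra_simps)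
  have M3: "3 \<le> ?M"
    using n_ge_2 by simp
  have m1: "?M * h + h' < ?M * h' + h"
  proof -
    have "0 < (?M - 1) * (h' - h)"
      using hh M3 by (intro mult_pos_pos) auto
    then show ?thesis
      by (simp add: algebra_simps)
  qed
  have Mh: "h \<le> ?M * h" "h' \<le> ?M * h'"
    using hh M3 by (auto simp: mult_le_cancel_right1)
  have m2: "\<bar>?M * h - h'\<bar> \<le> ?M * h' - h"
  proof -
    have "?M * h \<le> ?M * h'"
      using hh M3 by (intro mult_left_mono) auto
    then show ?thesis
      using hh Mh m1 by auto
  qed
  have "cos (?M * h' + h) < cos (?M * h + h')"
    using hh m1 M3 pi_gt_zero by (intro cos_monotone_0_pi) auto
  moreover have "cos (?M * h' - h) \<le> cos \<bar>?M * h - h'\<bar>"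
    using hh m2 M3 pi_gt_zero by (intro cos_monotone_0_pi_le) auto
  ultimately have "cos (?M * h') * cos h < cos (?M * h) * cos h'"
    by (simp add: cos_add cos_diff)
  moreover have "cos (?M * h') = hp (node t') * cos h'" "cos (?M * h) = hp (node t) * cos h"
    using hp_node[of t] hp_node[of t'] by (auto simp: h_def h'_def algebra_simps)
  ultimately have "hp (node t') * (cos h * cos h') < hp (node t) * (cos h * cos h')"
    by (simp add: mult_ac)
  then show ?thesis
    using c by (simp add: h_def h'_def)
qed

lemma node_less_iff: "0 \<le> t \<Longrightarrow> t \<le> pi \<Longrightarrow> 0 \<le> t' \<Longrightarrow> t' \<le> pi \<Longrightarrow> node t < node t' \<longleftrightarrow> t < t'"
  by (simp add: node_def cos_mono_less_eq)

lemma first_band_pair: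
  assumes "0 \<le> l" "l < l'" "l' \<le> tp 0"
  obtains t t' where "0 \<le> t" "t < t'" "t' \<le> ang 1" "l = node t" "l' = node t'"
proof -
  obtain t where t: "0 \<le> t" "t \<le> ang 1" "l = node t"
    using first_band_angle[of l] assms by auto
  obtain t' where t': "0 \<le> t'" "t' \<le> ang 1" "l' = node t'"
    using first_band_angle[of l'] assms by auto
  have "t < t'"
    using assms(2) node_less_iff[of t t'] t t' first_band_bounds(1) by (simp add: less_imp_le)
  then show ?thesis
    using that t t' by blast
qed

text \<open>R l / l is nonincreasing because the values of \<open>chebB\<close> in it are. This
  makes the rescaled iterates of the inverse branch increase and their limit strictly
  monotone.\<close>

lemma gp_kp_antimono:
  assumes "0 \<le> l" "l \<le> l'" "l' \<le> tp 0"
  shows "gp l' * kp l' \<le> gp l * kp l"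
proof (cases "l = l'")
  case False
  then obtain t t' where t: "0 \<le> t" "t < t'" "t' \<le> ang 1" "l = node t" "l' = node t'"
    using first_band_pair assms by (metis less_le)
  have n1: "real (n - 1) * t' \<le> pi"
  proof -
    have "real (n - 1) * t' \<le> real n * t'"
      using t by (intro mult_right_mono) auto
    moreover have "real n * t' \<le> pi"
      using first_band_bounds(2)[of t'] t by auto
    ultimately show ?thesis
      by linarith
  qed
  have "chebB n l' \<le> chebB n l" "chebB (n - 1) l' \<le> chebB (n - 1) l"
    using t n1 first_band_bounds(2)[of t'] by (auto intro!: chebB_node_antimono)
  then show ?thesis
    using first_band_nonneg(4,5)[of l] first_band_nonneg(4,5)[of l'] assms
    by (intro mult_mono) (auto simp: gp_eq kp_def)
qed simp

text \<open>By \<open>ep_hp\<close>, 8 - 6 R is a product of two decreasing factors. The decrease is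
  strict because that of \<open>hp\<close> is and \<open>ep\<close> is positive.\<close>

lemma dec_strict_mono:
  assumes "0 \<le> l" "l < l'" "l' \<le> tp 0"
  shows "dec l < dec l'"
proof -
  obtain t t' where t: "0 \<le> t" "t < t'" "t' \<le> ang 1" "l = node t" "l' = node t'"
    using first_band_pair assms by blast
  have h: "hp l' < hp l" "0 \<le> hp l'"
    using hp_strict_antimono t first_band_nonneg(3)[of l'] assms by auto
  have e: "ep l' \<le> ep l" "0 < ep l"
  proof -
    have b: "real n * t' \<le> pi" "real (n - 1) * t' \<le> pi"
    proof -
      show "real n * t' \<le> pi"
        using first_band_bounds(2)[of t'] t by auto
      moreover have "real (n - 1) * t' \<le> real n * t'"
        using t by (intro mult_right_mono) auto
      ultimately show "real (n - 1) * t' \<le> pi"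
        by auto
    qed
    have "cos (real n * t') \<le> cos (real n * t)" "cos (real (n - 1) * t') \<le> cos (real (n - 1) * t)"
      using b t by (auto intro!: cos_monotone_0_pi_le mult_left_mono)
    then show "ep l' \<le> ep l"
      using t by (simp add: ep_node)
    show "0 < ep l"
      using first_band_nonneg(6)[of l] assms by auto
  qed
  have "ep l' * hp l' \<le> ep l * hp l'"
    using e h by (intro mult_right_mono)
  also have "\<dots> < ep l * hp l"
    using e h by simp
  finally show ?thesis
    using ep_hp[of l] ep_hp[of l'] by simp
qed

end

section \<open>The graphs in integer coordinates\<close>

type_synonym pt2 = "int \<times> int"

definition cor :: "pt2 set" where "cor = {0, 1} \<times> {0, 1}"

lemma finite_cor [simp]: "finite cor"
  by (simp add: cor_def)

lemma corE:
  assumes "e \<in> cor"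
  obtains "e = (0, 0)" | "e = (0, 1)" | "e = (1, 0)" | "e = (1, 1)"
  using assms by (auto simp: cor_def)

lemma corE2:
  assumes "(i, j) \<in> cor"
  obtains "i = 0" "j = 0" | "i = 0" "j = 1" | "i = 1" "j = 0" | "i = 1" "j = 1"
  using assms by (auto simp: cor_def)

definition opp :: "pt2 \<Rightarrow> pt2" where "opp e = (1 - fst e, 1 - snd e)"

definition cell_sum :: "(pt2 \<Rightarrow> real) \<Rightarrow> pt2 \<Rightarrow> real" where
  "cell_sum u A = (\<Sum>e\<in>cor. u (A + e))"

lemma sum_cor: "(\<Sum>e\<in>cor. f e) = f (0, 0) + f (0, 1) + f (1, 0) + f (1, 1 :: int)"
  for f :: "pt2 \<Rightarrow> real"
proof -
  have "cor = {(0, 0), (0, 1), (1, 0), (1, 1)}"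
    by (auto simp: cor_def)
  show ?thesis
    unfolding \<open>cor = _\<close> by (simp add: add.assoc)
qed

lemma cell_sum_add: "cell_sum (\<lambda>x. u x + v x) A = cell_sum u A + cell_sum v A"
  by (simp add: cell_sum_def sum.distrib)

lemma cell_sum_scale: "cell_sum (\<lambda>x. c * u x) A = c * cell_sum u A"
  by (simp add: cell_sum_def sum_distrib_left)

context vicsek
begin

definition L :: int where "L = 2 * int n - 1"

definition mid :: int where "mid = int n - 1"

lemma L_mid: "L = 2 * mid + 1" "1 \<le> mid" "3 \<le> L"
  using n_ge_2 by (auto simp: L_def mid_def)

text \<open>Cells and vertices of level \<open>m\<close> have integer coordinates, the unit being the side of an
  \<open>m\<close>-cell; a cell is named by its lower left corner. \<open>sub A s e\<close> is the subcell of \<open>A\<close> at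
  distance \<open>s\<close> from the central one on the leg towards the corner \<open>e\<close>.\<close>

fun sub :: "pt2 \<Rightarrow> nat \<Rightarrow> pt2 \<Rightarrow> pt2" where
  "sub (a, b) s (i, j) = (L * a + mid + int s * (2 * i - 1), L * b + mid + int s * (2 * j - 1))"

primrec cel :: "nat \<Rightarrow> pt2 set" where
  "cel 0 = {(0, 0)}"
| "cel (Suc m) = {sub A s e | A s e. A \<in> cel m \<and> s < n \<and> e \<in> cor}"

definition cells_at :: "nat \<Rightarrow> pt2 \<Rightarrow> pt2 set" where "cells_at m Q = {A \<in> cel m. Q - A \<in> cor}"

definition vert :: "nat \<Rightarrow> pt2 set" where "vert m = {A + e | A e. A \<in> cel m \<and> e \<in> cor}"

declare sub.simps [simp del]

lemma subI: "A \<in> cel m \<Longrightarrow> s < n \<Longrightarrow> e \<in> cor \<Longrightarrow> sub A s e \<in> cel (Suc m)"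
  unfolding cel.simps by blast

lemma coord_offset:
  assumes "int s \<le> mid" "i \<in> {0, 1}"
  shows "0 \<le> mid + int s * (2 * i - 1)" "mid + int s * (2 * i - 1) < L"
  using assms L_mid by auto

lemma L_digit:
  assumes "L * a + x = L * a' + x'" "0 \<le> x" "x < L" "0 \<le> x'" "x' < L"
  shows "a = a'" "x = x'"
proof -
  have "(x + L * a) div L = a" "(x' + L * a') div L = a'"
    using assms by simp_all
  then show "a = a'"
    using assms(1) by (simp add: add.commute)
  then show "x = x'"
    using assms(1) by simp
qed

lemma coord_eqD:
  assumes "L * a + mid + int s * (2 * i - 1) = L * a' + mid + int s' * (2 * i' - 1)"
    "int s \<le> mid" "int s' \<le> mid" "i \<in> {0, 1}" "i' \<in> {0, 1}"
  shows "a = a'" "s = s'" "s = 0 \<or> i = i'"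
proof -
  have eq: "L * a + (mid + int s * (2 * i - 1)) = L * a' + (mid + int s' * (2 * i' - 1))"
    using assms(1) by simp
  show "a = a'"
    by (rule L_digit(1)[OF eq]) (use assms coord_offset in blast)+
  have "mid + int s * (2 * i - 1) = mid + int s' * (2 * i' - 1)"
    by (rule L_digit(2)[OF eq]) (use assms coord_offset in blast)+
  then show "s = s'" "s = 0 \<or> i = i'"
    using assms(4,5) by auto
qed

lemma sub_eqD:
  assumes "sub A s e = sub A' s' e'" "s < n" "s' < n" "e \<in> cor" "e' \<in> cor"
  shows "A = A'" "s = s'" "s = 0 \<or> e = e'"
proof -
  obtain a b a' b' i j i' j' where
    eqs: "A = (a, b)" "A' = (a', b')" "e = (i, j)" "e' = (i', j')"
    by (metis surj_pair)
  have le: "int s \<le> mid" "int s' \<le> mid"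
    using assms(2,3) by (auto simp: mid_def)
  have ij: "i \<in> {0, 1}" "j \<in> {0, 1}" "i' \<in> {0, 1}" "j' \<in> {0, 1}"
    using assms(4,5) eqs by (auto simp: cor_def)
  have 1: "L * a + mid + int s * (2 * i - 1) = L * a' + mid + int s' * (2 * i' - 1)"
    and 2: "L * b + mid + int s * (2 * j - 1) = L * b' + mid + int s' * (2 * j' - 1)"
    using assms(1) unfolding eqs sub.simps prod.inject by blast+
  show "A = A'" "s = s'" "s = 0 \<or> e = e'"
    using coord_eqD[OF 1 le ij(1,3)] coord_eqD[OF 2 le ij(2,4)] eqs by auto
qed

text \<open>Cells are squares of one colour of a checkerboard; hence two of them share at most a corner,
  and only the diagonally opposite cell can share a given corner with a cell.\<close>

lemma cel_even: "A \<in> cel m \<Longrightarrow> even (fst A + snd A)"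
proof (induction m arbitrary: A)
  case (Suc m)
  then obtain B s e where A: "A = sub B s e" "B \<in> cel m" "e \<in> cor"
    by auto
  obtain a b i j where eqs: "B = (a, b)" "e = (i, j)"
    by (metis surj_pair)
  have "even (a + b)"
    using Suc.IH[OF A(2)] eqs by simp
  moreover have "fst A + snd A = L * (a + b) + 2 * mid + int s * (2 * (i + j - 1))"
    by (simp add: A(1) eqs sub.simps algebra_simps)
  ultimately show ?case
    by simp
qed simp

lemma finite_cel [simp]: "finite (cel m)"
proof (induction m)
  case (Suc m)
  have "cel (Suc m) = (\<lambda>(A, s, e). sub A s e) ` (cel m \<times> {..<n} \<times> cor)"
    by force
  then show ?case
    using Suc by simp
qed simp

lemma finite_at [simp]: "finite (cells_at m Q)"
  by (simp add: cells_at_def)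

lemma finite_vert [simp]: "finite (vert m)"
proof -
  have "vert m = (\<lambda>(A, e). A + e) ` (cel m \<times> cor)"
    by (force simp: vert_def)
  then show ?thesis
    by simp
qed

lemma vert_iff: "Q \<in> vert m \<longleftrightarrow> cells_at m Q \<noteq> {}"
proof
  assume "Q \<in> vert m"
  then obtain A e where "A \<in> cel m" "e \<in> cor" "Q = A + e"
    by (auto simp: vert_def)
  then have "A \<in> cells_at m Q"
    by (simp add: cells_at_def)
  then show "cells_at m Q \<noteq> {}"
    by blast
next
  assume "cells_at m Q \<noteq> {}"
  then obtain A where A: "A \<in> cel m" "Q - A \<in> cor"
    by (auto simp: cells_at_def)
  then have "Q = A + (Q - A)"
    by simp
  with A show "Q \<in> vert m"
    unfolding vert_def by blast
qed

lemma vertI: "A \<in> cel m \<Longrightarrow> e \<in> cor \<Longrightarrow> A + e \<in> vert m"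
  unfolding vert_def by blast

lemma card_at_pos: "Q \<in> vert m \<Longrightarrow> 0 < card (cells_at m Q)"
  by (simp add: vert_iff card_gt_0_iff)

lemma sum_incidence:
  fixes F :: "pt2 \<Rightarrow> pt2 \<Rightarrow> real"
  shows "(\<Sum>Q\<in>vert m. \<Sum>A\<in>cells_at m Q. F A Q) = (\<Sum>A\<in>cel m. \<Sum>e\<in>cor. F A (A + e))"
proof -
  have "(\<Sum>Q\<in>vert m. \<Sum>A\<in>cells_at m Q. F A Q) = (\<Sum>A\<in>cel m. \<Sum>Q\<in>{Q \<in> vert m. Q - A \<in> cor}. F A Q)"
    unfolding cells_at_def by (rule sum.swap_restrict) auto
  also have "\<dots> = (\<Sum>A\<in>cel m. \<Sum>e\<in>cor. F A (A + e))"
  proof (rule sum.cong[OF refl])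
    fix A assume "A \<in> cel m"
    then show "(\<Sum>Q\<in>{Q \<in> vert m. Q - A \<in> cor}. F A Q) = (\<Sum>e\<in>cor. F A (A + e))"
      by (intro sum.reindex_bij_witness[of _ "\<lambda>e. A + e" "\<lambda>Q. Q - A"]) (auto intro: vertI)
  qed
  finally show ?thesis .
qed

text \<open>The same point of the plane in the coordinates of the next finer grid.\<close>

definition lat :: "pt2 \<Rightarrow> pt2" where "lat q = (L * fst q, L * snd q)"

definition in_lat :: "pt2 \<Rightarrow> bool" where "in_lat Q \<longleftrightarrow> L dvd fst Q \<and> L dvd snd Q"

definition unlat :: "pt2 \<Rightarrow> pt2" where "unlat Q = (fst Q div L, snd Q div L)"

lemma lat_simps [simp]: "in_lat (lat q)" "unlat (lat q) = q" "lat q = lat q' \<longleftrightarrow> q = q'"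
  using L_mid by (auto simp: lat_def in_lat_def unlat_def prod_eq_iff)

lemma lat_unlat: "in_lat Q \<Longrightarrow> lat (unlat Q) = Q"
  by (auto simp: lat_def in_lat_def unlat_def)

lemma inj_lat: "inj_on lat A"
  by (auto simp: inj_on_def)

lemma sub_outer: "e \<in> cor \<Longrightarrow> sub A (n - 1) e + e = lat (A + e)"
proof -
  assume e: "e \<in> cor"
  have m: "int (n - 1) = mid"
    using n_ge_2 by (simp add: mid_def of_nat_diff)
  show ?thesis
    using e L_mid(1) by (cases A; elim corE) (auto simp: m m[simplified] sub.simps lat_def algebra_simps)
qed

text \<open>Relative to the parent cell, a corner of a subcell has coordinates between 0 and L.
  These are divisible by L only at the ends, which only the outer corner of an outermost subcell
  attains in both coordinates.\<close>

lemma in_lat_sub: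
  assumes "s < n" "e \<in> cor" "f \<in> cor"
  shows "in_lat (sub A s e + f) \<longleftrightarrow> s = n - 1 \<and> f = e"
proof
  assume lt: "in_lat (sub A s e + f)"
  obtain a b i j i' j' where eqs: "A = (a, b)" "e = (i, j)" "f = (i', j')"
    by (metis surj_pair)
  have le: "int s \<le> mid"
    using assms(1) by (simp add: mid_def)
  have *: "int s = mid \<and> i' = i"
    if d: "L dvd L * a + mid + int s * (2 * i - 1) + i'" "i \<in> {0, 1}" "i' \<in> {0, 1}" for a i i'
  proof -
    have "L dvd mid + int s * (2 * i - 1) + i'"
      using d(1) by (metis add.assoc dvd_add_right_iff dvd_triv_left)
    then obtain k where k: "mid + int s * (2 * i - 1) + i' = L * k"
      by blast
    have "0 \<le> L * k" "L * k \<le> L"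
      using coord_offset[OF le d(2)] d(3) unfolding k[symmetric] by auto
    then have "0 \<le> k"
      using L_mid(3) by (simp add: zero_le_mult_iff)
    moreover have "k \<le> 1"
    proof (rule ccontr)
      assume "\<not> k \<le> 1"
      then have "L * 2 \<le> L * k"
        using L_mid(3) by (intro mult_left_mono) auto
      then show False
        using \<open>L * k \<le> L\<close> L_mid(3) by simp
    qed
    ultimately have "k = 0 \<or> k = 1"
      by auto
    then show ?thesis
      using k d(2,3) le L_mid by auto
  qed
  have "int s = mid" "i' = i" "j' = j"
    using *[of a i i'] *[of b j j'] lt assms eqs by (auto simp: sub.simps in_lat_def cor_def)
  then show "s = n - 1 \<and> f = e"
    using eqs assms(1) by (auto simp: mid_def)
next
  assume "s = n - 1 \<and> f = e"
  then show "in_lat (sub A s e + f)"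
    using sub_outer[of e A] assms by simp
qed

lemma opp_cor: "e \<in> cor \<Longrightarrow> opp e \<in> cor" "opp (opp e) = e" "opp e \<noteq> e"
  by (auto simp: opp_def cor_def prod_eq_iff) presburger

text \<open>The displacement to the cell diagonally across the corner \<open>f\<close>.\<close>

definition step :: "pt2 \<Rightarrow> pt2" where "step f = (2 * fst f - 1, 2 * snd f - 1)"

lemma sub_step:
  "sub A 0 e + step f = sub A 1 f" "sub A s e + step e = sub A (Suc s) e"
  "sub A (Suc s) e + step (opp e) = sub A s e"
  by (cases A; cases e; cases f; simp add: sub.simps step_def opp_def algebra_simps)+

lemma sub_0: "sub A 0 e = sub A 0 f"
  by (cases A; cases e; cases f; simp add: sub.simps)

lemma at_subset:
  assumes "B \<in> cel m" "f \<in> cor"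
  shows "cells_at m (B + f) = {B} \<union> (if B + step f \<in> cel m then {B + step f} else {})"
proof -
  have "C = B \<or> C = B + step f" if C: "C \<in> cells_at m (B + f)" for C
  proof -
    have g: "C \<in> cel m" "B + f - C \<in> cor"
      using C by (auto simp: cells_at_def)
    have ev: "even (fst B + snd B)" "even (fst C + snd C)"
      using cel_even assms(1) g(1) by auto
    obtain b1 b2 c1 c2 where eqs: "B = (b1, b2)" "C = (c1, c2)"
      by (metis surj_pair)
    obtain g1 g2 where g12: "B + f - C = (g1, g2)"
      by (metis surj_pair)
    from g(2) assms(2) show ?thesis
      unfolding g12 using g12 ev unfolding eqs
      by (elim corE corE2; simp add: step_def; presburger)
  qed
  moreover have "B + f - (B + step f) = opp f"
    by (simp add: step_def opp_def prod_eq_iff)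
  then have "B + step f \<in> cel m \<Longrightarrow> B + step f \<in> cells_at m (B + f)"
    using assms opp_cor(1) by (simp add: cells_at_def)
  moreover have "B \<in> cells_at m (B + f)"
    using assms by (simp add: cells_at_def)
  moreover have "C \<in> cells_at m (B + f) \<Longrightarrow> C \<in> cel m" for C
    by (simp add: cells_at_def)
  ultimately show ?thesis
    by (simp split: if_split) blast
qed

text \<open>A subcell has the same distance from the centre of its parent in both coordinates. A
  diagonal step transverse to the leg moves one coordinate inwards, to distance s - 1, and the other
  outwards, to distance at least s.\<close>

lemma side_not_cel:
  assumes "0 < s" "s < n" "e \<in> cor" "f \<in> cor" "f \<noteq> e" "f \<noteq> opp e"
  shows "sub A s e + step f \<notin> cel (Suc m)"
proof
  assume "sub A s e + step f \<in> cel (Suc m)"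
  then obtain A2 s2 e2 where eq: "sub A s e + step f = sub A2 s2 e2" and s2: "s2 < n" "e2 \<in> cor"
    by auto
  obtain a b i j i' j' a2 b2 i2 j2 where eqs: "A = (a, b)" "e = (i, j)" "f = (i', j')"
    "A2 = (a2, b2)" "e2 = (i2, j2)"
    by (metis surj_pair)
  have i: "i \<in> {0, 1}" "j \<in> {0, 1}" "i2 \<in> {0, 1}" "j2 \<in> {0, 1}"
    using assms s2 eqs by (auto simp: cor_def)
  have le: "int s \<le> mid" "int s2 \<le> mid" "int (s - 1) \<le> mid"
    using assms s2 by (auto simp: mid_def)
  have c1: "L * a + mid + int s * (2 * i - 1) + (2 * i' - 1) = L * a2 + mid + int s2 * (2 * i2 - 1)"
    and c2: "L * b + mid + int s * (2 * j - 1) + (2 * j' - 1) = L * b2 + mid + int s2 * (2 * j2 - 1)"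
    using eq unfolding eqs by (auto simp: sub.simps step_def)
  have inner: "s2 = s - 1"
    if c: "L * a + mid + int s * (2 * i - 1) + (2 * i' - 1) = L * a2 + mid + int s2 * (2 * i2 - 1)"
      "i' = 1 - i" "i \<in> {0, 1}" "i2 \<in> {0, 1}" for a i i' a2 i2
  proof -
    have "L * a + mid + int (s - 1) * (2 * i - 1) = L * a2 + mid + int s2 * (2 * i2 - 1)"
      using c(1) assms(1) unfolding c(2) by (simp add: of_nat_diff algebra_simps)
    from coord_eqD(2)[OF this le(3,2) c(3,4)] show ?thesis by simp
  qed
  have outer: "s \<le> s2"
    if c: "L * a + mid + int s * (2 * i - 1) + (2 * i' - 1) = L * a2 + mid + int s2 * (2 * i2 - 1)"
      "i' = i" "i \<in> {0, 1}" "i2 \<in> {0, 1}" for a i i' a2 i2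
  proof (cases "int s = mid")
    case True
    \<comment> \<open>At the rim the step enters the adjacent square of the coarse grid, again at
      distance \<open>mid\<close> but on the opposite side.\<close>
    have "L * (a + 2 * i - 1) + mid + int s * (2 * (1 - i) - 1) = L * a2 + mid + int s2 * (2 * i2 - 1)"
      using c(1,3) unfolding c(2) True using L_mid(1) by (auto simp: algebra_simps)
    from coord_eqD(2)[OF this le(1,2) _ c(4)] c(3) show ?thesis by auto
  next
    case False
    then have "int (Suc s) \<le> mid"
      using le by simp
    have "L * a + mid + int (Suc s) * (2 * i - 1) = L * a2 + mid + int s2 * (2 * i2 - 1)"
      using c(1) unfolding c(2) by (simp add: algebra_simps)
    from coord_eqD(2)[OF this \<open>int (Suc s) \<le> mid\<close> le(2) c(3,4)] show ?thesis by simp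
  qed
  have "(i' = i \<and> j' = 1 - j) \<or> (i' = 1 - i \<and> j' = j)"
    using assms(3-6) eqs by (auto simp: cor_def opp_def)
  then show False
    using inner[OF c1] inner[OF c2] outer[OF c1] outer[OF c2] i assms(1) by auto
qed

lemma at_center:
  assumes "A \<in> cel m" "f \<in> cor"
  shows "cells_at (Suc m) (sub A 0 e + f) = {sub A 0 f, sub A 1 f}"
proof -
  have "sub A 0 f \<in> cel (Suc m)" "sub A 1 f \<in> cel (Suc m)"
    using assms n_ge_2 by (auto simp del: cel.simps intro!: subI)
  then show ?thesis
    using at_subset[of "sub A 0 f" "Suc m" f] assms sub_step(1)[of A f f] sub_0[of A e f] by auto
qed

lemma at_leg:
  assumes "A \<in> cel m" "e \<in> cor"
  shows "Suc s < n \<Longrightarrow> cells_at (Suc m) (sub A s e + e) = {sub A s e, sub A (Suc s) e}"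
    and "Suc s < n \<Longrightarrow> cells_at (Suc m) (sub A (Suc s) e + opp e) = {sub A s e, sub A (Suc s) e}"
    and "0 < s \<Longrightarrow> s < n \<Longrightarrow> f \<in> cor \<Longrightarrow> f \<noteq> e \<Longrightarrow> f \<noteq> opp e \<Longrightarrow> cells_at (Suc m) (sub A s e + f) = {sub A s e}"
proof -
  show "cells_at (Suc m) (sub A s e + e) = {sub A s e, sub A (Suc s) e}" if "Suc s < n"
  proof -
    have "sub A s e \<in> cel (Suc m)" "sub A (Suc s) e \<in> cel (Suc m)"
      using assms that by (auto simp del: cel.simps intro!: subI)
    then show ?thesis
      using at_subset[of "sub A s e" "Suc m" e] assms sub_step(2)[of A s e] by auto
  qed
  show "cells_at (Suc m) (sub A (Suc s) e + opp e) = {sub A s e, sub A (Suc s) e}" if "Suc s < n"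
  proof -
    have "sub A s e \<in> cel (Suc m)" "sub A (Suc s) e \<in> cel (Suc m)"
      using assms that by (auto simp del: cel.simps intro!: subI)
    then show ?thesis
      using at_subset[of "sub A (Suc s) e" "Suc m" "opp e"] assms opp_cor(1)[of e] sub_step(3)[of A s e]
      by auto
  qed
  show "cells_at (Suc m) (sub A s e + f) = {sub A s e}"
    if "0 < s" "s < n" "f \<in> cor" "f \<noteq> e" "f \<noteq> opp e"
  proof -
    have "sub A s e \<in> cel (Suc m)"
      using assms that by (auto simp del: cel.simps intro!: subI)
    then show ?thesis
      using at_subset[of "sub A s e" "Suc m" f] side_not_cel[OF that(1,2) assms(2) that(3-5)] that
      by (simp del: cel.simps)
  qed
qed

lemma at_lat: "cells_at (Suc m) (lat q) = (\<lambda>A. sub A (n - 1) (q - A)) ` cells_at m q"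
proof (intro equalityI subsetI)
  fix B assume "B \<in> cells_at (Suc m) (lat q)"
  then obtain A s e where B: "B = sub A s e" "A \<in> cel m" "s < n" "e \<in> cor" "lat q - B \<in> cor"
    by (auto simp: cells_at_def)
  then have "in_lat (sub A s e + (lat q - B))"
    by simp
  then have s: "s = n - 1" "lat q - B = e"
    using in_lat_sub[of s e "lat q - B" A] B by auto
  have "lat (A + e) = B + e"
    using sub_outer[OF B(4), of A] B(1) s by simp
  also have "\<dots> = lat q"
    using s(2) by (auto simp: algebra_simps)
  finally have "q = A + e"
    by simp
  then show "B \<in> (\<lambda>A. sub A (n - 1) (q - A)) ` cells_at m q"
    using B s by (auto simp: cells_at_def intro!: image_eqI[of _ _ A])
next
  fix B assume "B \<in> (\<lambda>A. sub A (n - 1) (q - A)) ` cells_at m q"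
  then obtain A where A: "A \<in> cel m" "q - A \<in> cor" "B = sub A (n - 1) (q - A)"
    by (auto simp: cells_at_def)
  then have "B + (q - A) = lat q"
    using sub_outer[of "q - A" A] by simp
  then have "lat q - B = q - A"
    by (metis add_diff_cancel_left')
  moreover have "B \<in> cel (Suc m)"
    using A n_ge_2 by (auto simp del: cel.simps intro!: subI)
  ultimately show "B \<in> cells_at (Suc m) (lat q)"
    using A by (simp add: cells_at_def)
qed

lemma inj_outer: "inj_on (\<lambda>A. sub A (n - 1) (q - A)) (cells_at m q)"
  using sub_eqD(1) n_ge_2 by (auto simp: inj_on_def cells_at_def)

lemma lat_vert_iff: "lat q \<in> vert (Suc m) \<longleftrightarrow> q \<in> vert m"
  by (simp add: vert_iff at_lat)

lemma cor_split:
  assumes "e \<in> cor"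
  obtains f g where "cor = {e, opp e, f, g}" "distinct [e, opp e, f, g]"
proof -
  have "\<exists>f g. cor = {e, opp e, f, g} \<and> distinct [e, opp e, f, g]"
    using assms
    by (intro exI[of _ "(fst e, 1 - snd e)"] exI[of _ "(1 - fst e, snd e)"])
       (auto simp: cor_def opp_def)
  then show ?thesis
    using that by blast
qed

section \<open>Extension to the next level\<close>

text \<open>If \<open>l\<close> is an eigenvalue, then every inner vertex has the mean of the sums over its cells, divided
  by \<open>kap l\<close>, as its value. Eliminating the vertices leaves a three-term recursion for the cell sums
  along each leg, with solution \<open>leg\<close>; the fictitious sum with \<open>s = n\<close> beyond the outermost subcell
  encodes the given value at the corner. \<open>base\<close> is the sum over the central subcell.\<close>

definition base :: "real \<Rightarrow> (pt2 \<Rightarrow> real) \<Rightarrow> pt2 \<Rightarrow> real" where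
  "base l p A = 2 * kap l * cell_sum p A / ep l"

definition leg :: "real \<Rightarrow> (pt2 \<Rightarrow> real) \<Rightarrow> pt2 \<Rightarrow> nat \<Rightarrow> pt2 \<Rightarrow> real" where
  "leg l p A s e = (chebG (n - s) l * base l p A + 2 * kap l * chebB s l * p (A + e)) / gp l"

definition sval :: "real \<Rightarrow> (pt2 \<Rightarrow> real) \<Rightarrow> pt2 \<Rightarrow> real" where
  "sval l p B = (case (SOME (A, s, e). s < n \<and> e \<in> cor \<and> B = sub A s e) of (A, s, e) \<Rightarrow> leg l p A s e)"

definition ext :: "nat \<Rightarrow> real \<Rightarrow> (pt2 \<Rightarrow> real) \<Rightarrow> pt2 \<Rightarrow> real" where
  "ext m l p Q = (if in_lat Q then p (unlat Q)
     else (\<Sum>B\<in>cells_at (Suc m) Q. sval l p B) / (kap l * card (cells_at (Suc m) Q)))"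

text \<open>The graph Laplacian plus z, multiplied by the degree of the vertex, which is three times
  the number of its cells. Cells at a vertex meet nowhere else, so cell sums suffice.\<close>

definition Lop :: "nat \<Rightarrow> real \<Rightarrow> (pt2 \<Rightarrow> real) \<Rightarrow> pt2 \<Rightarrow> real" where
  "Lop m z u Q = (\<Sum>A\<in>cells_at m Q. cell_sum u A - (4 - 3 * z) * u Q)"

text \<open>Only the central subcell has several names, and there \<open>chebB 0 l\<close> = 0
  removes the dependence on the corner.\<close>

lemma sval_sub: "s < n \<Longrightarrow> e \<in> cor \<Longrightarrow> sval l p (sub A s e) = leg l p A s e"
proof -
  assume se: "s < n" "e \<in> cor"
  define t where "t = (SOME (A', s', e'). s' < n \<and> e' \<in> cor \<and> sub A s e = sub A' s' e')"
  have "case t of (A', s', e') \<Rightarrow> s' < n \<and> e' \<in> cor \<and> sub A s e = sub A' s' e'"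
    unfolding t_def by (rule someI[of _ "(A, s, e)"]) (use se in simp)
  then obtain A' s' e' where t: "t = (A', s', e')" "s' < n" "e' \<in> cor" "sub A s e = sub A' s' e'"
    by (cases t) auto
  have "A = A'" "s = s'" "s = 0 \<or> e = e'"
    using sub_eqD[OF t(4) se(1) t(2) se(2) t(3)] .
  then have "leg l p A' s' e' = leg l p A s e"
    by (auto simp: leg_def)
  then show ?thesis
    unfolding sval_def t_def[symmetric] t(1) by simp
qed

lemma leg_linear:
  "leg l (\<lambda>x. u x + v x) A s e = leg l u A s e + leg l v A s e"
  "leg l (\<lambda>x. c * u x) A s e = c * leg l u A s e"
  by (simp_all add: leg_def base_def cell_sum_add cell_sum_scale add_divide_distrib algebra_simps)

lemma sval_linear:
  "sval l (\<lambda>x. u x + v x) B = sval l u B + sval l v B"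
  "sval l (\<lambda>x. c * u x) B = c * sval l u B"
  by (simp_all add: sval_def leg_linear split: prod.split)

lemma ext_linear:
  "ext m l (\<lambda>x. u x + v x) = (\<lambda>Q. ext m l u Q + ext m l v Q)"
  "ext m l (\<lambda>x. c * u x) = (\<lambda>Q. c * ext m l u Q)"
  by (simp_all add: fun_eq_iff ext_def sval_linear sum.distrib sum_distrib_left add_divide_distrib)

lemma ext_lat [simp]: "ext m l p (lat q) = p q"
  by (simp add: ext_def)

lemma ext_outside:
  assumes "\<And>q. q \<notin> vert m \<Longrightarrow> p q = 0" "Q \<notin> vert (Suc m)"
  shows "ext m l p Q = 0"
proof (cases "in_lat Q")
  case True
  then have "unlat Q \<notin> vert m"
    using assms(2) lat_vert_iff[of "unlat Q" m] lat_unlat[OF True] by simp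
  then show ?thesis
    using assms(1) by (simp add: ext_def True)
next
  case False
  then show ?thesis
    using assms(2) by (simp add: ext_def vert_iff)
qed

lemma leg_0: "gp l \<noteq> 0 \<Longrightarrow> leg l p A 0 e = base l p A"
  by (simp add: leg_def gp_def)

lemma leg_rec:
  assumes "Suc (Suc s) \<le> n"
  shows "leg l p A (Suc (Suc s)) e = (2 - 6 * l) * leg l p A (Suc s) e - leg l p A s e"
proof -
  obtain r where r: "n = Suc (Suc s) + r"
    using assms le_Suc_ex by blast
  have g: "chebG (n - s) l = (2 - 6 * l) * chebG (n - Suc s) l - chebG (n - Suc (Suc s)) l"
    by (simp add: r Suc_diff_le)
  show ?thesis
    unfolding leg_def g by (simp add: diff_divide_distrib[symmetric] algebra_simps)
qed

lemma leg_end: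
  assumes "gp l \<noteq> 0"
  shows "leg l p A n e + leg l p A (n - 1) e = 2 * kap l * p (A + e)"
proof -
  have "n - (n - 1) = Suc 0"
    using n_ge_2 by simp
  then have "leg l p A n e + leg l p A (n - 1) e
      = (2 * kap l * (chebB n l + chebB (n - 1) l) * p (A + e)) / gp l"
    unfolding leg_def by (simp add: add_divide_distrib[symmetric] algebra_simps)
  then show ?thesis
    using assms unfolding gp_eq[symmetric] by simp
qed

text \<open>The outermost subcell contributes the left side to the equation at an old vertex. Here
  \<open>ep_hp\<close> makes R appear: up to a factor independent of the cell this is the
  contribution of the parent cell for the parameter \<open>dec l\<close>.\<close>

lemma leg_flux:
  assumes "gp l \<noteq> 0" "ep l \<noteq> 0"
  shows "leg l p A (n - 1) e - kap l * p (A + e)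
    = 2 * kap l / (ep l * gp l) * (cell_sum p A - (4 - 3 * dec l) * p (A + e))"
proof -
  have d: "4 - 3 * dec l = ep l * hp l / 2"
    using ep_hp[of l] by simp
  have "n - (n - 1) = Suc 0"
    using n_ge_2 by simp
  then have "leg l p A (n - 1) e - kap l * p (A + e)
      = (base l p A + 2 * kap l * chebB (n - 1) l * p (A + e) - kap l * gp l * p (A + e)) / gp l"
    unfolding leg_def using assms by (simp add: field_simps)
  also have "\<dots> = (base l p A - kap l * hp l * p (A + e)) / gp l"
    by (simp add: gp_eq[of l] hp_def algebra_simps)
  also have "\<dots> = 2 * kap l / (ep l * gp l) * (cell_sum p A - (4 - 3 * dec l) * p (A + e))"
    unfolding d base_def using assms by (simp add: field_simps)
  finally show ?thesis .
qed

text \<open>The equation at the central subcell. It is the condition that determines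
  \<open>base\<close>.\<close>

lemma leg_1_sum:
  assumes "gp l \<noteq> 0" "ep l \<noteq> 0"
  shows "(\<Sum>e\<in>cor. leg l p A 1 e) = (4 - 6 * l) * base l p A"
proof -
  have "(\<Sum>e\<in>cor. leg l p A 1 e) = (4 * chebG (n - 1) l * base l p A + 2 * kap l * cell_sum p A) / gp l"
    unfolding leg_def cell_sum_def sum_cor by (simp add: add_divide_distrib[symmetric] algebra_simps)
  also have "2 * kap l * cell_sum p A = ep l * base l p A"
    using assms by (simp add: base_def)
  also have "4 * chebG (n - 1) l * base l p A + ep l * base l p A = (4 - 6 * l) * gp l * base l p A"
    by (simp add: ep_def gp_def algebra_simps)
  finally show ?thesis
    using assms by simp
qed

lemma ext_outer: "e \<in> cor \<Longrightarrow> ext m l p (sub A (n - 1) e + e) = p (A + e)"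
  by (simp only: sub_outer ext_lat)

lemma ext_center:
  assumes "A \<in> cel m" "f \<in> cor"
  shows "ext m l p (sub A 0 e + f) = (leg l p A 0 f + leg l p A 1 f) / (2 * kap l)"
proof -
  have "\<not> in_lat (sub A 0 f + f)"
    using in_lat_sub[of 0 f f A] assms n_ge_2 by simp
  moreover have "sub A 0 f \<noteq> sub A 1 f"
    using sub_eqD(2)[of A 0 f A 1 f] assms n_ge_2 by auto
  ultimately show ?thesis
    using at_center[OF assms, of e] sub_0[of A e f] assms n_ge_2
    by (simp add: ext_def sval_sub)
qed

lemma ext_leg:
  assumes "A \<in> cel m" "e \<in> cor"
  shows "Suc s < n \<Longrightarrow> ext m l p (sub A s e + e) = (leg l p A s e + leg l p A (Suc s) e) / (2 * kap l)"
    and "Suc s < n \<Longrightarrow> ext m l p (sub A (Suc s) e + opp e) = (leg l p A s e + leg l p A (Suc s) e) / (2 * kap l)"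
    and "0 < s \<Longrightarrow> s < n \<Longrightarrow> f \<in> cor \<Longrightarrow> f \<noteq> e \<Longrightarrow> f \<noteq> opp e \<Longrightarrow> ext m l p (sub A s e + f) = leg l p A s e / kap l"
proof -
  have ne: "sub A s e \<noteq> sub A (Suc s) e" if "Suc s < n"
    using sub_eqD(2)[of A s e A "Suc s" e] assms that by auto
  show "ext m l p (sub A s e + e) = (leg l p A s e + leg l p A (Suc s) e) / (2 * kap l)" if "Suc s < n"
  proof -
    have "\<not> in_lat (sub A s e + e)"
      using in_lat_sub[of s e e A] assms that by auto
    then show ?thesis
      using at_leg(1)[OF assms that] ne[OF that] that assms by (simp add: ext_def sval_sub)
  qed
  show "ext m l p (sub A (Suc s) e + opp e) = (leg l p A s e + leg l p A (Suc s) e) / (2 * kap l)" if "Suc s < n"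
  proof -
    have "\<not> in_lat (sub A (Suc s) e + opp e)"
      using in_lat_sub[of "Suc s" e "opp e" A] assms that opp_cor[of e] by auto
    then show ?thesis
      using at_leg(2)[OF assms that] ne[OF that] that assms by (simp add: ext_def sval_sub)
  qed
  show "ext m l p (sub A s e + f) = leg l p A s e / kap l"
    if "0 < s" "s < n" "f \<in> cor" "f \<noteq> e" "f \<noteq> opp e"
  proof -
    have "\<not> in_lat (sub A s e + f)"
      using in_lat_sub[of s e f A] assms that by auto
    then show ?thesis
      using at_leg(3)[OF assms that] that assms by (simp add: ext_def sval_sub)
  qed
qed

text \<open>The values of \<open>ext\<close> are made from prescribed sums, so it remains to see
  that they add up to them. At the centre this is \<open>leg_1_sum\<close>; along a leg it is
  \<open>leg_rec\<close>, with \<open>leg_end\<close> at the outer corner, and 8 - 6 l = 2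
  \<open>kap l\<close>.\<close>

lemma cell_sum_ext:
  assumes "nonsing l" "A \<in> cel m" "s < n" "e \<in> cor"
  shows "cell_sum (ext m l p) (sub A s e) = leg l p A s e"
proof -
  have ns: "kap l \<noteq> 0" "gp l \<noteq> 0" "ep l \<noteq> 0"
    using assms(1) by (auto simp: nonsing_def)
  have k: "8 - 6 * l = 2 * kap l"
    by (simp add: kap_def)
  show ?thesis
  proof (cases s)
    case 0
    have "cell_sum (ext m l p) (sub A 0 e) = (\<Sum>f\<in>cor. (leg l p A 0 f + leg l p A 1 f) / (2 * kap l))"
      unfolding cell_sum_def using ext_center[OF assms(2)] by simp
    also have "\<dots> = (4 * base l p A + (\<Sum>f\<in>cor. leg l p A 1 f)) / (2 * kap l)"
      by (simp add: sum_cor leg_0[OF ns(2)] add_divide_distrib)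
    also have "\<dots> = ((8 - 6 * l) * base l p A) / (2 * kap l)"
      unfolding leg_1_sum[OF ns(2,3)] by (simp add: algebra_simps)
    also have "\<dots> = leg l p A 0 e"
      unfolding k leg_0[OF ns(2)] using ns(1) by simp
    finally show ?thesis
      using 0 by simp
  next
    case (Suc r)
    obtain f g where fg: "cor = {e, opp e, f, g}" "distinct [e, opp e, f, g]"
      using cor_split[OF assms(4)] .
    have "cell_sum (ext m l p) (sub A s e) = ext m l p (sub A s e + e) + ext m l p (sub A s e + opp e)
       + ext m l p (sub A s e + f) + ext m l p (sub A s e + g)"
      unfolding cell_sum_def fg(1) using fg(2) by (simp add: add.assoc)
    also have "ext m l p (sub A s e + f) = leg l p A s e / kap l"
      using fg assms Suc by (intro ext_leg(3)) auto
    also have "ext m l p (sub A s e + g) = leg l p A s e / kap l"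
      using fg assms Suc by (intro ext_leg(3)) auto
    also have "ext m l p (sub A s e + opp e) = (leg l p A r e + leg l p A s e) / (2 * kap l)"
      using assms Suc ext_leg(2) by simp
    also have "ext m l p (sub A s e + e) = (leg l p A s e + leg l p A (Suc s) e) / (2 * kap l)"
    proof (cases "Suc s < n")
      case True
      then show ?thesis
        using assms by (intro ext_leg(1))
    next
      case False
      then have sn: "s = n - 1" "Suc s = n"
        using assms(3) by auto
      have "leg l p A s e + leg l p A (Suc s) e = 2 * kap l * p (A + e)"
        using leg_end[OF ns(2), of p A e] unfolding sn(1)[symmetric] sn(2) by simp
      then show ?thesis
        using ext_outer[OF assms(4)] ns(1) sn(1) by simp
    qed
    also have "leg l p A (Suc s) e = (2 - 6 * l) * leg l p A s e - leg l p A r e"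
      unfolding Suc using assms(3) Suc by (intro leg_rec) auto
    finally have "cell_sum (ext m l p) (sub A s e)
        = (leg l p A s e + ((2 - 6 * l) * leg l p A s e - leg l p A r e)) / (2 * kap l)
          + (leg l p A r e + leg l p A s e) / (2 * kap l)
          + (2 * leg l p A s e) / (2 * kap l) + (2 * leg l p A s e) / (2 * kap l)"
      by simp
    also have "\<dots> = ((8 - 6 * l) * leg l p A s e) / (2 * kap l)"
      unfolding add_divide_distrib[symmetric] by (simp add: algebra_simps)
    finally have "cell_sum (ext m l p) (sub A s e) = ((8 - 6 * l) * leg l p A s e) / (2 * kap l)" .
    then show ?thesis
      unfolding k using ns(1) by simp
  qed
qed

lemma cell_sum_ext_sval:
  assumes "nonsing l" "B \<in> cel (Suc m)"
  shows "cell_sum (ext m l p) B = sval l p B"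
proof -
  obtain A s e where "B = sub A s e" "A \<in> cel m" "s < n" "e \<in> cor"
    using assms(2) by auto
  then show ?thesis
    using cell_sum_ext[OF assms(1)] sval_sub by simp
qed

lemma Lop_ext_nonlat:
  assumes "nonsing l" "\<not> in_lat Q"
  shows "Lop (Suc m) l (ext m l p) Q = 0"
proof -
  have "Lop (Suc m) l (ext m l p) Q
      = (\<Sum>B\<in>cells_at (Suc m) Q. sval l p B - kap l * ext m l p Q)"
    unfolding Lop_def kap_def
    by (rule sum.cong) (use assms cell_sum_ext_sval in \<open>auto simp: cells_at_def simp del: cel.simps\<close>)
  also have "\<dots> = (\<Sum>B\<in>cells_at (Suc m) Q. sval l p B) - kap l * card (cells_at (Suc m) Q) * ext m l p Q"
    by (simp add: sum_subtractf)
  also have "\<dots> = 0"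
    using assms by (cases "cells_at (Suc m) Q = {}") (auto simp: ext_def nonsing_def)
  finally show ?thesis .
qed

definition dcoef :: "real \<Rightarrow> real" where "dcoef l = 2 * kap l / (ep l * gp l)"

lemma Lop_ext_lat:
  assumes "nonsing l"
  shows "Lop (Suc m) l (ext m l p) (lat q) = dcoef l * Lop m (dec l) p q"
proof -
  have ns: "gp l \<noteq> 0" "ep l \<noteq> 0"
    using assms by (auto simp: nonsing_def)
  have "Lop (Suc m) l (ext m l p) (lat q)
     = (\<Sum>A\<in>cells_at m q. cell_sum (ext m l p) (sub A (n - 1) (q - A)) - kap l * p q)"
    unfolding Lop_def at_lat kap_def ext_lat by (simp only: sum.reindex[OF inj_outer] o_def)
  also have "\<dots> = (\<Sum>A\<in>cells_at m q. dcoef l * (cell_sum p A - (4 - 3 * dec l) * p q))"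
  proof (rule sum.cong[OF refl])
    fix A assume "A \<in> cells_at m q"
    then have "A \<in> cel m" "q - A \<in> cor"
      by (auto simp: cells_at_def)
    then show "cell_sum (ext m l p) (sub A (n - 1) (q - A)) - kap l * p q
        = dcoef l * (cell_sum p A - (4 - 3 * dec l) * p q)"
      using cell_sum_ext[OF assms, of A m "n - 1" "q - A" p] leg_flux[OF ns, of p A "q - A"] n_ge_2
      by (simp add: dcoef_def)
  qed
  also have "\<dots> = dcoef l * Lop m (dec l) p q"
    by (simp add: Lop_def sum_distrib_left)
  finally show ?thesis .
qed

section \<open>Symmetry and restriction to the coarser level\<close>

lemma Lop_symmetric:
  "(\<Sum>Q\<in>vert m. Lop m z u Q * v Q) = (\<Sum>Q\<in>vert m. u Q * Lop m z v Q)"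
proof -
  have *: "(\<Sum>Q\<in>vert m. Lop m z u Q * v Q) = (\<Sum>A\<in>cel m. cell_sum u A * cell_sum v A)
     - (4 - 3 * z) * (\<Sum>A\<in>cel m. \<Sum>e\<in>cor. u (A + e) * v (A + e))" for u v
  proof -
    have "(\<Sum>Q\<in>vert m. Lop m z u Q * v Q)
       = (\<Sum>Q\<in>vert m. \<Sum>A\<in>cells_at m Q. (cell_sum u A - (4 - 3 * z) * u Q) * v Q)"
      by (simp add: Lop_def sum_distrib_right)
    also have "\<dots> = (\<Sum>A\<in>cel m. \<Sum>e\<in>cor. (cell_sum u A - (4 - 3 * z) * u (A + e)) * v (A + e))"
      by (rule sum_incidence)
    also have "\<dots> = (\<Sum>A\<in>cel m. cell_sum u A * cell_sum v A - (4 - 3 * z) * (\<Sum>e\<in>cor. u (A + e) * v (A + e)))"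
      by (rule sum.cong) (auto simp: cell_sum_def[of v] sum_distrib_left sum_subtractf[symmetric] algebra_simps)
    also have "\<dots> = (\<Sum>A\<in>cel m. cell_sum u A * cell_sum v A)
     - (4 - 3 * z) * (\<Sum>A\<in>cel m. \<Sum>e\<in>cor. u (A + e) * v (A + e))"
      by (simp add: sum_subtractf sum_distrib_left)
    finally show ?thesis .
  qed
  show ?thesis
    using *[of u v] *[of v u] by (simp add: mult.commute)
qed

lemma sum_vert_lat:
  assumes "\<And>Q. Q \<in> vert (Suc m) \<Longrightarrow> \<not> in_lat Q \<Longrightarrow> F Q = 0"
  shows "(\<Sum>Q\<in>vert (Suc m). F Q) = (\<Sum>q\<in>vert m. F (lat q) :: real)"
proof -
  have "(\<Sum>Q\<in>vert (Suc m). F Q) = (\<Sum>Q\<in>lat ` vert m. F Q)"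
  proof (rule sum.mono_neutral_right)
    show "lat ` vert m \<subseteq> vert (Suc m)"
      by (auto simp: lat_vert_iff)
    show "\<forall>Q\<in>vert (Suc m) - lat ` vert m. F Q = 0"
    proof
      fix Q assume Q: "Q \<in> vert (Suc m) - lat ` vert m"
      have "\<not> in_lat Q"
        using Q lat_unlat[of Q] lat_vert_iff[of "unlat Q" m] by (metis DiffD1 DiffD2 imageI)
      then show "F Q = 0"
        using assms Q by simp
    qed
  qed simp
  also have "\<dots> = (\<Sum>q\<in>vert m. F (lat q))"
    by (simp add: sum.reindex[OF inj_lat])
  finally show ?thesis .
qed

text \<open>Decimation is the adjoint of extension.\<close>

lemma Lop_restrict:
  assumes "nonsing l"
  shows "dcoef l * (\<Sum>q\<in>vert m. Lop m (dec l) (\<lambda>q. v (lat q)) q * p q)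
     = (\<Sum>Q\<in>vert (Suc m). Lop (Suc m) l v Q * ext m l p Q)"
proof -
  have "(\<Sum>Q\<in>vert (Suc m). Lop (Suc m) l v Q * ext m l p Q)
     = (\<Sum>Q\<in>vert (Suc m). v Q * Lop (Suc m) l (ext m l p) Q)"
    by (rule Lop_symmetric)
  also have "\<dots> = (\<Sum>q\<in>vert m. v (lat q) * Lop (Suc m) l (ext m l p) (lat q))"
    by (rule sum_vert_lat) (simp add: Lop_ext_nonlat[OF assms])
  also have "\<dots> = dcoef l * (\<Sum>q\<in>vert m. v (lat q) * Lop m (dec l) p q)"
    by (simp add: Lop_ext_lat[OF assms] sum_distrib_left mult_ac)
  also have "(\<Sum>q\<in>vert m. v (lat q) * Lop m (dec l) p q) = (\<Sum>q\<in>vert m. Lop m (dec l) (\<lambda>q. v (lat q)) q * p q)"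
    by (rule Lop_symmetric[symmetric])
  finally show ?thesis ..
qed

text \<open>The operator tested against the constant 1. It computes the total weight of an extension
  exactly.\<close>

lemma sum_Lop:
  fixes u :: "pt2 \<Rightarrow> real" and z :: real
  shows "(\<Sum>Q\<in>vert m. Lop m z u Q) = 3 * z * (\<Sum>Q\<in>vert m. card (cells_at m Q) * u Q)"
proof -
  have "(\<Sum>Q\<in>vert m. Lop m z u Q) = (\<Sum>A\<in>cel m. \<Sum>e\<in>cor. cell_sum u A - (4 - 3 * z) * u (A + e))"
    unfolding Lop_def by (rule sum_incidence)
  also have "\<dots> = (\<Sum>A\<in>cel m. 3 * z * (\<Sum>e\<in>cor. u (A + e)))"
    by (rule sum.cong) (auto simp: cell_sum_def sum_cor algebra_simps)
  also have "\<dots> = 3 * z * (\<Sum>Q\<in>vert m. \<Sum>A\<in>cells_at m Q. u Q)"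
    unfolding sum_incidence by (simp add: sum_distrib_left)
  finally show ?thesis
    by simp
qed

lemma first_band_nonsing: "0 \<le> l \<Longrightarrow> l \<le> tp 0 \<Longrightarrow> nonsing l"
  using first_band_nonneg(4,6)[of l] tp_less[of 0] by (auto simp: nonsing_def kap_def)

lemma first_band_kap: "l \<le> tp 0 \<Longrightarrow> 0 < kap l"
  using tp_less[of 0] by (auto simp: kap_def)

lemma dcoef_pos: "0 \<le> l \<Longrightarrow> l \<le> tp 0 \<Longrightarrow> 0 < dcoef l"
  using first_band_nonneg(4,6)[of l] first_band_kap[of l] by (simp add: dcoef_def)

lemma ext_nonneg:
  assumes "0 \<le> l" "l \<le> tp 0" "\<And>q. 0 \<le> p q"
  shows "0 \<le> ext m l p Q"
proof -
  note pos = first_band_nonneg[OF assms(1,2)] and k = first_band_kap[OF assms(2)]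
  have sv: "0 \<le> sval l p B" if B: "B \<in> cel (Suc m)" for B
  proof -
    obtain A s e where B: "B = sub A s e" "s < n" "e \<in> cor"
      using B unfolding cel.simps by blast
    have "0 \<le> cell_sum p A"
      unfolding cell_sum_def using assms(3) by (intro sum_nonneg)
    then have "0 \<le> base l p A"
      using pos(6) k by (simp add: base_def)
    moreover have "0 \<le> chebG (n - s) l"
      using pos(2)[of "n - s"] B(2) by (simp add: less_imp_le)
    ultimately have "0 \<le> leg l p A s e"
      using pos(1)[of s] pos(4) k assms(3)[of "A + e"] B(2)
      by (auto simp: leg_def intro!: divide_nonneg_nonneg mult_nonneg_nonneg add_nonneg_nonneg)
    then show ?thesis
      using B by (simp add: sval_sub)
  qed
  then have "0 \<le> (\<Sum>B\<in>cells_at (Suc m) Q. sval l p B)"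
    by (intro sum_nonneg) (auto simp: cells_at_def simp del: cel.simps)
  then show ?thesis
    using assms(3) k by (auto simp: ext_def intro!: divide_nonneg_nonneg)
qed

text \<open>Restricting an approximate eigenfunction enlarges the error relative to the
  degrees by the factor \<open>dec l / l\<close> only.\<close>

lemma Lop_restrict_error:
  fixes \<eta> :: real
  assumes l: "0 < l" "l \<le> tp 0" and q: "q \<in> vert m"
    and err: "\<And>Q. Q \<in> vert (Suc m) \<Longrightarrow> \<bar>Lop (Suc m) l v Q\<bar> \<le> \<eta> * card (cells_at (Suc m) Q)"
  shows "\<bar>Lop m (dec l) (\<lambda>q. v (lat q)) q\<bar> \<le> \<eta> * (dec l / l) * card (cells_at m q)"
proof -
  have ns: "nonsing l"
    using l by (intro first_band_nonsing) auto
  have c: "0 < dcoef l"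
    using l by (intro dcoef_pos) auto
  \<comment> \<open>Testing with the extension of the unit mass at \<open>q\<close> isolates the
    value of the restricted operator at \<open>q\<close>.\<close>
  define p :: "pt2 \<Rightarrow> real" where "p = (\<lambda>x. if x = q then 1 else 0)"
  let ?X = "ext m l p"
  have X: "0 \<le> ?X Q" for Q
    using l by (intro ext_nonneg) (auto simp: p_def)
  have pick: "(\<Sum>x\<in>vert m. f x * p x) = f q" for f :: "pt2 \<Rightarrow> real"
    using q by (simp add: p_def if_distrib[of "\<lambda>x. _ * x"] sum.delta cong: if_cong)
  \<comment> \<open>The degree-weighted total of the test function. As the test function is
    nonnegative, this total is also its weighted l1-norm, so no constant is lost when the error is
    summed.\<close>
  have mass: "3 * l * (\<Sum>Q\<in>vert (Suc m). card (cells_at (Suc m) Q) * ?X Q)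
      = dcoef l * (3 * dec l * card (cells_at m q))"
  proof -
    have "3 * l * (\<Sum>Q\<in>vert (Suc m). card (cells_at (Suc m) Q) * ?X Q) = (\<Sum>Q\<in>vert (Suc m). Lop (Suc m) l ?X Q)"
      by (rule sum_Lop[symmetric])
    also have "\<dots> = (\<Sum>x\<in>vert m. Lop (Suc m) l ?X (lat x))"
      by (rule sum_vert_lat) (simp add: Lop_ext_nonlat[OF ns])
    also have "\<dots> = dcoef l * (\<Sum>x\<in>vert m. Lop m (dec l) p x)"
      by (simp add: Lop_ext_lat[OF ns] sum_distrib_left)
    also have "(\<Sum>x\<in>vert m. Lop m (dec l) p x) = 3 * dec l * card (cells_at m q)"
      unfolding sum_Lop pick ..
    finally show ?thesis .
  qed
  have "dcoef l * \<bar>Lop m (dec l) (\<lambda>q. v (lat q)) q\<bar> = \<bar>\<Sum>Q\<in>vert (Suc m). Lop (Suc m) l v Q * ?X Q\<bar>"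
    using Lop_restrict[OF ns, of m v p, symmetric] c unfolding pick by (simp add: abs_mult)
  also have "\<dots> \<le> (\<Sum>Q\<in>vert (Suc m). (\<eta> * card (cells_at (Suc m) Q)) * ?X Q)"
    by (rule order_trans[OF sum_abs sum_mono])
       (use err X in \<open>simp add: abs_mult mult_right_mono\<close>)
  also have "\<dots> = \<eta> * (\<Sum>Q\<in>vert (Suc m). card (cells_at (Suc m) Q) * ?X Q)"
    by (simp add: sum_distrib_left mult.assoc)
  also have "(\<Sum>Q\<in>vert (Suc m). card (cells_at (Suc m) Q) * ?X Q) = dcoef l * (dec l / l) * card (cells_at m q)"
    using mass l(1) by (simp add: field_simps)
  finally have "dcoef l * \<bar>Lop m (dec l) (\<lambda>q. v (lat q)) q\<bar>
      \<le> dcoef l * (\<eta> * (dec l / l) * card (cells_at m q))"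
    by (simp add: mult_ac)
  then show ?thesis
    using mult_le_cancel_left_pos[OF c] by blast
qed

end

section \<open>Eigenspaces of the graphs\<close>

interpretation lf: vector_space "\<lambda>(c::real) (u :: pt2 \<Rightarrow> real) x. c * u x"
  by unfold_locales (auto simp: fun_eq_iff algebra_simps)

interpretation lfp: vector_space_pair "\<lambda>(c::real) (u :: pt2 \<Rightarrow> real) x. c * u x" "\<lambda>(c::real) (u :: pt2 \<Rightarrow> real) x. c * u x"
  by unfold_locales

definition delta :: "pt2 \<Rightarrow> pt2 \<Rightarrow> real" where "delta q = (\<lambda>x. if x = q then 1 else 0)"

lemma sum_apply: "(\<Sum>q\<in>V. f q) x = (\<Sum>q\<in>V. f q x)"
  for f :: "'a \<Rightarrow> 'b \<Rightarrow> 'c :: comm_monoid_add"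
  by (induction V rule: infinite_finite_induct) auto

lemma supported_in_span:
  assumes "finite V" "\<And>x. x \<notin> V \<Longrightarrow> u x = 0"
  shows "u \<in> lf.span (delta ` V)"
proof -
  have "u = (\<Sum>q\<in>V. (\<lambda>x. u q * delta q x))"
  proof
    fix x
    have "(\<Sum>q\<in>V. u q * delta q x) = (\<Sum>q\<in>V. if q = x then u x else 0)"
      by (rule sum.cong) (auto simp: delta_def)
    also have "\<dots> = u x"
      using assms by (auto simp: sum.delta)
    finally show "u x = (\<Sum>q\<in>V. (\<lambda>x. u q * delta q x)) x"
      by (simp add: sum_apply)
  qed
  also have "\<dots> \<in> lf.span (delta ` V)"
    by (intro lf.span_sum lf.span_scale lf.span_base) auto
  finally show ?thesis .
qed

lemma independent_delta: "lf.independent (delta ` V)"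
proof
  assume "lf.dependent (delta ` V)"
  then obtain t c v where t: "finite t" "t \<subseteq> delta ` V" "(\<Sum>v\<in>t. (\<lambda>x. c v * v x)) = 0" "v \<in> t" "c v \<noteq> 0"
    unfolding lf.dependent_explicit by blast
  obtain q where q: "v = delta q"
    using t by auto
  have "0 = (\<Sum>w\<in>t. (\<lambda>x. c w * w x)) q"
    unfolding t(3) by simp
  also have "\<dots> = (\<Sum>w\<in>t. c w * w q)"
    by (simp add: sum_apply)
  also have "\<dots> = (\<Sum>w\<in>t. if w = v then c v else 0)"
  proof (rule sum.cong[OF refl])
    fix w assume "w \<in> t"
    then obtain q' where q': "w = delta q'"
      using t(2) by blast
    show "c w * w q = (if w = v then c v else 0)"
    proof (cases "q' = q")
      case True
      then show ?thesis
        using q q' by (simp add: delta_def)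
    next
      case False
      then have "w q = 0" "v q = 1"
        using q q' by (simp_all add: delta_def)
      then show ?thesis
        by auto
    qed
  qed
  also have "\<dots> = c v"
    using t(1,4) by simp
  finally show False
    using t(5) by simp
qed

context vicsek
begin

definition supp :: "nat \<Rightarrow> (pt2 \<Rightarrow> real) set" where
  "supp m = {u. \<forall>Q. Q \<notin> vert m \<longrightarrow> u Q = 0}"

definition E :: "nat \<Rightarrow> real \<Rightarrow> (pt2 \<Rightarrow> real) set" where
  "E m z = {u \<in> supp m. \<forall>Q\<in>vert m. Lop m z u Q = 0}"

definition mult :: "nat \<Rightarrow> real \<Rightarrow> nat" where "mult m z = lf.dim (E m z)"

definition Dbas :: "nat \<Rightarrow> (pt2 \<Rightarrow> real) set" where "Dbas m = delta ` vert m"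

lemma finite_Dbas [simp]: "finite (Dbas m)"
  by (simp add: Dbas_def)

lemma inj_delta: "inj_on delta V"
proof (rule inj_onI)
  fix x y assume "delta x = delta y"
  then have "delta x x = delta y x"
    by simp
  then show "x = y"
    by (simp add: delta_def split: if_splits)
qed

lemma card_Dbas: "card (Dbas m) = card (vert m)"
  by (simp add: Dbas_def card_image inj_delta)

lemma supp_span: "supp m \<subseteq> lf.span (Dbas m)"
  using supported_in_span[of "vert m"] by (auto simp: supp_def Dbas_def)

lemma E_span: "E m z \<subseteq> lf.span (Dbas m)"
  using supp_span by (auto simp: E_def)

lemma Lop_linear:
  "Lop m z (\<lambda>x. u x + v x) Q = Lop m z u Q + Lop m z v Q"
  "Lop m z (\<lambda>x. c * u x) Q = c * Lop m z u Q"
  by (simp_all add: Lop_def cell_sum_add cell_sum_scale sum_distrib_left sum.distrib[symmetric] algebra_simps)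

lemma Lop_zero: "Lop m z (\<lambda>x. 0) Q = 0"
  by (simp add: Lop_def cell_sum_def)

lemma subspace_supp: "lf.subspace (supp m)"
  by (auto simp: lf.subspace_def supp_def)

lemma subspace_E: "lf.subspace (E m z)"
  by (auto simp: lf.subspace_def supp_def E_def zero_fun_def plus_fun_def Lop_linear Lop_zero)

lemma dim_supp: "lf.dim (supp m) = card (vert m)"
proof -
  have "Dbas m \<subseteq> supp m"
    by (auto simp: Dbas_def supp_def delta_def)
  then have "lf.dim (supp m) = card (Dbas m)"
    using supp_span independent_delta[of "vert m"] by (intro lf.dim_unique) (auto simp: Dbas_def)
  then show ?thesis
    by (simp add: card_Dbas)
qed

lemma linear_ext: "Vector_Spaces.linear (\<lambda>(c::real) u x. c * u x) (\<lambda>(c::real) u x. c * u x) (ext m l)"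
  by unfold_locales (simp_all add: plus_fun_def ext_linear)

lemma ext_E:
  assumes "nonsing l" "p \<in> E m (dec l)"
  shows "ext m l p \<in> E (Suc m) l"
proof -
  have "ext m l p \<in> supp (Suc m)"
    using ext_outside[of m p] assms(2) by (auto simp: E_def supp_def)
  moreover have "Lop (Suc m) l (ext m l p) Q = 0" if Q: "Q \<in> vert (Suc m)" for Q
  proof (cases "in_lat Q")
    case True
    then have eq: "Q = lat (unlat Q)"
      by (simp add: lat_unlat)
    then have "unlat Q \<in> vert m"
      using Q lat_vert_iff by metis
    then show ?thesis
      using Lop_ext_lat[OF assms(1), of m p "unlat Q"] assms(2) eq by (simp add: E_def)
  qed (simp add: Lop_ext_nonlat[OF assms(1)])
  ultimately show ?thesis
    by (simp add: E_def)
qed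

lemma inj_ext: "inj_on (ext m l) V"
proof (rule inj_onI)
  fix p p' assume "ext m l p = ext m l p'"
  then have "ext m l p (lat q) = ext m l p' (lat q)" for q
    by simp
  then show "p = p'"
    by auto
qed

lemma mult_ext_le:
  assumes "nonsing l"
  shows "mult m (dec l) \<le> mult (Suc m) l"
  unfolding mult_def
  by (rule lfp.dim_le_of_injective[OF linear_ext inj_ext _ subspace_E finite_Dbas E_span])
     (use ext_E[OF assms] in auto)

lemma vert_nonempty: "vert m \<noteq> {}"
proof (induction m)
  case 0
  show ?case
    by (auto simp: vert_def cor_def)
next
  case (Suc m)
  then obtain q where "q \<in> vert m"
    by blast
  then have "lat q \<in> vert (Suc m)"
    by (simp add: lat_vert_iff)
  then show ?case
    by blast
qed

lemma mult_0: "1 \<le> mult m 0"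
proof -
  let ?u = "\<lambda>Q. if Q \<in> vert m then 1 else 0 :: real"
  have "Lop m 0 ?u Q = 0" if "Q \<in> vert m" for Q
  proof -
    have "cell_sum ?u A = 4" if "A \<in> cells_at m Q" for A
    proof -
      have "cell_sum ?u A = (\<Sum>e\<in>cor. 1)"
        unfolding cell_sum_def using that vertI[of A m] by (intro sum.cong) (auto simp: cells_at_def)
      then show ?thesis
        by (simp add: sum_cor del: sum_constant)
    qed
    then show ?thesis
      using that by (simp add: Lop_def)
  qed
  then have u: "?u \<in> E m 0"
    by (simp add: E_def supp_def)
  obtain q where "q \<in> vert m"
    using vert_nonempty by blast
  then have "?u \<noteq> 0"
    by (metis (mono_tags, lifting) one_neq_zero zero_fun_def)
  then have "lf.independent {?u}"
    using lf.dependent_single by blast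
  then show ?thesis
    unfolding mult_def using lf.independent_card_le_dim_in_span(2)[OF finite_Dbas E_span, of "{?u}"] u by simp
qed

text \<open>For z = 4/3 the coefficient 4 - 3 z is 0, so vanishing cell sums already solve the
  equation. They impose at most one independent condition per cell.\<close>

lemma mult_top: "card (vert m) \<le> card (cel m) + mult m (4 / 3)"
proof -
  let ?K = "{u \<in> supp m. \<forall>A\<in>cel m. cell_sum u A = 0}"
  have "lf.dim (supp m) \<le> card (cel m) + lf.dim ?K"
    by (rule lf.dim_kernel_functionals[OF finite_Dbas supp_span subspace_supp finite_cel])
       (simp_all add: plus_fun_def cell_sum_add cell_sum_scale)
  moreover have "?K \<subseteq> E m (4 / 3)"
    by (auto simp: E_def Lop_def cells_at_def)
  then have "lf.dim ?K \<le> mult m (4 / 3)"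
    unfolding mult_def by (rule lf.dim_mono_in_span[OF finite_Dbas E_span])
  ultimately show ?thesis
    by (simp add: dim_supp)
qed

text \<open>Weighted by the vertex degrees up to the factor 3: the inner product for which the graph
  Laplacian is self-adjoint.\<close>

definition ip :: "nat \<Rightarrow> (pt2 \<Rightarrow> real) \<Rightarrow> (pt2 \<Rightarrow> real) \<Rightarrow> real" where
  "ip m u v = (\<Sum>Q\<in>vert m. real (card (cells_at m Q)) * u Q * v Q)"

lemma ip_orthogonal:
  assumes "u \<in> E m z" "v \<in> E m y" "z \<noteq> y"
  shows "ip m u v = 0"
proof -
  have v: "Lop m z v Q = 3 * (z - y) * (card (cells_at m Q) * v Q)" if "Q \<in> vert m" for Q
  proof -
    have "Lop m z v Q - Lop m y v Q = 3 * (z - y) * (card (cells_at m Q) * v Q)"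
      unfolding Lop_def sum_subtractf[symmetric] by (simp add: algebra_simps)
    then show ?thesis
      using assms(2) that by (simp add: E_def)
  qed
  have "0 = (\<Sum>Q\<in>vert m. Lop m z u Q * v Q)"
    using assms(1) by (simp add: E_def)
  also have "\<dots> = (\<Sum>Q\<in>vert m. u Q * Lop m z v Q)"
    by (rule Lop_symmetric)
  also have "\<dots> = (\<Sum>Q\<in>vert m. 3 * (z - y) * (card (cells_at m Q) * u Q * v Q))"
    by (rule sum.cong) (simp_all add: v)
  also have "\<dots> = 3 * (z - y) * ip m u v"
    by (simp add: ip_def sum_distrib_left)
  finally show ?thesis
    using assms(3) by simp
qed

lemma sum_mult_le:
  assumes "finite Z"
  shows "(\<Sum>z\<in>Z. mult m z) \<le> card (vert m)"
proof -
  have "(\<Sum>z\<in>Z. lf.dim (E m z)) \<le> card (Dbas m)"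
  proof (rule lf.sum_dim_le[OF assms finite_Dbas E_span])
    fix z Y assume z: "z \<in> Z" "Y \<subseteq> Z - {z}"
    show "lf.span (E m z) \<inter> lf.span (\<Union> (E m ` Y)) \<subseteq> {0}"
    proof
      fix w assume w: "w \<in> lf.span (E m z) \<inter> lf.span (\<Union> (E m ` Y))"
      have wE: "w \<in> E m z"
        using w by (simp add: lf.span_eq_iff[THEN iffD2, OF subspace_E])
      have "ip m w v = 0" if "v \<in> lf.span (\<Union> (E m ` Y))" for v
        using that
      proof (induction rule: lf.span_induct_alt)
        case base
        show ?case by (simp add: ip_def)
      next
        case (step c x y)
        then obtain y' where "x \<in> E m y'" "y' \<in> Y"
          by blast
        then have "ip m w x = 0"
          using z(2) by (intro ip_orthogonal[OF wE]) auto
        moreover have "ip m w ((\<lambda>Q. c * x Q) + y) = c * ip m w x + ip m w y"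
          by (simp add: ip_def sum_distrib_left sum.distrib[symmetric] algebra_simps)
        ultimately have "ip m w ((\<lambda>Q. c * x Q) + y) = 0"
          using step.IH by simp
        then show ?case .
      qed
      then have "ip m w w = 0"
        using w by blast
      then have "(\<Sum>Q\<in>vert m. card (cells_at m Q) * (w Q)^2) = 0"
        by (simp add: ip_def power2_eq_square mult.assoc)
      then have "\<forall>Q\<in>vert m. card (cells_at m Q) * (w Q)^2 = 0"
        by (subst (asm) sum_nonneg_eq_0_iff) auto
      then have "\<forall>Q\<in>vert m. w Q = 0"
        using card_at_pos by fastforce
      then have "w = 0"
        using wE by (auto simp: E_def supp_def fun_eq_iff)
      then show "w \<in> {0}"
        by simp
    qed
  qed
  then show ?thesis
    by (simp add: mult_def card_Dbas)
qed

section \<open>Numbers of cells and vertices\<close>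

lemma card_cel: "card (cel m) = (4 * n - 3) ^ m"
proof (induction m)
  case (Suc m)
  \<comment> \<open>The central subcell gets a single name and every other distance four of them: 1
    + 4 (n - 1) = 4 n - 3.\<close>
  let ?I = "insert (0, (0, 0)) ({1..<n} \<times> cor)"
  have "cel (Suc m) = (\<lambda>(A, s, e). sub A s e) ` (cel m \<times> ?I)"
  proof (intro equalityI subsetI)
    fix B assume "B \<in> cel (Suc m)"
    then obtain A s e where B: "B = sub A s e" "A \<in> cel m" "s < n" "e \<in> cor"
      unfolding cel.simps by blast
    show "B \<in> (\<lambda>(A, s, e). sub A s e) ` (cel m \<times> ?I)"
    proof (cases "s = 0")
      case True
      then have "B = sub A 0 (0, 0)"
        using B sub_0 by blast
      then show ?thesis
        using B by (intro image_eqI[of _ _ "(A, 0, (0, 0))"]) auto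
    next
      case False
      then show ?thesis
        using B by (intro image_eqI[of _ _ "(A, s, e)"]) auto
    qed
  next
    fix B assume "B \<in> (\<lambda>(A, s, e). sub A s e) ` (cel m \<times> ?I)"
    then obtain A s e where "B = sub A s e" "A \<in> cel m" "(s, e) \<in> ?I"
      by auto
    then show "B \<in> cel (Suc m)"
      using n_ge_2 by (auto simp del: cel.simps simp: cor_def intro!: subI)
  qed
  moreover have "inj_on (\<lambda>(A, s, e). sub A s e) (cel m \<times> ?I)"
  proof (rule inj_onI)
    fix x y assume xy: "x \<in> cel m \<times> ?I" "y \<in> cel m \<times> ?I"
      "(case x of (A, s, e) \<Rightarrow> sub A s e) = (case y of (A, s, e) \<Rightarrow> sub A s e)"
    obtain A s e A' s' e' where eqs: "x = (A, s, e)" "y = (A', s', e')"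
      by (metis surj_pair)
    have se: "s < n" "s' < n" "e \<in> cor" "e' \<in> cor" "s = 0 \<Longrightarrow> e = (0, 0)" "s' = 0 \<Longrightarrow> e' = (0, 0)"
      using xy n_ge_2 unfolding eqs by (auto simp: cor_def)
    have "sub A s e = sub A' s' e'"
      using xy(3) unfolding eqs by simp
    from sub_eqD[OF this se(1-4)] show "x = y"
      using se(5,6) unfolding eqs by auto
  qed
  ultimately have "card (cel (Suc m)) = card (cel m \<times> ?I)"
    by (simp add: card_image del: cel.simps)
  also have "card ?I = 4 * n - 3"
  proof -
    have "card cor = 4"
      by (simp add: cor_def card_cartesian_product)
    then have "card ({1..<n} \<times> cor) = (n - 1) * 4"
      by (simp add: card_cartesian_product)
    moreover have "card ?I = Suc (card ({1..<n} \<times> cor))"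
      by (intro card_insert_disjoint) auto
    ultimately show ?thesis
      using n_ge_2 by simp
  qed
  then have "card (cel m \<times> ?I) = card (cel m) * (4 * n - 3)"
    unfolding card_cartesian_product by simp
  finally show ?case
    using Suc by simp
qed simp

abbreviation NN :: "nat \<Rightarrow> nat" where "NN m \<equiv> (4 * n - 3) ^ m"

text \<open>Besides the old vertices, every subcell but the central ones contributes its
  corners other than the outer one; the inner one is shared with the previous subcell of its leg, where it is the outer one.\<close>

lemma card_vert_ge: "3 * NN m + 1 \<le> card (vert m)"
proof (induction m)
  case 0
  have "vert 0 = cor"
  proof -
    have "(0, 0) + e = e" for e :: pt2
      by (simp add: prod_eq_iff)
    then show ?thesis
      unfolding vert_def cel.simps by force
  qed
  then show ?case
    by (simp add: cor_def card_cartesian_product)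
next
  case (Suc m)
  let ?J = "cel m \<times> {1..<n} \<times> (cor \<times> cor - Id)"
  let ?f = "\<lambda>(A, s, e, f). sub A s e + f"
  have inj: "inj_on ?f ?J"
  proof (rule inj_onI)
    fix x y assume xy: "x \<in> ?J" "y \<in> ?J" "?f x = ?f y"
    obtain A s e f A' s' e' f' where eqs: "x = (A, s, e, f)" "y = (A', s', e', f')"
      by (metis surj_pair)
    have h: "A \<in> cel m" "0 < s" "s < n" "e \<in> cor" "f \<in> cor" "e \<noteq> f"
      "A' \<in> cel m" "0 < s'" "s' < n" "e' \<in> cor" "f' \<in> cor" "e' \<noteq> f'"
      and Q: "sub A s e + f = sub A' s' e' + f'"
      using xy unfolding eqs by auto
    have B': "sub A' s' e' \<in> cells_at (Suc m) (sub A s e + f)"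
      unfolding Q using h by (auto simp: cells_at_def simp del: cel.simps intro!: subI)
    have "sub A' s' e' = sub A s e"
    proof (cases "f = opp e")
      case True
      obtain r where r: "s = Suc r"
        using h(2) gr0_implies_Suc by blast
      have "sub A' s' e' = sub A s e \<or> sub A' s' e' = sub A r e"
        using B' at_leg(2)[OF h(1,4), of r] h(3) unfolding r True by auto
      \<comment> \<open>The previous subcell of the leg would own this point through its outer
        corner, which the index set excludes.\<close>
      moreover have False if b: "sub A' s' e' = sub A r e"
      proof -
        have e: "e' = e"
          using sub_eqD(3)[OF b h(9) _ h(10,4)] h(3,8) r by simp
        have "sub A r e + f' = sub A r e + (step e + opp e)"
          using Q b sub_step(2)[of A r e, symmetric] unfolding r True by (simp add: add.assoc)
        then have "f' = e"
          by (simp add: step_def opp_def prod_eq_iff)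
        then show False
          using e h(12) by simp
      qed
      ultimately show ?thesis
        by blast
    next
      case False
      then show ?thesis
        using B' at_leg(3)[OF h(1,4,2,3,5)] h(6) by simp
    qed
    moreover from sub_eqD[OF this h(9,3) h(10,4)] have "A' = A" "s' = s" "e' = e"
      using h(8) by auto
    ultimately show "x = y"
      using Q unfolding eqs by simp
  qed
  have sub1: "?f ` ?J \<subseteq> vert (Suc m)"
    by (auto simp del: cel.simps intro!: vertI subI)
  have sub2: "lat ` vert m \<subseteq> vert (Suc m)"
    by (auto simp: lat_vert_iff)
  have disj: "?f ` ?J \<inter> lat ` vert m = {}"
  proof -
    have "\<not> in_lat Q" if "Q \<in> ?f ` ?J" for Q
      using that in_lat_sub by auto
    moreover have "in_lat Q" if "Q \<in> lat ` vert m" for Q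
      using that by auto
    ultimately show ?thesis
      by blast
  qed
  have "card (cor \<times> cor - Id) = 12"
  proof -
    have "card (cor \<times> cor - Id) = card (cor \<times> cor) - card (Id_on cor)"
      by (subst card_Diff_subset[symmetric]) (auto simp: Id_on_def intro!: arg_cong[of _ _ card])
    moreover have "Id_on cor = (\<lambda>x. (x, x)) ` cor"
      by (auto simp: Id_on_def)
    then have "card (Id_on cor) = card cor"
      by (simp add: card_image inj_on_def)
    ultimately show ?thesis
      by (simp add: cor_def card_cartesian_product)
  qed
  then have "card ?J = NN m * ((n - 1) * 12)"
    by (simp add: card_cartesian_product card_cel)
  then have "card (?f ` ?J) = NN m * ((n - 1) * 12)"
    unfolding card_image[OF inj] .
  moreover have "card (lat ` vert m) = card (vert m)"
    by (simp add: card_image inj_lat)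
  moreover have "card (?f ` ?J \<union> lat ` vert m) = card (?f ` ?J) + card (lat ` vert m)"
    using disj by (intro card_Un_disjoint) auto
  moreover have "card (?f ` ?J \<union> lat ` vert m) \<le> card (vert (Suc m))"
    using sub1 sub2 by (intro card_mono) auto
  ultimately have "NN m * ((n - 1) * 12) + (3 * NN m + 1) \<le> card (vert (Suc m))"
    using Suc by linarith
  moreover have "NN m * ((n - 1) * 12) + 3 * NN m = 3 * NN (Suc m)"
  proof -
    have "(n - 1) * 12 + 3 = 3 * (4 * n - 3)"
      using n_ge_2 by simp
    then have "NN m * ((n - 1) * 12 + 3) = NN m * (3 * (4 * n - 3))"
      by simp
    then show ?thesis
      by (simp add: algebra_simps)
  qed
  ultimately show ?case
    by linarith
qed

section \<open>Spectral decimation of the graphs\<close>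

definition spec :: "nat \<Rightarrow> real set" where "spec m = {z. mult m z \<noteq> 0}"

definition mass :: "nat \<Rightarrow> real set \<Rightarrow> nat" where "mass m J = (\<Sum>z\<in>spec m \<inter> J. mult m z)"

lemma finite_spec [simp]: "finite (spec m)"
proof (rule finite_if_finite_subsets_card_bdd[of _ "card (vert m)", THEN conjunct1])
  fix Z assume Z: "Z \<subseteq> spec m" "finite Z"
  have "card Z = (\<Sum>z\<in>Z. 1)"
    by simp
  also have "\<dots> \<le> (\<Sum>z\<in>Z. mult m z)"
    using Z(1) by (intro sum_mono) (auto simp: spec_def)
  also have "\<dots> \<le> card (vert m)"
    by (rule sum_mult_le[OF Z(2)])
  finally show "card Z \<le> card (vert m)" .
qed

lemma mass_Un: "J \<inter> K = {} \<Longrightarrow> mass m (J \<union> K) = mass m J + mass m K"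
  unfolding mass_def Int_Un_distrib by (rule sum.union_disjoint) auto

lemma mass_mono: "J \<subseteq> K \<Longrightarrow> mass m J \<le> mass m K"
  unfolding mass_def by (rule sum_mono2) auto

lemma mass_singleton: "mass m {z} = mult m z"
  by (cases "z \<in> spec m") (auto simp: mass_def spec_def)

lemma mass_le_card: "mass m J \<le> card (vert m)"
  unfolding mass_def by (rule sum_mult_le) simp

lemma mass_ge_sum: "finite Z \<Longrightarrow> Z \<subseteq> J \<Longrightarrow> (\<Sum>z\<in>Z. mult m z) \<le> mass m J"
proof -
  assume Z: "finite Z" "Z \<subseteq> J"
  have "(\<Sum>z\<in>Z. mult m z) = (\<Sum>z\<in>Z \<inter> spec m. mult m z)"
    using Z(1) by (intro sum.mono_neutral_right) (auto simp: spec_def)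
  also have "\<dots> \<le> mass m J"
    unfolding mass_def using Z by (intro sum_mono2) auto
  finally show ?thesis .
qed

text \<open>One preimage per eigenvalue gives a lower bound. The choice is injective because R
  recovers the eigenvalue, and values of R strictly between 0 and 4/3 avoid the singular
  parameters.\<close>

lemma mass_band:
  assumes "\<And>y. y \<in> spec m \<Longrightarrow> 0 < y \<Longrightarrow> y < 4 / 3 \<Longrightarrow> \<exists>x. a < x \<and> x < b \<and> dec x = y" "b \<le> 4 / 3"
  shows "mass m {0<..<4/3} \<le> mass (Suc m) {a<..<b}"
proof -
  let ?Y = "spec m \<inter> {0<..<4/3}"
  obtain h where h: "\<And>y. y \<in> ?Y \<Longrightarrow> a < h y \<and> h y < b \<and> dec (h y) = y"
    using assms(1) by (metis IntD1 IntD2 greaterThanLessThan_iff)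
  have inj: "inj_on h ?Y"
    using h by (metis inj_onI)
  have "mass m {0<..<4/3} = (\<Sum>y\<in>?Y. mult m y)"
    by (simp add: mass_def)
  also have "\<dots> \<le> (\<Sum>y\<in>?Y. mult (Suc m) (h y))"
  proof (rule sum_mono)
    fix y assume y: "y \<in> ?Y"
    then have "nonsing (h y)"
      using h[OF y] assms(2) by (intro nonsing_generic) auto
    then show "mult m y \<le> mult (Suc m) (h y)"
      using mult_ext_le[of "h y" m] h[OF y] by simp
  qed
  also have "\<dots> = (\<Sum>z\<in>h ` ?Y. mult (Suc m) z)"
    by (simp add: sum.reindex[OF inj])
  also have "\<dots> \<le> mass (Suc m) {a<..<b}"
    using h by (intro mass_ge_sum) auto
  finally show ?thesis .
qed

lemma mass_band_odd: "j \<le> n - 1 \<Longrightarrow> mass m {0<..<4/3} \<le> mass (Suc m) {zp j<..<tp j}"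
  using band_odd tp_less[of j] by (intro mass_band) auto

lemma zp_le: "j \<le> n - 1 \<Longrightarrow> zp j < 4 / 3"
  using zp_less_tp[of j] tp_less[of j] by linarith

lemma mass_band_even: "j < n - 1 \<Longrightarrow> mass m {0<..<4/3} \<le> mass (Suc m) {tp j<..<zp (j + 1)}"
  using band_even zp_le[of "j + 1"] by (intro mass_band) auto

lemma mult_zp: "j \<le> n - 1 \<Longrightarrow> 1 \<le> mult (Suc m) (zp j)"
  using mult_ext_le[OF nonsing_zp, of j m] mult_0[of m] dec_zp[of j] by simp

text \<open>Extension only bounds multiplicities from below, but the lower bounds already add up to the number
  of vertices, so all of them are equalities and there are no further eigenvalues.\<close>

definition top_mult :: "nat \<Rightarrow> nat" where "top_mult m = card (vert m) - NN m"

lemma top_mult: "card (vert m) = NN m + top_mult m" "2 * NN m + 1 \<le> top_mult m" "top_mult m \<le> mult m (4 / 3)"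
  using card_vert_ge[of m] mult_top[of m] by (auto simp: top_mult_def card_cel)

lemma mult_tp: "j < n - 1 \<Longrightarrow> 2 * NN m + 1 \<le> mult (Suc m) (tp j)"
  using mult_ext_le[OF nonsing_tp, of j m] top_mult[of m] dec_tp[of j] by simp

text \<open>With N = \<open>NN m\<close>, passing from \<open>zp (j + 1)\<close> down to
  \<open>zp j\<close> adds 1 (the extended constant at \<open>zp (j + 1)\<close>), N - 1 (even
  band), 2 N + 1 (extended eigenfunctions for 4/3 at \<open>tp j\<close>) and N - 1 (odd band),
  together 4 N. The induction starts with N - 1 for the last band.\<close>

lemma mass_upper:
  assumes "NN m - 1 \<le> mass m {0<..<4/3}" "j \<le> n - 1"
  shows "4 * (n - 1 - j) * NN m + NN m - 1 \<le> mass (Suc m) {zp j<..<4/3}"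
  using assms(2)
proof (induction "n - 1 - j" arbitrary: j)
  case 0
  then have j: "j = n - 1"
    by simp
  have "NN m - 1 \<le> mass (Suc m) {zp j<..<tp j}"
    using mass_band_odd[of j m] assms(1) j by simp
  also have "\<dots> \<le> mass (Suc m) {zp j<..<4/3}"
    using tp_less[of j] j by (intro mass_mono) auto
  finally show ?case
    using j by simp
next
  case (Suc r)
  then have j: "j < n - 1" "r = n - 1 - (j + 1)" "n - 1 - j = Suc (n - 1 - (j + 1))"
    by auto
  have IH: "4 * (n - 1 - (j + 1)) * NN m + NN m - 1 \<le> mass (Suc m) {zp (j+1)<..<4/3}"
    using Suc.hyps(1)[OF j(2)] j(1) by simp
  have ord: "zp j < tp j" "tp j < zp (j + 1)" "zp (j + 1) < 4 / 3"
    using zp_less_tp[of j] tp_less_zp[of j] zp_le[of "j + 1"] j by auto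
  have un: "{zp j<..<4/3} = {zp j<..<tp j} \<union> ({tp j} \<union> ({tp j<..<zp (j+1)} \<union> ({zp (j+1)} \<union> {zp (j+1)<..<4/3})))"
    using ord by auto
  have eq: "mass (Suc m) {zp j<..<4/3} = mass (Suc m) {zp j<..<tp j} + (mass (Suc m) {tp j}
      + (mass (Suc m) {tp j<..<zp (j+1)} + (mass (Suc m) {zp (j+1)} + mass (Suc m) {zp (j+1)<..<4/3})))"
    unfolding un using ord by (subst mass_Un; (auto; fail)?)+
  have "NN m \<ge> 1"
    using n_ge_2 by simp
  moreover have "4 * Suc (n - 1 - (j + 1)) * NN m = 4 * (n - 1 - (j + 1)) * NN m + 4 * NN m"
    by (simp add: add_mult_distrib)
  moreover have "mass m {0<..<4/3} \<le> mass (Suc m) {zp j<..<tp j}"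
    using j(1) by (intro mass_band_odd) auto
  moreover have "1 \<le> mult (Suc m) (zp (j + 1))"
    using j(1) by (intro mult_zp) auto
  ultimately show ?case
    unfolding eq j(3) mass_singleton
    using IH mass_band_even[OF j(1), of m] mult_tp[OF j(1), of m] assms(1) by linarith
qed

lemma NN_pos: "1 \<le> NN m"
  using n_ge_2 by simp

lemma NN_Suc: "NN (Suc m) = 4 * (n - 1) * NN m + NN m"
proof -
  have "4 * n - 3 = 4 * (n - 1) + 1"
    using n_ge_2 by simp
  then show ?thesis
    by (simp only: power_Suc) (simp add: algebra_simps)
qed

lemma mass_mid_ge: "NN m - 1 \<le> mass m {0<..<4/3}"
proof (induction m)
  case (Suc m)
  show ?case
    using mass_upper[OF Suc, of 0] unfolding NN_Suc by (simp add: zp_0)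
qed simp

lemma mass_total:
  "mass m {..<0} + mult m 0 + mass m {0<..<4/3} + mult m (4/3) + mass m {4/3<..} \<le> card (vert m)"
proof -
  have "mass m ({..<0} \<union> {0} \<union> {0<..<4/3} \<union> {4/3} \<union> {4/3<..})
      = mass m {..<0} + mult m 0 + mass m {0<..<4/3} + mult m (4/3) + mass m {4/3<..}"
    unfolding mass_singleton[symmetric] by (subst mass_Un; (auto; fail)?)+
  then show ?thesis
    using mass_le_card by metis
qed

lemma masses:
  "mass m {..<0} = 0" "mult m 0 = 1" "mass m {0<..<4/3} = NN m - 1" "mult m (4/3) = top_mult m"
  "mass m {4/3<..} = 0"
  using mass_total[of m] mass_mid_ge[of m] mult_0[of m] top_mult[of m] NN_pos[of m] by linarith+

lemma mass_lower:
  assumes "j \<le> n - 1"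
  shows "4 * j * NN m \<le> mass (Suc m) {..<zp j}"
  using assms
proof (induction j)
  case (Suc j)
  then have j: "j < n - 1"
    by simp
  have IH: "4 * j * NN m \<le> mass (Suc m) {..<zp j}"
    using Suc by simp
  have ord: "zp j < tp j" "tp j < zp (j + 1)"
    using zp_less_tp[of j] tp_less_zp[of j] j by auto
  have un: "{..<zp (j+1)} = {..<zp j} \<union> ({zp j} \<union> ({zp j<..<tp j} \<union> ({tp j} \<union> {tp j<..<zp (j+1)})))"
    using ord by auto
  have eq: "mass (Suc m) {..<zp (j+1)} = mass (Suc m) {..<zp j} + (mass (Suc m) {zp j} + (mass (Suc m) {zp j<..<tp j}
      + (mass (Suc m) {tp j} + mass (Suc m) {tp j<..<zp (j+1)})))"
    unfolding un using ord by (subst mass_Un; (auto; fail)?)+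
  have "4 * (j + 1) * NN m \<le> mass (Suc m) {..<zp (j+1)}"
  proof -
    have "4 * (j + 1) * NN m = 4 * j * NN m + 4 * NN m"
      by (simp add: add_mult_distrib)
    moreover have "mass m {0<..<4/3} \<le> mass (Suc m) {zp j<..<tp j}"
      using j by (intro mass_band_odd) auto
    moreover have "1 \<le> mult (Suc m) (zp j)"
      using j by (intro mult_zp) auto
    ultimately show ?thesis
      unfolding eq mass_singleton
      using IH mass_band_even[OF j, of m] mult_tp[OF j, of m] masses(3)[of m] NN_pos[of m] by linarith
  qed
  then show ?case
    by simp
qed simp

lemma masses_zp:
  assumes j: "j \<le> n - 1"
  shows "mass (Suc m) {..<zp j} = 4 * j * NN m" "mult (Suc m) (zp j) = 1"
    "mass (Suc m) {zp j<..<4/3} = 4 * (n - 1 - j) * NN m + NN m - 1"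
proof -
  have z: "zp j < 4 / 3"
    using zp_le j by simp
  have "mass (Suc m) ({..<zp j} \<union> ({zp j} \<union> ({zp j<..<4/3} \<union> {4/3})))
    = mass (Suc m) {..<zp j} + (mass (Suc m) {zp j} + (mass (Suc m) {zp j<..<4/3} + mass (Suc m) {4/3}))"
    using z by (subst mass_Un; (auto; fail)?)+
  then have tot: "mass (Suc m) {..<zp j} + (mult (Suc m) (zp j) + (mass (Suc m) {zp j<..<4/3} + mult (Suc m) (4/3)))
      \<le> card (vert (Suc m))"
    unfolding mass_singleton using mass_le_card by metis
  have "4 * (n - 1) * NN m = 4 * j * NN m + 4 * (n - 1 - j) * NN m"
    using j by (metis add_mult_distrib add_mult_distrib2 le_add_diff_inverse)
  then show "mass (Suc m) {..<zp j} = 4 * j * NN m" "mult (Suc m) (zp j) = 1"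
    "mass (Suc m) {zp j<..<4/3} = 4 * (n - 1 - j) * NN m + NN m - 1"
    using tot mass_lower[OF j, of m] mult_zp[OF j, of m] mass_upper[OF mass_mid_ge j, of m]
      top_mult(1,3)[of "Suc m"] NN_Suc[of m] NN_pos[of m] by linarith+
qed

lemma masses_tp:
  assumes j: "j < n - 1"
  shows "mass (Suc m) {zp j<..<tp j} = NN m - 1" "mult (Suc m) (tp j) = 2 * NN m + 1"
proof -
  have ord: "zp j < tp j" "tp j < zp (j + 1)"
    using zp_less_tp[of j] tp_less_zp[of j] j by auto
  have un: "{..<zp (j+1)} = {..<zp j} \<union> ({zp j} \<union> ({zp j<..<tp j} \<union> ({tp j} \<union> {tp j<..<zp (j+1)})))"
    using ord by auto
  have eq: "mass (Suc m) {..<zp (j+1)} = mass (Suc m) {..<zp j} + (mass (Suc m) {zp j} + (mass (Suc m) {zp j<..<tp j}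
      + (mass (Suc m) {tp j} + mass (Suc m) {tp j<..<zp (j+1)})))"
    unfolding un using ord by (subst mass_Un; (auto; fail)?)+
  have "4 * (j + 1) * NN m = 4 * j * NN m + 4 * NN m"
    by (simp add: algebra_simps)
  then show "mass (Suc m) {zp j<..<tp j} = NN m - 1" "mult (Suc m) (tp j) = 2 * NN m + 1"
    using eq masses_zp(1)[of "j + 1" m] masses_zp(1,2)[of j m] j mass_band_odd[of j m] mass_band_even[of j m]
      mult_tp[of j m] masses(3)[of m] NN_pos[of m]
    unfolding mass_singleton by linarith+
qed

text \<open>The preimages in the last band already account for all N - 1 eigenvalues between
  \<open>zp (n - 1)\<close> and 4/3.\<close>

lemma mass_last_gap: "mass (Suc m) {tp (n - 1)<..<4/3} = 0"
proof -
  have ord: "zp (n - 1) < tp (n - 1)" "tp (n - 1) < 4 / 3"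
    using tp_last_props by auto
  have "{zp (n-1)<..<tp (n-1)} \<union> {tp (n-1)<..<4/3} \<subseteq> {zp (n-1)<..<4/3}"
    using ord by auto
  then have "mass (Suc m) ({zp (n-1)<..<tp (n-1)} \<union> {tp (n-1)<..<4/3}) \<le> mass (Suc m) {zp (n-1)<..<4/3}"
    by (rule mass_mono)
  moreover have "mass (Suc m) ({zp (n-1)<..<tp (n-1)} \<union> {tp (n-1)<..<4/3})
      = mass (Suc m) {zp (n-1)<..<tp (n-1)} + mass (Suc m) {tp (n-1)<..<4/3}"
    by (rule mass_Un) auto
  ultimately show ?thesis
    using masses_zp(3)[of "n - 1" m] mass_band_odd[of "n - 1" m] masses(3)[of m] by simp
qed

lemma spec_gap: "z \<in> spec (Suc m) \<Longrightarrow> z < 4 / 3 \<Longrightarrow> z \<le> tp (n - 1)"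
proof (rule ccontr)
  assume z: "z \<in> spec (Suc m)" "z < 4 / 3" "\<not> z \<le> tp (n - 1)"
  have "mult (Suc m) z \<le> mass (Suc m) {tp (n - 1)<..<4/3}"
    using mass_mono[of "{z}" "{tp (n - 1)<..<4/3}" "Suc m"] z by (simp add: mass_singleton)
  then show False
    using mass_last_gap[of m] z by (simp add: spec_def)
qed

lemma mass_below_tp: "j < n - 1 \<Longrightarrow> mass (Suc m) {..<tp j} = (4 * j + 1) * NN m"
proof -
  assume j: "j < n - 1"
  have ord: "zp j < tp j"
    using zp_less_tp[of j] j by auto
  have un: "{..<tp j} = {..<zp j} \<union> ({zp j} \<union> {zp j<..<tp j})"
    using ord by auto
  have eq: "mass (Suc m) {..<tp j} = mass (Suc m) {..<zp j} + (mass (Suc m) {zp j} + mass (Suc m) {zp j<..<tp j})"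
    unfolding un using ord by (subst mass_Un; (auto; fail)?)+
  show ?thesis
    unfolding eq mass_singleton using masses_zp(1,2)[of j m] masses_tp(1)[OF j, of m] j NN_pos[of m]
    by (simp add: algebra_simps)
qed

lemma mass_upto_tp: "j < n - 1 \<Longrightarrow> mass (Suc m) {..tp j} = (4 * j + 3) * NN m + 1"
proof -
  assume j: "j < n - 1"
  have un: "{..tp j} = {..<tp j} \<union> {tp j}"
    by auto
  have eq: "mass (Suc m) {..tp j} = mass (Suc m) {..<tp j} + mass (Suc m) {tp j}"
    unfolding un by (rule mass_Un) auto
  show ?thesis
    unfolding eq mass_singleton using mass_below_tp[OF j, of m] masses_tp(2)[OF j, of m]
    by (simp add: algebra_simps)
qed

lemma mass_upto_zp: "j \<le> n - 1 \<Longrightarrow> mass (Suc m) {..zp j} = 4 * j * NN m + 1"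
proof -
  assume j: "j \<le> n - 1"
  have un: "{..zp j} = {..<zp j} \<union> {zp j}"
    by auto
  have eq: "mass (Suc m) {..zp j} = mass (Suc m) {..<zp j} + mass (Suc m) {zp j}"
    unfolding un by (rule mass_Un) auto
  show ?thesis
    unfolding eq mass_singleton using masses_zp(1,2)[OF j, of m] by simp
qed

lemma dec_first_band:
  assumes "0 < x" "x < tp 0"
  shows "0 < dec x" "dec x < 4 / 3"
  using dec_strict_mono[of 0 x] dec_strict_mono[of x "tp 0"] assms dec_tp[of 0] dec_0 by auto

text \<open>Extension gives one inequality. A strict one at \<open>x\<close> would make the
  preimages in the first band, taken together, exceed the total N - 1 that the band holds.\<close>

lemma mult_first_band:
  assumes "0 < x" "x < tp 0"
  shows "mult (Suc m) x = mult m (dec x)"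
proof (rule antisym)
  have ns: "nonsing x"
    using assms by (intro first_band_nonsing) auto
  then show "mult m (dec x) \<le> mult (Suc m) x"
    by (rule mult_ext_le)
  \<comment> \<open>The point \<open>dec x\<close> is included even if it is no eigenvalue of level
    m; then the conclusion is that \<open>x\<close> is none of level m + 1 either.\<close>
  let ?Y = "insert (dec x) (spec m \<inter> {0<..<4/3})"
  have Yr: "0 < y \<and> y < 4 / 3" if "y \<in> ?Y" for y
    using that dec_first_band[OF assms] by auto
  have ex: "\<exists>z. 0 < z \<and> z < tp 0 \<and> dec z = y" if "y \<in> ?Y" for y
    using band_odd[of 0 y] Yr[OF that] by (auto simp: zp_0)
  then obtain h where h: "\<And>y. y \<in> ?Y \<Longrightarrow> 0 < h y \<and> h y < tp 0 \<and> dec (h y) = y"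
    by metis
  have inj: "inj_on h ?Y"
    using h by (metis inj_onI)
  have hx: "h (dec x) = x"
  proof (rule ccontr)
    assume "h (dec x) \<noteq> x"
    then show False
      using dec_strict_mono[of x "h (dec x)"] dec_strict_mono[of "h (dec x)" x] h[of "dec x"] assms
      by (cases "x < h (dec x)") auto
  qed
  have le: "mult m y \<le> mult (Suc m) (h y)" if "y \<in> ?Y" for y
  proof -
    have "nonsing (h y)"
      using h[OF that] by (intro first_band_nonsing) auto
    then show ?thesis
      using mult_ext_le[of "h y" m] h[OF that] by simp
  qed
  show "mult (Suc m) x \<le> mult m (dec x)"
  proof (rule ccontr)
    assume "\<not> mult (Suc m) x \<le> mult m (dec x)"
    then have "(\<Sum>y\<in>?Y. mult m y) < (\<Sum>y\<in>?Y. mult (Suc m) (h y))"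
      using le hx by (intro sum_strict_mono_ex1) auto
    also have "\<dots> = (\<Sum>z\<in>h ` ?Y. mult (Suc m) z)"
      unfolding sum.reindex[OF inj] o_def ..
    also have "\<dots> \<le> mass (Suc m) {zp 0<..<tp 0}"
      using h zp_0 by (intro mass_ge_sum) auto
    also have "\<dots> = NN m - 1"
      using masses_tp(1)[of 0 m] n_ge_2 by simp
    also have "\<dots> = (\<Sum>y\<in>spec m \<inter> {0<..<4/3}. mult m y)"
      using masses(3)[of m] by (simp add: mass_def)
    also have "\<dots> \<le> (\<Sum>y\<in>?Y. mult m y)"
      by (intro sum_mono2) auto
    finally show False by simp
  qed
qed

section \<open>The limit of the first inverse branch\<close>

definition phi :: "real \<Rightarrow> real" where "phi y = (SOME x. 0 \<le> x \<and> x \<le> tp 0 \<and> dec x = y)"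

lemma tp_0_pos: "0 < tp 0" "tp 0 \<le> 1 / 6" "tp 0 < 4 / 3"
  using zp_less_tp[of 0] zp_0 tp_0 nd_1_le by auto

lemma phi:
  assumes "0 \<le> y" "y \<le> 4 / 3"
  shows "0 \<le> phi y" "phi y \<le> tp 0" "dec (phi y) = y"
proof -
  have "\<exists>x. 0 \<le> x \<and> x \<le> tp 0 \<and> dec x = y"
  proof -
    have "\<exists>x\<ge>0. x \<le> tp 0 \<and> dec x = y"
      using assms dec_0 dec_tp[of 0] tp_0_pos by (intro IVT') (auto intro: continuous_intros)
    then show ?thesis by blast
  qed
  then have "0 \<le> phi y \<and> phi y \<le> tp 0 \<and> dec (phi y) = y"
    unfolding phi_def by (rule someI_ex)
  then show "0 \<le> phi y" "phi y \<le> tp 0" "dec (phi y) = y"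
    by auto
qed

lemma phi_le: "0 \<le> y \<Longrightarrow> y \<le> 4 / 3 \<Longrightarrow> phi y \<le> 4 / 3"
  using phi[of y] tp_0_pos by auto

lemma dec_mono_iff: "0 \<le> x \<Longrightarrow> x \<le> tp 0 \<Longrightarrow> 0 \<le> x' \<Longrightarrow> x' \<le> tp 0 \<Longrightarrow> dec x < dec x' \<longleftrightarrow> x < x'"
  using dec_strict_mono[of x x'] dec_strict_mono[of x' x] by (metis less_asym linorder_neqE_linordered_idom less_irrefl)

lemma phi_less_iff:
  assumes "0 \<le> y" "y \<le> 4 / 3" "0 \<le> y'" "y' \<le> 4 / 3"
  shows "phi y < phi y' \<longleftrightarrow> y < y'"
  using dec_mono_iff[of "phi y" "phi y'"] phi[of y] phi[of y'] assms by simp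

lemma phi_0: "phi 0 = 0"
  using dec_mono_iff[of 0 "phi 0"] phi[of 0] tp_0_pos dec_0 by auto

lemma phi_strict:
  assumes "0 < y" "y < 4 / 3"
  shows "0 < phi y" "phi y < tp 0" "dec (phi y) = y"
  using dec_mono_iff[of 0 "phi y"] dec_mono_iff[of "phi y" "tp 0"] phi[of y] assms dec_0 dec_tp[of 0] tp_0_pos
  by auto

lemma continuous_on_phi: "continuous_on {0..4/3} phi"
proof -
  have inv: "phi (dec x) = x" if "x \<in> {0..tp 0}" for x
  proof -
    have d: "0 \<le> dec x" "dec x \<le> 4 / 3"
      using dec_mono_iff[of x 0] dec_mono_iff[of "tp 0" x] that dec_0 dec_tp[of 0] tp_0_pos by auto
    show ?thesis
      using dec_mono_iff[of x "phi (dec x)"] dec_mono_iff[of "phi (dec x)" x] phi[OF d] that by auto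
  qed
  have "continuous_on (dec ` {0..tp 0}) phi"
    using inv by (intro continuous_on_inv) (auto intro: continuous_intros)
  moreover have "{0..4/3} \<subseteq> dec ` {0..tp 0}"
  proof
    fix y :: real assume "y \<in> {0..4/3}"
    then have "phi y \<in> {0..tp 0}" "y = dec (phi y)"
      using phi[of y] by auto
    then show "y \<in> dec ` {0..tp 0}"
      by blast
  qed
  ultimately show ?thesis
    using continuous_on_subset by blast
qed

primrec zeta :: "nat \<Rightarrow> real \<Rightarrow> real" where
  "zeta 0 z = z"
| "zeta (Suc i) z = phi (zeta i z)"

lemma zeta_range:
  assumes "0 \<le> z" "z \<le> 4 / 3"
  shows "0 \<le> zeta i z" "zeta i z \<le> 4 / 3" "0 \<le> zeta (Suc i) z" "zeta (Suc i) z \<le> tp 0"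
    "dec (zeta (Suc i) z) = zeta i z"
proof -
  have *: "0 \<le> zeta i z \<and> zeta i z \<le> 4 / 3"
  proof (induction i)
    case (Suc i)
    then show ?case
      using phi(1)[of "zeta i z"] phi_le[of "zeta i z"] by simp
  qed (use assms in simp)
  then show "0 \<le> zeta i z" "zeta i z \<le> 4 / 3" "0 \<le> zeta (Suc i) z" "zeta (Suc i) z \<le> tp 0"
    "dec (zeta (Suc i) z) = zeta i z"
    using phi[of "zeta i z"] by auto
qed

lemma zeta_strict:
  assumes "0 < z" "z < 4 / 3"
  shows "0 < zeta i z" "zeta i z < 4 / 3" "0 < zeta (Suc i) z" "zeta (Suc i) z < tp 0"
proof -
  have *: "0 < zeta i z \<and> zeta i z < 4 / 3"
    using assms
  proof (induction i)
    case (Suc i)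
    then show ?case
      using phi_strict[of "zeta i z"] tp_0_pos by auto
  qed simp
  then show "0 < zeta i z" "zeta i z < 4 / 3" "0 < zeta (Suc i) z" "zeta (Suc i) z < tp 0"
    using phi_strict[of "zeta i z"] by auto
qed

lemma continuous_on_zeta: "continuous_on {0..4/3} (zeta i)"
proof (induction i)
  case 0
  have "zeta 0 = (\<lambda>z. z)"
    by (simp add: fun_eq_iff)
  then show ?case
    by simp
next
  case (Suc i)
  have "continuous_on {0..4/3} (\<lambda>z. phi (zeta i z))"
    using zeta_range(1,2) by (intro continuous_on_compose2[OF continuous_on_phi Suc]) auto
  then show ?case
    by (simp add: fun_eq_iff[symmetric] cong: continuous_on_cong)
qed

text \<open>The quotient R l / l, continued to l = 0, where it is rho.\<close>

definition growth :: "real \<Rightarrow> real" where "growth l = gp l * kp l"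

lemma dec_growth: "dec l = l * growth l"
  by (simp add: dec_def growth_def)

text \<open>The bound 8 comes from the right end: R is 4/3 at \<open>tp 0\<close>, and
  \<open>tp 0\<close> is at most 1/6. It makes the iterates of the inverse branch decay like
  8^-i.\<close>

lemma growth_bounds:
  assumes "0 \<le> l" "l \<le> tp 0"
  shows "8 \<le> growth l" "growth l \<le> vs_rho n"
proof -
  have "growth (tp 0) \<le> growth l"
    unfolding growth_def using assms by (intro gp_kp_antimono) auto
  moreover have "8 \<le> growth (tp 0)"
  proof (rule ccontr)
    assume "\<not> 8 \<le> growth (tp 0)"
    then have "tp 0 * growth (tp 0) < tp 0 * 8"
      using tp_0_pos by simp
    moreover have "tp 0 * growth (tp 0) = 4 / 3"
      using dec_tp[of 0] dec_growth[of "tp 0"] by simp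
    ultimately show False
      using tp_0_pos by simp
  qed
  ultimately show "8 \<le> growth l"
    by simp
  have "growth l \<le> growth 0"
    unfolding growth_def using assms by (intro gp_kp_antimono) auto
  then show "growth l \<le> vs_rho n"
    using combos_0 by (simp add: growth_def vs_rho_def mult.commute)
qed

lemma rho_pos: "0 < vs_rho n" "8 \<le> vs_rho n"
  using growth_bounds[of 0] tp_0_pos by auto

lemma zeta_growth:
  assumes "0 \<le> z" "z \<le> 4 / 3"
  shows "zeta (Suc i) z * growth (zeta (Suc i) z) = zeta i z"
  using zeta_range(5)[OF assms, of i] dec_growth by simp

lemma zeta_le:
  assumes "0 \<le> z" "z \<le> 4 / 3"
  shows "zeta i z \<le> (4 / 3) * (1 / 8) ^ i"
proof (induction i)
  case (Suc i)
  have "zeta (Suc i) z * 8 \<le> zeta (Suc i) z * growth (zeta (Suc i) z)"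
    using zeta_range[OF assms] growth_bounds by (intro mult_left_mono) auto
  then show ?case
    using zeta_growth[OF assms, of i] Suc by simp
qed (use assms in simp)

lemma growth_defect: obtains C where "0 \<le> C" "\<And>l. 0 \<le> l \<Longrightarrow> l \<le> tp 0 \<Longrightarrow> vs_rho n - growth l \<le> C * l"
proof -
  obtain q where q: "continuous_on UNIV q" "\<And>l. gp l * kp l = vs_rho n + l * q l"
    using gp_kp_expansion by blast
  have "compact (q ` {0..1})"
    using q(1) by (intro compact_continuous_image) (auto intro: continuous_on_subset)
  then obtain C where C: "\<forall>x\<in>q ` {0..1}. \<bar>x\<bar> \<le> C"
    using compact_imp_bounded bounded_real by metis
  show ?thesis
  proof
    have "0 \<le> \<bar>q 0\<bar>" by simp
    also have "\<dots> \<le> C"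
      using C by auto
    finally show "0 \<le> C" .
    fix l assume l: "0 \<le> l" "l \<le> tp 0"
    then have "\<bar>q l\<bar> \<le> C"
      using C tp_0_pos by auto
    then have "l * (- q l) \<le> l * C"
      using l by (intro mult_left_mono) auto
    then show "vs_rho n - growth l \<le> C * l"
      unfolding growth_def q(2) by (simp add: algebra_simps)
  qed
qed

section \<open>Uniform convergence of the rescaled iterates\<close>

definition psi :: "nat \<Rightarrow> real \<Rightarrow> real" where "psi i z = vs_rho n ^ i * zeta i z"

lemma psi_mono:
  assumes "0 \<le> z" "z \<le> 4 / 3"
  shows "psi i z \<le> psi (Suc i) z"
proof -
  have "zeta i z \<le> zeta (Suc i) z * vs_rho n"
    unfolding zeta_growth[OF assms, symmetric, of i]
    using zeta_range(3,4)[OF assms] growth_bounds by (intro mult_left_mono) auto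
  then have "vs_rho n ^ i * zeta i z \<le> vs_rho n ^ i * (zeta (Suc i) z * vs_rho n)"
    using rho_pos by (intro mult_left_mono) auto
  then show ?thesis
    by (simp add: psi_def mult_ac)
qed

lemma psi_nonneg: "0 \<le> z \<Longrightarrow> z \<le> 4 / 3 \<Longrightarrow> 0 \<le> psi i z"
  using zeta_range rho_pos by (simp add: psi_def)

text \<open>The relative increment is at most a constant times \<open>zeta (Suc i) z\<close>,
  because rho - R l / l is O(l). Since these terms are bounded by a geometric sequence,
  \<open>psi\<close> stays bounded like a convergent product, and the increments inherit the
  geometric decay uniformly in z.\<close>

lemma psi_increment:
  obtains M where "\<And>i z. 0 \<le> z \<Longrightarrow> z \<le> 4 / 3 \<Longrightarrow> psi (Suc i) z - psi i z \<le> M * (1 / 8) ^ i"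
proof -
  obtain C where C: "0 \<le> C" "\<And>l. 0 \<le> l \<Longrightarrow> l \<le> tp 0 \<Longrightarrow> vs_rho n - growth l \<le> C * l"
    using growth_defect by blast
  have step: "psi (Suc i) z - psi i z \<le> psi i z * (C * zeta (Suc i) z)" if z: "0 \<le> z" "z \<le> 4 / 3" for i z
  proof -
    let ?l = "zeta (Suc i) z"
    note l = zeta_range(3,4)[OF z, of i]
    have "psi (Suc i) z - psi i z = vs_rho n ^ i * ?l * (vs_rho n - growth ?l)"
      unfolding psi_def zeta_growth[OF z, symmetric, of i] by (simp add: algebra_simps)
    also have "\<dots> \<le> vs_rho n ^ i * ?l * (C * ?l)"
      using l rho_pos by (intro mult_left_mono C) auto
    also have "\<dots> \<le> psi i z * (C * ?l)"
    proof (rule mult_right_mono)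
      have "?l \<le> zeta i z"
        unfolding zeta_growth[OF z, symmetric, of i]
        using l growth_bounds[OF l] by (simp add: mult_le_cancel_left1)
      then show "vs_rho n ^ i * ?l \<le> psi i z"
        unfolding psi_def using rho_pos by (intro mult_left_mono) auto
    qed (use C l in auto)
    finally show ?thesis .
  qed
  have bd: "psi i z \<le> (4 / 3) * exp (C * (\<Sum>k<i. zeta (Suc k) z))" if z: "0 \<le> z" "z \<le> 4 / 3" for i z
  proof (induction i)
    case 0
    then show ?case
      using z by (simp add: psi_def)
  next
    case (Suc i)
    have "psi (Suc i) z \<le> psi i z * (1 + C * zeta (Suc i) z)"
      using step[OF z, of i] by (simp add: algebra_simps)
    also have "\<dots> \<le> psi i z * exp (C * zeta (Suc i) z)"
      using psi_nonneg[OF z] by (intro mult_left_mono) auto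
    also have "\<dots> \<le> (4 / 3) * exp (C * (\<Sum>k<i. zeta (Suc k) z)) * exp (C * zeta (Suc i) z)"
      using Suc by (intro mult_right_mono) auto
    also have "\<dots> = (4 / 3) * exp (C * (\<Sum>k<Suc i. zeta (Suc k) z))"
      by (simp add: exp_add[symmetric] algebra_simps del: zeta.simps)
    finally show ?case .
  qed
  have bd2: "psi i z \<le> (4 / 3) * exp (C * 2)" if z: "0 \<le> z" "z \<le> 4 / 3" for i z
  proof -
    have "(\<Sum>k<i. zeta (Suc k) z) \<le> (\<Sum>k<i. (4 / 3) * (1 / 8) ^ Suc k)"
      by (intro sum_mono zeta_le z)
    also have "\<dots> = (1 / 6) * (\<Sum>k<i. (1 / 8) ^ k)"
      by (simp add: sum_distrib_left)
    also have "(\<Sum>k<i. (1 / 8) ^ k) = (1 - (1 / 8 :: real) ^ i) / (1 - 1 / 8)"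
      by (subst sum_gp_strict) simp
    also have "(1 / 6) * \<dots> \<le> (2 :: real)"
      by (simp add: field_simps)
    finally have "C * (\<Sum>k<i. zeta (Suc k) z) \<le> C * 2"
      using C(1) by (intro mult_left_mono)
    then have "(4 / 3) * exp (C * (\<Sum>k<i. zeta (Suc k) z)) \<le> (4 / 3) * exp (C * 2)"
      by simp
    then show ?thesis
      using bd[OF z, of i] by linarith
  qed
  show ?thesis
  proof
    fix i z assume z: "0 \<le> z" "z \<le> (4 / 3 :: real)"
    have "psi (Suc i) z - psi i z \<le> psi i z * (C * zeta (Suc i) z)"
      by (rule step[OF z])
    also have "\<dots> \<le> (4 / 3) * exp (C * 2) * (C * ((4 / 3) * (1 / 8) ^ i))"
    proof (intro mult_mono bd2 z)
      have "zeta (Suc i) z \<le> (4 / 3) * (1 / 8) ^ Suc i"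
        by (rule zeta_le[OF z])
      also have "\<dots> \<le> (4 / 3) * (1 / 8) ^ i"
        by simp
      finally show "zeta (Suc i) z \<le> (4 / 3) * (1 / 8) ^ i" .
    qed (use C zeta_range[OF z] in auto)
    finally show "psi (Suc i) z - psi i z \<le> ((4 / 3) * exp (C * 2) * C * (4 / 3)) * (1 / 8) ^ i"
      by (simp add: mult_ac)
  qed
qed

text \<open>An eigenvalue \<open>z\<close> of level m that is continued along the first branch on
  all later levels becomes \<open>vs_rho n ^ m * Psi z\<close> on the fractal.\<close>

definition Psi :: "real \<Rightarrow> real" where "Psi z = lim (\<lambda>i. psi i z)"

lemma uniform_limit_psi: "uniform_limit {0..4/3} psi Psi sequentially"
proof -
  obtain M where M: "\<And>i z. 0 \<le> z \<Longrightarrow> z \<le> 4 / 3 \<Longrightarrow> psi (Suc i) z - psi i z \<le> M * (1 / 8) ^ i"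
    using psi_increment by blast
  have "uniform_limit {0..4/3} (\<lambda>k z. \<Sum>i<k. psi (Suc i) z - psi i z)
     (\<lambda>z. suminf (\<lambda>i. psi (Suc i) z - psi i z)) sequentially"
  proof (rule Weierstrass_m_test)
    show "norm (psi (Suc i) z - psi i z) \<le> M * (1 / 8) ^ i" if "z \<in> {0..4/3}" for i z
      using M[of z i] psi_mono[of z i] that by simp
    show "summable (\<lambda>i. M * (1 / 8 :: real) ^ i)"
      by (intro summable_mult summable_geometric) simp
  qed
  then have u: "uniform_limit {0..4/3} (\<lambda>k z. psi k z - psi 0 z)
     (\<lambda>z. suminf (\<lambda>i. psi (Suc i) z - psi i z)) sequentially"
  proof -
    have "(\<Sum>i<k. psi (Suc i) z - psi i z) = psi k z - psi 0 z" for k z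
      using sum_lessThan_telescope[of "\<lambda>i. psi i z" k] by simp
    then show ?thesis
      using \<open>uniform_limit _ _ _ _\<close> by simp
  qed
  have "uniform_limit {0..4/3} (\<lambda>k z. (psi k z - psi 0 z) + psi 0 z)
     (\<lambda>z. suminf (\<lambda>i. psi (Suc i) z - psi i z) + psi 0 z) sequentially"
    by (intro uniform_limit_add u uniform_limit_const)
  then have u2: "uniform_limit {0..4/3} psi
     (\<lambda>z. suminf (\<lambda>i. psi (Suc i) z - psi i z) + psi 0 z) sequentially"
    by simp
  have eq: "suminf (\<lambda>i. psi (Suc i) z - psi i z) + psi 0 z = Psi z" if "z \<in> {0..4/3}" for z
    unfolding Psi_def using tendsto_uniform_limitI[OF u2 that] by (simp add: limI)
  show ?thesis
    by (rule uniform_limit_cong'[THEN iffD1, OF refl eq u2])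
qed

lemma psi_tendsto: "0 \<le> z \<Longrightarrow> z \<le> 4 / 3 \<Longrightarrow> (\<lambda>i. psi i z) \<longlonglongrightarrow> Psi z"
  using tendsto_uniform_limitI[OF uniform_limit_psi] by simp

lemma continuous_on_Psi: "continuous_on {0..4/3} Psi"
proof (rule uniform_limit_theorem[OF _ uniform_limit_psi])
  show "\<forall>\<^sub>F i in sequentially. continuous_on {0..4/3} (psi i)"
    unfolding psi_def[abs_def] by (intro always_eventually allI continuous_intros continuous_on_zeta)
qed simp

lemma Psi_ge: "0 \<le> z \<Longrightarrow> z \<le> 4 / 3 \<Longrightarrow> z \<le> Psi z"
proof -
  assume z: "0 \<le> z" "z \<le> 4 / 3"
  have "incseq (\<lambda>i. psi i z)"
    using psi_mono[OF z] by (intro incseq_SucI)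
  then have "psi 0 z \<le> Psi z"
    by (rule incseq_le[OF _ psi_tendsto[OF z]])
  then show ?thesis
    by (simp add: psi_def)
qed

lemma Psi_0: "Psi 0 = 0"
proof -
  have "zeta i 0 = 0" for i
    by (induction i) (auto simp: phi_0)
  then have "psi i 0 = 0" for i
    by (simp add: psi_def)
  then show ?thesis
    by (simp add: Psi_def)
qed

text \<open>A limit of strictly increasing functions need not be strictly increasing. That
  \<open>zeta i z\<close> / z is nondecreasing in z, a consequence of R l / l being nonincreasing,
  survives the limit and gives strictness.\<close>

lemma zeta_ratio:
  assumes "0 \<le> z" "z \<le> z'" "z' \<le> 4 / 3"
  shows "zeta i z \<le> zeta i z' \<and> z' * zeta i z \<le> z * zeta i z'"
proof (induction i)
  case 0
  then show ?case
    using assms by (simp add: mult.commute)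
next
  case (Suc i)
  have z: "0 \<le> z" "z \<le> 4 / 3" "0 \<le> z'" "z' \<le> 4 / 3"
    using assms by auto
  let ?x = "zeta (Suc i) z" and ?x' = "zeta (Suc i) z'"
  note r = zeta_range[OF z(1,2), of i] zeta_range[OF z(3,4), of i]
  have le: "?x \<le> ?x'"
    using phi_less_iff[of "zeta i z'" "zeta i z"] r Suc by auto
  have gr: "growth ?x' \<le> growth ?x" "8 \<le> growth ?x'"
    using gp_kp_antimono[of ?x ?x'] growth_bounds[of ?x'] r le by (auto simp: growth_def)
  have "(z' * ?x) * growth ?x' \<le> (z' * ?x) * growth ?x"
    using z r gr by (intro mult_left_mono) auto
  also have "\<dots> = z' * zeta i z"
    using zeta_growth[OF z(1,2), of i] by (simp only: mult.assoc)
  also have "\<dots> \<le> z * zeta i z'"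
    using Suc by simp
  also have "\<dots> = (z * ?x') * growth ?x'"
    using zeta_growth[OF z(3,4), of i] by (simp only: mult.assoc)
  finally have "(z' * ?x) * growth ?x' \<le> (z * ?x') * growth ?x'" .
  then have "z' * ?x \<le> z * ?x'"
    using gr by (auto simp: mult_le_cancel_right)
  then show ?case
    using le by blast
qed

lemma Psi_strict_mono:
  assumes "0 \<le> z" "z < z'" "z' \<le> 4 / 3"
  shows "Psi z < Psi z'"
proof -
  have "z' * psi i z \<le> z * psi i z'" for i
  proof -
    have "vs_rho n ^ i * (z' * zeta i z) \<le> vs_rho n ^ i * (z * zeta i z')"
      using zeta_ratio[of z z' i] assms rho_pos by (intro mult_left_mono) auto
    then show ?thesis
      by (simp add: psi_def mult_ac)
  qed
  then have le: "z' * Psi z \<le> z * Psi z'"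
    using assms by (intro LIMSEQ_le[OF tendsto_mult_left[OF psi_tendsto] tendsto_mult_left[OF psi_tendsto]]) auto
  have "0 < Psi z'"
    using Psi_ge[of z'] assms by auto
  then have "z * Psi z' < z' * Psi z'"
    using assms by simp
  then have "z' * Psi z < z' * Psi z'"
    using le by simp
  then show ?thesis
    using assms by simp
qed

lemma Psi_less_iff: "0 \<le> z \<Longrightarrow> z \<le> 4/3 \<Longrightarrow> 0 \<le> z' \<Longrightarrow> z' \<le> 4/3 \<Longrightarrow> Psi z < Psi z' \<longleftrightarrow> z < z'"
  using Psi_strict_mono by (metis less_asym linorder_neqE_linordered_idom less_irrefl)

lemma Psi_surj:
  assumes "0 < t" "t \<le> Psi z" "0 \<le> z" "z \<le> 4 / 3"
  obtains x where "0 < x" "x \<le> z" "Psi x = t"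
proof -
  have "\<exists>x\<ge>0. x \<le> z \<and> Psi x = t"
    using assms Psi_0 continuous_on_subset[OF continuous_on_Psi] by (intro IVT') auto
  then obtain x where "0 \<le> x" "x \<le> z" "Psi x = t"
    by blast
  moreover have "x \<noteq> 0"
    using Psi_0 assms(1) \<open>Psi x = t\<close> by auto
  ultimately show ?thesis
    using that by (metis less_eq_real_def)
qed

section \<open>The Vicsek set\<close>

definition pt :: "nat \<Rightarrow> pt2 \<Rightarrow> real \<times> real" where
  "pt m Q = (real_of_int (fst Q) / real_of_int L ^ m, real_of_int (snd Q) / real_of_int L ^ m)"

lemma Lr_pos: "0 < real_of_int L" "real_of_int L = 2 * real n - 1" "3 \<le> real_of_int L"
  using L_mid n_ge_2 by (auto simp: L_def)

lemma pt_inj: "pt m Q = pt m Q' \<longleftrightarrow> Q = Q'"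
  using Lr_pos by (auto simp: pt_def prod_eq_iff)

lemma pt_lat: "pt (Suc m) (lat Q) = pt m Q"
  using Lr_pos by (simp add: pt_def lat_def)

lemma sub_add: "sub (A + B) s e = sub A s e + lat B"
  by (cases A; cases B; cases e) (simp add: sub.simps lat_def algebra_simps)

definition shift :: "nat \<Rightarrow> pt2 \<Rightarrow> pt2" where "shift m c = (L ^ m * fst c, L ^ m * snd c)"

lemma lat_shift: "lat (shift m c) = shift (Suc m) c"
  by (simp add: lat_def shift_def mult.assoc)

text \<open>The similarities in the definition of the Vicsek set act from outside, while
  \<open>cel\<close> refines the innermost cells. Both recursions produce the same cells.\<close>

lemma cel_outer: "cel (Suc m) = {A + shift m c | c A. c \<in> cel 1 \<and> A \<in> cel m}"
proof (induction m)
  case 0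
  have "(0, 0) + shift 0 c = c" for c
    by (simp add: shift_def prod_eq_iff)
  then show ?case
    by simp
next
  case (Suc m)
  have "cel (Suc (Suc m)) = {sub B s e | B s e. B \<in> cel (Suc m) \<and> s < n \<and> e \<in> cor}"
    by (rule cel.simps(2))
  also have "\<dots> = {sub (A + shift m c) s e | c A s e. c \<in> cel 1 \<and> A \<in> cel m \<and> s < n \<and> e \<in> cor}"
    unfolding Suc by blast
  also have "\<dots> = {sub A s e + shift (Suc m) c | c A s e. c \<in> cel 1 \<and> A \<in> cel m \<and> s < n \<and> e \<in> cor}"
    unfolding sub_add lat_shift ..
  also have "\<dots> = {A + shift (Suc m) c | c A. c \<in> cel 1 \<and> A \<in> cel (Suc m)}"
    unfolding cel.simps(2)[of m] by blast
  finally show ?case .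
qed

lemma vert_outer: "vert (Suc m) = {Q + shift m c | c Q. c \<in> cel 1 \<and> Q \<in> vert m}"
proof -
  have "vert (Suc m) = {(A + shift m c) + e | c A e. c \<in> cel 1 \<and> A \<in> cel m \<and> e \<in> cor}"
    unfolding vert_def cel_outer by blast
  also have "\<dots> = {(A + e) + shift m c | c A e. c \<in> cel 1 \<and> A \<in> cel m \<and> e \<in> cor}"
    unfolding add.assoc add.commute[of "shift m _"] ..
  also have "\<dots> = {Q + shift m c | c Q. c \<in> cel 1 \<and> Q \<in> vert m}"
    unfolding vert_def by blast
  finally show ?thesis .
qed

section \<open>Agreement with the vertices, cells and graph Laplacians of the definition\<close>

definition off_int :: "nat \<times> nat \<Rightarrow> pt2" where "off_int c = (int (fst c), int (snd c))"

lemma cel_1: "cel 1 = off_int ` vs_offsets n"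
proof (intro equalityI subsetI)
  fix B assume "B \<in> cel 1"
  then obtain s e where B: "B = sub (0, 0) s e" "s < n" "e \<in> cor"
    by auto
  have s: "int s \<le> mid"
    using B(2) by (simp add: mid_def)
  obtain a b where ab: "B = (a, b)"
    by (cases B)
  have "0 \<le> a \<and> 0 \<le> b \<and> a < L \<and> b < L \<and> (a = b \<or> a + b = L - 1)"
    using B(3) s L_mid ab unfolding B(1) by (elim corE) (auto simp: sub.simps)
  then have "B = off_int (nat a, nat b)" "(nat a, nat b) \<in> vs_offsets n"
    using ab n_ge_2 by (auto simp: off_int_def vs_offsets_def L_def)
  then show "B \<in> off_int ` vs_offsets n"
    by blast
next
  fix B assume "B \<in> off_int ` vs_offsets n"
  then obtain a b where ab: "B = (int a, int b)" "a < 2 * n - 1" "b < 2 * n - 1" "a = b \<or> a + b = 2 * n - 2"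
    by (auto simp: off_int_def vs_offsets_def)
  define s where "s = nat \<bar>int a - mid\<bar>"
  have s: "s < n" "int s = \<bar>int a - mid\<bar>"
    using ab n_ge_2 by (auto simp: s_def mid_def)
  have "\<exists>e\<in>cor. B = sub (0, 0) s e"
  proof -
    have "a = b \<or> int a + int b = 2 * mid"
      using ab n_ge_2 by (auto simp: mid_def)
    then consider "a = b" "int a \<le> mid" | "a = b" "mid < int a"
      | "int a + int b = 2 * mid" "int a \<le> mid" | "int a + int b = 2 * mid" "mid < int a"
      by linarith
    then show ?thesis
    proof cases
      case 1
      then show ?thesis
        using ab s by (intro bexI[of _ "(0, 0)"]) (auto simp: sub.simps cor_def)
    next
      case 2
      then show ?thesis
        using ab s by (intro bexI[of _ "(1, 1)"]) (auto simp: sub.simps cor_def)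
    next
      case 3
      then show ?thesis
        using ab s by (intro bexI[of _ "(0, 1)"]) (auto simp: sub.simps cor_def)
    next
      case 4
      then show ?thesis
        using ab s by (intro bexI[of _ "(1, 0)"]) (auto simp: sub.simps cor_def)
    qed
  qed
  then show "B \<in> cel 1"
    using s(1) by auto
qed

lemma vs_map_pt: "vs_map n c (pt m Q) = pt (Suc m) (Q + shift m (off_int c))"
  unfolding vs_map_def Lr_pos(2)[symmetric] using Lr_pos(1)
  by (simp add: pt_def shift_def off_int_def field_simps)

lemma vs_vertices_eq: "vs_vertices n m = pt m ` vert m"
proof (induction m)
  case 0
  have "vert 0 = cor"
  proof -
    have "(0, 0) + e = e" for e :: pt2
      by (simp add: prod_eq_iff)
    then show ?thesis
      unfolding vert_def cel.simps by force
  qed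
  then show ?case
    by (auto simp: square_corners_def cor_def pt_def)
next
  case (Suc m)
  have "vs_vertices n (Suc m) = (\<Union>c\<in>vs_offsets n. (\<lambda>Q. pt (Suc m) (Q + shift m (off_int c))) ` vert m)"
    by (simp add: Suc image_image vs_map_pt)
  also have "\<dots> = pt (Suc m) ` {Q + shift m c | c Q. c \<in> cel 1 \<and> Q \<in> vert m}"
    unfolding cel_1 by blast
  finally show ?case
    unfolding vert_outer .
qed

lemma vs_cells_eq: "vs_cells n m = (\<lambda>A. (\<lambda>e. pt m (A + e)) ` cor) ` cel m"
proof (induction m)
  case 0
  have "(0, 0) + e = e" for e :: pt2
    by (simp add: prod_eq_iff)
  then show ?case
    by (auto simp: square_corners_def cor_def pt_def)
next
  case (Suc m)
  have "vs_cells n (Suc m) = (\<Union>c\<in>vs_offsets n. (\<lambda>A. (\<lambda>e. pt (Suc m) ((A + shift m (off_int c)) + e)) ` cor) ` cel m)"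
    by (simp add: Suc image_image vs_map_pt add_ac)
  also have "\<dots> = (\<lambda>A. (\<lambda>e. pt (Suc m) (A + e)) ` cor) ` {A + shift m c | c A. c \<in> cel 1 \<and> A \<in> cel m}"
    unfolding cel_1 by blast
  finally show ?case
    unfolding cel_outer .
qed

text \<open>Hence the neighbours of a vertex split disjointly over its cells, three for each, and
  sums over neighbours become sums over cells.\<close>

lemma cells_share_one:
  assumes "A \<in> cells_at m Q" "A' \<in> cells_at m Q" "A \<noteq> A'" "e \<in> cor" "e' \<in> cor" "A + e = A' + e'"
  shows "A + e = Q"
proof -
  define f where "f = Q - A"
  have f: "f \<in> cor" "A \<in> cel m" "Q = A + f"
    using assms(1) by (auto simp: cells_at_def f_def)
  have "A' = A + step f"
    using at_subset[OF f(2,1)] assms(2,3) f(3) by (auto split: if_splits)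
  then have "A + e = A + (step f + e')"
    using assms(6) by (simp add: add.assoc)
  then have "e = step f + e'"
    by (metis add_left_cancel)
  then have "e = f"
    using assms(4,5) f(1) by (auto simp: cor_def step_def prod_eq_iff)
  then show ?thesis
    using f(3) by simp
qed

lemma vs_neighbours_eq:
  assumes "Q \<in> vert m"
  shows "vs_neighbours n m (pt m Q) = pt m ` (\<Union>A\<in>cells_at m Q. (\<lambda>e. A + e) ` cor - {Q})"
proof (intro equalityI subsetI)
  fix y assume "y \<in> vs_neighbours n m (pt m Q)"
  then obtain A e e' where y: "y \<noteq> pt m Q" "A \<in> cel m" "e \<in> cor" "e' \<in> cor" "pt m Q = pt m (A + e)" "y = pt m (A + e')"
    unfolding vs_neighbours_def vs_cells_eq by blast
  then have "Q = A + e" "A + e' \<noteq> Q"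
    using pt_inj by blast+
  then have "A \<in> cells_at m Q" "A + e' \<in> (\<lambda>e. A + e) ` cor - {Q}"
    using y by (auto simp: cells_at_def)
  then show "y \<in> pt m ` (\<Union>A\<in>cells_at m Q. (\<lambda>e. A + e) ` cor - {Q})"
    using y(6) by blast
next
  fix y assume "y \<in> pt m ` (\<Union>A\<in>cells_at m Q. (\<lambda>e. A + e) ` cor - {Q})"
  then obtain A e where y: "A \<in> cells_at m Q" "e \<in> cor" "A + e \<noteq> Q" "y = pt m (A + e)"
    by blast
  have A: "A \<in> cel m" "Q - A \<in> cor" "Q = A + (Q - A)"
    using y(1) by (auto simp: cells_at_def)
  have "y \<noteq> pt m Q"
    using y(3,4) by (simp add: pt_inj)
  moreover have "pt m Q \<in> (\<lambda>e. pt m (A + e)) ` cor"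
    using A(2) by (intro image_eqI[of _ _ "Q - A"]) simp_all
  moreover have "y \<in> (\<lambda>e. pt m (A + e)) ` cor"
    using y by blast
  ultimately show "y \<in> vs_neighbours n m (pt m Q)"
    unfolding vs_neighbours_def vs_cells_eq using A(1) by blast
qed

lemma sum_neighbours:
  fixes g :: "real \<times> real \<Rightarrow> real"
  assumes "Q \<in> vert m"
  shows "(\<Sum>y\<in>vs_neighbours n m (pt m Q). g y)
     = (\<Sum>A\<in>cells_at m Q. (\<Sum>e\<in>cor. g (pt m (A + e))) - g (pt m Q))"
proof -
  have inj: "inj_on (pt m) S" for S
    using pt_inj by (auto simp: inj_on_def)
  have "(\<Sum>y\<in>vs_neighbours n m (pt m Q). g y)
     = (\<Sum>P\<in>(\<Union>A\<in>cells_at m Q. (\<lambda>e. A + e) ` cor - {Q}). g (pt m P))"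
    unfolding vs_neighbours_eq[OF assms] sum.reindex[OF inj] o_def ..
  also have "\<dots> = (\<Sum>A\<in>cells_at m Q. \<Sum>P\<in>(\<lambda>e. A + e) ` cor - {Q}. g (pt m P))"
  proof (rule sum.UNION_disjoint)
    show "\<forall>A\<in>cells_at m Q. \<forall>A'\<in>cells_at m Q. A \<noteq> A' \<longrightarrow>
        ((\<lambda>e. A + e) ` cor - {Q}) \<inter> ((\<lambda>e. A' + e) ` cor - {Q}) = {}"
      using cells_share_one by blast
  qed auto
  also have "\<dots> = (\<Sum>A\<in>cells_at m Q. (\<Sum>e\<in>cor. g (pt m (A + e))) - g (pt m Q))"
  proof (rule sum.cong[OF refl])
    fix A assume A: "A \<in> cells_at m Q"
    have inA: "inj_on (\<lambda>e. A + e) cor"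
      by (auto simp: inj_on_def)
    have "Q \<in> (\<lambda>e. A + e) ` cor"
      using A by (auto simp: cells_at_def intro!: image_eqI[of _ _ "Q - A"])
    then have "(\<Sum>P\<in>(\<lambda>e. A + e) ` cor - {Q}. g (pt m P)) = (\<Sum>P\<in>(\<lambda>e. A + e) ` cor. g (pt m P)) - g (pt m Q)"
      by (simp add: sum_diff1)
    then show "(\<Sum>P\<in>(\<lambda>e. A + e) ` cor - {Q}. g (pt m P)) = (\<Sum>e\<in>cor. g (pt m (A + e))) - g (pt m Q)"
      unfolding sum.reindex[OF inA] o_def .
  qed
  finally show ?thesis .
qed

lemma Lop_graph_laplacian:
  assumes "Q \<in> vert m"
  shows "Lop m z (\<lambda>Q. u (pt m Q)) Q
     = 3 * card (cells_at m Q) * (graph_laplacian n m u (pt m Q) + z * u (pt m Q))"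
proof -
  let ?N = "vs_neighbours n m (pt m Q)" and ?c = "real (card (cells_at m Q))"
  have "real (card ?N) = (\<Sum>y\<in>?N. 1)"
    by simp
  also have "\<dots> = (\<Sum>A\<in>cells_at m Q. (\<Sum>e\<in>cor. 1) - 1)"
    by (rule sum_neighbours[OF assms])
  also have "\<dots> = 3 * ?c"
    by (simp add: sum_cor del: sum_constant) simp
  finally have card: "real (card ?N) = 3 * ?c" .
  have c: "0 < ?c"
    using card_at_pos[OF assms] by simp
  have "(\<Sum>y\<in>?N. u y - u (pt m Q)) = (\<Sum>A\<in>cells_at m Q. (\<Sum>e\<in>cor. u (pt m (A + e)) - u (pt m Q)))"
    unfolding sum_neighbours[OF assms] by simp
  also have "\<dots> = (\<Sum>A\<in>cells_at m Q. cell_sum (\<lambda>Q. u (pt m Q)) A - 4 * u (pt m Q))"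
    by (simp add: cell_sum_def sum_cor add.assoc)
  finally have s: "(\<Sum>y\<in>?N. u y - u (pt m Q)) = \<dots>" .
  have "Lop m z (\<lambda>Q. u (pt m Q)) Q
      = (\<Sum>A\<in>cells_at m Q. (cell_sum (\<lambda>Q. u (pt m Q)) A - 4 * u (pt m Q)) + 3 * z * u (pt m Q))"
    unfolding Lop_def by (simp add: algebra_simps)
  also have "\<dots> = (\<Sum>y\<in>?N. u y - u (pt m Q)) + ?c * (3 * z * u (pt m Q))"
    unfolding s by (simp add: sum.distrib)
  also have "(\<Sum>y\<in>?N. u y - u (pt m Q)) = 3 * ?c * graph_laplacian n m u (pt m Q)"
    unfolding graph_laplacian_def card using c by (subst nonzero_mult_div_cancel_left[symmetric, of "3 * ?c"]) auto
  finally show ?thesis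
    by (simp add: algebra_simps)
qed

section \<open>The Vicsek set as the closure of the vertices\<close>

definition Ver :: "(real \<times> real) set" where "Ver = (\<Union>m. vs_vertices n m)"

lemma vs_vertices_mono: "vs_vertices n m \<subseteq> vs_vertices n (Suc m)"
proof
  fix x assume "x \<in> vs_vertices n m"
  then obtain Q where "Q \<in> vert m" "x = pt m Q"
    by (auto simp: vs_vertices_eq)
  then have "x = pt (Suc m) (lat Q)" "lat Q \<in> vert (Suc m)"
    by (auto simp: pt_lat lat_vert_iff)
  then show "x \<in> vs_vertices n (Suc m)"
    unfolding vs_vertices_eq by blast
qed

lemma vs_vertices_mono_le: "m \<le> k \<Longrightarrow> vs_vertices n m \<subseteq> vs_vertices n k"
  using lift_Suc_mono_le[of "vs_vertices n"] vs_vertices_mono by blast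

lemma finite_offsets: "finite (vs_offsets n)"
proof (rule finite_subset)
  show "vs_offsets n \<subseteq> {..<2 * n - 1} \<times> {..<2 * n - 1}"
    by (auto simp: vs_offsets_def)
qed simp

lemma Ver_invariant: "Ver = (\<Union>c\<in>vs_offsets n. vs_map n c ` Ver)"
proof -
  have "Ver = (\<Union>m. vs_vertices n (Suc m))"
    unfolding Ver_def using vs_vertices_mono by blast
  also have "\<dots> = (\<Union>c\<in>vs_offsets n. vs_map n c ` Ver)"
    unfolding Ver_def by auto
  finally show ?thesis .
qed

lemma Ver_bounded: "bounded Ver"
proof (rule bounded_subset[OF bounded_cbox])
  show "Ver \<subseteq> cbox (0, 0) (1, 1)"
  proof -
    have "vs_vertices n m \<subseteq> cbox (0, 0) (1, 1)" for m
    proof (induction m)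
      case 0
      show ?case
        by (auto simp: square_corners_def cbox_Pair_eq)
    next
      case (Suc m)
      have step: "vs_map n c x \<in> cbox (0, 0) (1, 1)" if c: "c \<in> vs_offsets n" and x: "x \<in> cbox (0, 0) (1, 1)" for c x
      proof -
        have "real a + y \<le> 2 * real n - 1" if "a < 2 * n - 1" "y \<le> 1" for a y
        proof -
          have "a + 1 \<le> 2 * n - 1"
            using that by simp
          then have "real a + 1 \<le> 2 * real n - 1"
            using n_ge_2 by linarith
          then show ?thesis
            using that by simp
        qed
        then show ?thesis
          using c x n_ge_2 by (cases c; cases x) (auto simp: vs_map_def vs_offsets_def cbox_Pair_eq)
      qed
      show ?case
      proof
        fix y assume "y \<in> vs_vertices n (Suc m)"
        then obtain c x where "c \<in> vs_offsets n" "x \<in> vs_vertices n m" "y = vs_map n c x"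
          by auto
        then show "y \<in> cbox (0, 0) (1, 1)"
          using Suc step by blast
      qed
    qed
    then show ?thesis
      by (auto simp: Ver_def)
  qed
qed

lemma vs_map_image: "vs_map n c ` S = (*\<^sub>R) (1 / (2 * real n - 1)) ` ((+) (real (fst c), real (snd c)) ` S)"
  unfolding image_image vs_map_def ..

lemma dist_vs_map: "dist (vs_map n c x) (vs_map n c y) = dist x y / (2 * real n - 1)"
proof -
  have "vs_map n c x - vs_map n c y = (1 / (2 * real n - 1)) *\<^sub>R (x - y)"
    by (simp add: vs_map_def scaleR_diff_right[symmetric])
  then show ?thesis
    using n_ge_2 by (simp add: dist_norm)
qed

text \<open>The largest distance d of a point of K from K' satisfies d \<le> d / (2 n - 1), hence is
  0. Applied in both directions this is the uniqueness of the attractor.\<close>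

lemma invariant_subset:
  assumes K: "compact K" "K \<noteq> {}" "K \<subseteq> (\<Union>c\<in>vs_offsets n. vs_map n c ` K)"
    and K': "compact K'" "K' \<noteq> {}" "(\<Union>c\<in>vs_offsets n. vs_map n c ` K') \<subseteq> K'"
  shows "K \<subseteq> K'"
proof -
  have "continuous_on K (\<lambda>x. infdist x K')"
    by (intro continuous_intros)
  then obtain x where x: "x \<in> K" "\<forall>y\<in>K. infdist y K' \<le> infdist x K'"
    using continuous_attains_sup[OF K(1,2)] by blast
  obtain c y where y: "c \<in> vs_offsets n" "y \<in> K" "x = vs_map n c y"
    using K(3) x(1) by blast
  obtain w where w: "w \<in> K'" "infdist y K' = dist y w"
    using infdist_attains_inf[OF compact_imp_closed[OF K'(1)] K'(2)] by blast
  have "vs_map n c w \<in> K'"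
    using K'(3) y(1) w(1) by blast
  then have "infdist x K' \<le> dist x (vs_map n c w)"
    by (rule infdist_le)
  also have "\<dots> = infdist y K' / (2 * real n - 1)"
    unfolding y(3) dist_vs_map w(2) ..
  also have "\<dots> \<le> infdist x K' / (2 * real n - 1)"
    using x(2) y(2) n_ge_2 by (intro divide_right_mono) auto
  finally have "infdist x K' * (2 * real n - 1) \<le> infdist x K'"
    using n_ge_2 by (simp add: pos_le_divide_eq)
  then have "infdist x K' * (2 * real n - 2) \<le> 0"
    by (simp add: algebra_simps)
  then have "infdist x K' \<le> 0"
    using n_ge_2 by (simp add: mult_le_0_iff)
  show ?thesis
  proof
    fix y assume "y \<in> K"
    then have "infdist y K' = 0"
      using x(2) \<open>infdist x K' \<le> 0\<close> infdist_nonneg[of y K'] by force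
    then show "y \<in> K'"
      using in_closed_iff_infdist_zero[OF compact_imp_closed[OF K'(1)] K'(2)] by blast
  qed
qed

lemma vicsek_set_eq: "vicsek_set n = closure Ver"
proof -
  let ?P = "\<lambda>K. compact K \<and> K \<noteq> {} \<and> K = (\<Union>c\<in>vs_offsets n. vs_map n c ` K)"
  have "closure Ver = closure (\<Union>c\<in>vs_offsets n. vs_map n c ` Ver)"
    using Ver_invariant by simp
  also have "\<dots> = (\<Union>c\<in>vs_offsets n. closure (vs_map n c ` Ver))"
  proof -
    have *: "closure (\<Union>c\<in>I. S c) = (\<Union>c\<in>I. closure (S c))" if "finite I"
      for I :: "(nat \<times> nat) set" and S :: "nat \<times> nat \<Rightarrow> (real \<times> real) set"
      using that by (induction I rule: finite_induct) auto
    show ?thesis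
      by (rule *[OF finite_offsets])
  qed
  also have "\<dots> = (\<Union>c\<in>vs_offsets n. vs_map n c ` closure Ver)"
    unfolding vs_map_image closure_scaleR[symmetric] closure_translation ..
  finally have inv: "closure Ver = (\<Union>c\<in>vs_offsets n. vs_map n c ` closure Ver)" .
  have "Ver \<noteq> {}"
  proof -
    obtain q where "q \<in> vert 0"
      using vert_nonempty by blast
    then have "pt 0 q \<in> Ver"
      unfolding Ver_def vs_vertices_eq by blast
    then show ?thesis
      by blast
  qed
  then have P: "?P (closure Ver)"
    using inv Ver_bounded by (auto simp: compact_closure closure_eq_empty)
  have "K = closure Ver" if "?P K" for K
  proof
    have K: "compact K" "K \<noteq> {}" "K \<subseteq> (\<Union>c\<in>vs_offsets n. vs_map n c ` K)"
      "(\<Union>c\<in>vs_offsets n. vs_map n c ` K) \<subseteq> K"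
      using that by blast+
    have C: "compact (closure Ver)" "closure Ver \<noteq> {}" "closure Ver \<subseteq> (\<Union>c\<in>vs_offsets n. vs_map n c ` closure Ver)"
      "(\<Union>c\<in>vs_offsets n. vs_map n c ` closure Ver) \<subseteq> closure Ver"
      using P by blast+
    show "K \<subseteq> closure Ver"
      by (rule invariant_subset[OF K(1-3) C(1,2,4)])
    show "closure Ver \<subseteq> K"
      by (rule invariant_subset[OF C(1-3) K(1,2,4)])
  qed
  then show ?thesis
    unfolding vicsek_set_def using P by (intro the_equality) blast+
qed

lemma compact_vicsek: "compact (vicsek_set n)"
  using Ver_bounded by (simp add: vicsek_set_eq compact_closure)

lemma vertex_in_vicsek: "Q \<in> vert m \<Longrightarrow> pt m Q \<in> vicsek_set n"
proof -
  assume "Q \<in> vert m"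
  then have "pt m Q \<in> Ver"
    unfolding Ver_def vs_vertices_eq by blast
  then show ?thesis
    unfolding vicsek_set_eq using closure_subset by blast
qed

section \<open>Continuity of iterated extensions\<close>

definition osc_on :: "nat \<Rightarrow> (pt2 \<Rightarrow> real) \<Rightarrow> real \<Rightarrow> bool" where
  "osc_on m p w \<longleftrightarrow> (\<forall>A\<in>cel m. \<forall>e\<in>cor. \<forall>f\<in>cor. \<bar>p (A + e) - p (A + f)\<bar> \<le> w)"

text \<open>All bounds are values at 0 with some slack: \<open>ep 0\<close> = 8, \<open>gp 0\<close>
  = 2 n - 1, so their product is at least 24. The bound 16 is what makes the contraction factor 4 *
  3 / 16 = 3/4 below.\<close>

lemma small_parameter:
  obtains r where "0 < r" "r \<le> tp 0"
    "\<And>l. 0 \<le> l \<Longrightarrow> l \<le> r \<Longrightarrow> 16 \<le> ep l * gp l \<and> 4 \<le> ep l \<and> 1 \<le> gp l \<and>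
      (\<forall>s\<le>n. \<bar>chebG s l\<bar> \<le> 2 * real n \<and> \<bar>chebB s l\<bar> \<le> real n + 1)"
proof -
  have lim: "f \<midarrow>0\<rightarrow> f 0" if "continuous_on UNIV f" for f :: "real \<Rightarrow> real"
    using that by (simp add: continuous_on_eq_continuous_at isCont_def)
  have 1: "\<forall>\<^sub>F l in at 0. 16 < ep l * gp l"
    using order_tendstoD(1)[OF lim[of "\<lambda>l. ep l * gp l"], of 16] combos_0 n_ge_2
    by (auto intro: continuous_intros)
  have 2: "\<forall>\<^sub>F l in at 0. 4 < ep l"
    using order_tendstoD(1)[OF lim[of ep], of 4] combos_0 by (auto intro: continuous_intros)
  have 3: "\<forall>\<^sub>F l in at 0. 1 < gp l"
    using order_tendstoD(1)[OF lim[of gp], of 1] combos_0 n_ge_2 by (auto intro: continuous_intros)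
  have 4: "\<forall>\<^sub>F l in at 0. \<bar>chebG s l\<bar> < 2 * real n \<and> \<bar>chebB s l\<bar> < real n + 1" if "s \<le> n" for s
  proof -
    have "\<bar>chebG s 0\<bar> < 2 * real n" "\<bar>chebB s 0\<bar> < real n + 1"
      using that n_ge_2 by (auto simp: chebG_0 chebB_0)
    then have "\<forall>\<^sub>F l in at 0. \<bar>chebG s l\<bar> < 2 * real n" "\<forall>\<^sub>F l in at 0. \<bar>chebB s l\<bar> < real n + 1"
      using order_tendstoD(2)[OF lim[of "\<lambda>l. \<bar>chebG s l\<bar>"]] order_tendstoD(2)[OF lim[of "\<lambda>l. \<bar>chebB s l\<bar>"]]
      by (auto intro: continuous_intros)
    then show ?thesis
      by (rule eventually_conj)
  qed
  have "\<forall>\<^sub>F l in at 0. \<forall>s\<in>{..n}. \<bar>chebG s l\<bar> < 2 * real n \<and> \<bar>chebB s l\<bar> < real n + 1"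
    using 4 by (intro eventually_ball_finite) auto
  then have "\<forall>\<^sub>F l in at 0. (16 < ep l * gp l \<and> 4 < ep l) \<and> 1 < gp l \<and>
      (\<forall>s\<in>{..n}. \<bar>chebG s l\<bar> < 2 * real n \<and> \<bar>chebB s l\<bar> < real n + 1)"
    by (intro eventually_conj 1 2 3)
  then obtain d where d: "0 < d" "\<And>l. l \<noteq> 0 \<Longrightarrow> dist l 0 < d \<Longrightarrow> (16 < ep l * gp l \<and> 4 < ep l) \<and> 1 < gp l \<and>
      (\<forall>s\<in>{..n}. \<bar>chebG s l\<bar> < 2 * real n \<and> \<bar>chebB s l\<bar> < real n + 1)"
    unfolding eventually_at by auto
  show ?thesis
  proof
    show "0 < min (d / 2) (tp 0)" "min (d / 2) (tp 0) \<le> tp 0"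
      using d(1) tp_0_pos by auto
    fix l assume l: "0 \<le> l" "l \<le> min (d / 2) (tp 0)"
    show "16 \<le> ep l * gp l \<and> 4 \<le> ep l \<and> 1 \<le> gp l \<and>
      (\<forall>s\<le>n. \<bar>chebG s l\<bar> \<le> 2 * real n \<and> \<bar>chebB s l\<bar> \<le> real n + 1)"
    proof (cases "l = 0")
      case True
      have "\<bar>chebG s 0\<bar> \<le> 2 * real n \<and> \<bar>chebB s 0\<bar> \<le> real n + 1" if "s \<le> n" for s
        using that n_ge_2 by (auto simp: chebG_0 chebB_0)
      then show ?thesis
        using True combos_0 n_ge_2 by auto
    next
      case False
      have "dist l 0 < d"
        using l d(1) by (auto simp: dist_real_def)
      from d(2)[OF False this] show ?thesis
        by (auto intro: less_imp_le)
    qed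
  qed
qed

text \<open>The first summand comes from R l \<le> rho l. In the second, (24 n + 8) M bounds every
  cell sum on a leg when M bounds the function, and an error of 6 l times such a sum accumulates
  over at most n subcells; division by \<open>kap l\<close> \<ge> 3 leaves 2 n.\<close>

definition osc_const :: real where "osc_const = vs_rho n + 2 * real n * (24 * real n + 8)"

lemma osc_const_pos: "0 \<le> osc_const"
  using rho_pos by (simp add: osc_const_def)

text \<open>For l = 0 the cell sums are linear along a leg, so all increments equal the outermost
  one. That one is a flux, controlled by the Laplacian on the parent cell and hence by 3 w. For
  small l this is perturbed by O(l M). The second conjunct adds up at most n increments to compare
  with the corner of the parent.\<close>

lemma ext_osc:
  obtains r where "0 < r" "r \<le> tp 0"
    "\<And>m l p w M. 0 \<le> l \<Longrightarrow> l \<le> r \<Longrightarrow> (\<And>q. \<bar>p q\<bar> \<le> M) \<Longrightarrow> osc_on m p w \<Longrightarrow> 0 \<le> w \<Longrightarrow>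
      osc_on (Suc m) (ext m l p) (3 / 4 * w + osc_const * l * M) \<and>
      (\<forall>A\<in>cel m. \<forall>s<n. \<forall>e\<in>cor. \<forall>f\<in>cor.
        \<bar>ext m l p (sub A s e + f) - p (A + e)\<bar> \<le> (real n + 1) * (3 / 4 * w + osc_const * l * M))"
proof -
  obtain r where r: "0 < r" "r \<le> tp 0"
    "\<And>l. 0 \<le> l \<Longrightarrow> l \<le> r \<Longrightarrow> 16 \<le> ep l * gp l \<and> 4 \<le> ep l \<and> 1 \<le> gp l \<and>
      (\<forall>s\<le>n. \<bar>chebG s l\<bar> \<le> 2 * real n \<and> \<bar>chebB s l\<bar> \<le> real n + 1)"
    using small_parameter by metis
  have main: "osc_on (Suc m) (ext m l p) (3 / 4 * w + osc_const * l * M) \<and>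
      (\<forall>A\<in>cel m. \<forall>s<n. \<forall>e\<in>cor. \<forall>f\<in>cor.
        \<bar>ext m l p (sub A s e + f) - p (A + e)\<bar> \<le> (real n + 1) * (3 / 4 * w + osc_const * l * M))"
    if l: "0 \<le> l" "l \<le> r" and M: "\<And>q. \<bar>p q\<bar> \<le> M" and w: "osc_on m p w" "0 \<le> w" for m l p w M
  proof -
    let ?D = "3 / 4 * w + osc_const * l * M"
    have M0: "0 \<le> M"
      using M[of "(0, 0)"] by (auto intro: order_trans[OF abs_ge_zero])
    have b: "16 \<le> ep l * gp l" "4 \<le> ep l" "1 \<le> gp l"
      "\<And>s. s \<le> n \<Longrightarrow> \<bar>chebG s l\<bar> \<le> 2 * real n" "\<And>s. s \<le> n \<Longrightarrow> \<bar>chebB s l\<bar> \<le> real n + 1"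
      using r(3)[OF l] by auto
    have k: "3 \<le> kap l" "kap l \<le> 4"
      using l r(2) tp_0_pos by (auto simp: kap_def)
    have dl: "0 \<le> dec l" "dec l \<le> vs_rho n * l"
      using growth_bounds[of l] l r(2) mult_left_mono[of "growth l" "vs_rho n" l]
      unfolding dec_growth by (auto simp: mult.commute)
    have D0: "0 \<le> ?D"
      using osc_const_pos l w M0 by simp
    let ?La = "(24 * real n + 8) * M"
    have La0: "0 \<le> ?La"
      using M0 by simp
    have legb: "\<bar>leg l p A s e\<bar> \<le> ?La" if "s \<le> n" for A s e
    proof -
      have S: "\<bar>cell_sum p A\<bar> \<le> 4 * M"
        using M[of "A + (0,0)"] M[of "A + (0,1)"] M[of "A + (1,0)"] M[of "A + (1,1)"]
        unfolding cell_sum_def sum_cor by linarith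
      have base: "\<bar>base l p A\<bar> \<le> 8 * M"
      proof -
        have "2 * kap l * \<bar>cell_sum p A\<bar> \<le> (2 * 4) * (4 * M)"
          using S k M0 by (intro mult_mono) auto
        also have "\<dots> \<le> ep l * (8 * M)"
          using b(2) M0 mult_right_mono[of 4 "ep l" "8 * M"] by simp
        finally show ?thesis
          using b(2) k unfolding base_def by (simp add: abs_mult pos_divide_le_eq mult.commute)
      qed
      have "\<bar>chebG (n - s) l * base l p A + 2 * kap l * chebB s l * p (A + e)\<bar>
          \<le> \<bar>chebG (n - s) l\<bar> * \<bar>base l p A\<bar> + 2 * kap l * \<bar>chebB s l\<bar> * \<bar>p (A + e)\<bar>"
        using k by (intro order_trans[OF abs_triangle_ineq]) (simp add: abs_mult)
      also have "\<dots> \<le> (2 * real n) * (8 * M) + (2 * 4 * (real n + 1)) * M"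
        using b(4)[of "n - s"] b(5)[OF that] base M k M0 by (intro add_mono mult_mono) auto
      also have "\<dots> = ?La"
        by (simp add: algebra_simps)
      finally have "\<bar>chebG (n - s) l * base l p A + 2 * kap l * chebB s l * p (A + e)\<bar> \<le> ?La" .
      also have "?La \<le> ?La * gp l"
        using La0 b(3) by (simp add: mult_le_cancel_left1)
      finally show ?thesis
        using b(3) unfolding leg_def by (simp add: pos_divide_le_eq)
    qed
    have dn: "\<bar>leg l p A n e - leg l p A (n - 1) e\<bar> \<le> kap l * (3 / 4 * (w + vs_rho n * l * M))"
      if A: "A \<in> cel m" and e: "e \<in> cor" for A e
    proof -
      have g: "gp l \<noteq> 0" "ep l \<noteq> 0"
        using b by auto
      have "leg l p A n e - leg l p A (n - 1) e = - 2 * (leg l p A (n - 1) e - kap l * p (A + e))"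
        using leg_end[OF g(1), of p A e] by simp
      also have "\<dots> = - (4 * kap l / (ep l * gp l)) * (cell_sum p A - (4 - 3 * dec l) * p (A + e))"
        unfolding leg_flux[OF g] by simp
      finally have eq: "\<bar>leg l p A n e - leg l p A (n - 1) e\<bar>
          = (4 * kap l / (ep l * gp l)) * \<bar>cell_sum p A - (4 - 3 * dec l) * p (A + e)\<bar>"
        using b k by (simp add: abs_mult)
      have "\<bar>cell_sum p A - 4 * p (A + e)\<bar> \<le> 3 * w"
      proof -
        have "\<bar>p (A + f) - p (A + e)\<bar> \<le> w" if "f \<in> cor" for f
          using w(1) A e that by (auto simp: osc_on_def)
        then have "\<bar>p (A + (0,0)) - p (A + e)\<bar> \<le> w" "\<bar>p (A + (0,1)) - p (A + e)\<bar> \<le> w"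
          "\<bar>p (A + (1,0)) - p (A + e)\<bar> \<le> w" "\<bar>p (A + (1,1)) - p (A + e)\<bar> \<le> w"
          by (auto simp: cor_def)
        then show ?thesis
          using e unfolding cell_sum_def sum_cor by (elim corE; simp only:)
      qed
      moreover have "\<bar>3 * dec l * p (A + e)\<bar> \<le> 3 * (vs_rho n * l * M)"
      proof -
        have "dec l * \<bar>p (A + e)\<bar> \<le> vs_rho n * l * M"
          using dl M by (intro mult_mono) (auto intro: order_trans[OF dl(1)])
        then show ?thesis
          using dl by (simp add: abs_mult)
      qed
      ultimately have "\<bar>(cell_sum p A - 4 * p (A + e)) + 3 * dec l * p (A + e)\<bar> \<le> 3 * w + 3 * (vs_rho n * l * M)"
        by (intro order_trans[OF abs_triangle_ineq] add_mono)
      moreover have "(cell_sum p A - 4 * p (A + e)) + 3 * dec l * p (A + e) = cell_sum p A - (4 - 3 * dec l) * p (A + e)"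
        by (simp add: algebra_simps)
      ultimately have le: "\<bar>cell_sum p A - (4 - 3 * dec l) * p (A + e)\<bar> \<le> 3 * (w + vs_rho n * l * M)"
        by simp
      have "4 * kap l / (ep l * gp l) \<le> 4 * kap l / 16"
        using b k by (intro divide_left_mono) auto
      then have "\<bar>leg l p A n e - leg l p A (n - 1) e\<bar>
          \<le> (4 * kap l / 16) * (3 * (w + vs_rho n * l * M))"
        unfolding eq using le k by (intro mult_mono) auto
      also have "\<dots> = kap l * (3 / 4 * (w + vs_rho n * l * M))"
        by simp
      finally show ?thesis .
    qed
    have ds: "\<bar>leg l p A (Suc s) e - leg l p A s e\<bar> \<le> kap l * ?D"
      if A: "A \<in> cel m" and e: "e \<in> cor" and s: "s < n" for A e s
    proof -
      \<comment> \<open>Going inwards by one subcell changes the increment by 6 l times a cell sum,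
        by \<open>leg_rec\<close>.\<close>
      have step: "\<bar>leg l p A (Suc s) e - leg l p A s e\<bar>
          \<le> \<bar>leg l p A n e - leg l p A (n - 1) e\<bar> + real i * (6 * l * ?La)"
        if "i = n - 1 - s" "s < n" for i s
        using that
      proof (induction i arbitrary: s)
        case 0
        then have "s = n - 1" "Suc s = n"
          by auto
        then show ?case
          by simp
      next
        case (Suc i)
        then have s': "i = n - 1 - Suc s" "Suc s < n"
          by auto
        have "leg l p A (Suc (Suc s)) e - leg l p A (Suc s) e = leg l p A (Suc s) e - leg l p A s e - 6 * l * leg l p A (Suc s) e"
          using leg_rec[of s l p A e] s' by (simp add: algebra_simps)
        moreover have "\<bar>6 * l * leg l p A (Suc s) e\<bar> \<le> 6 * l * ?La"
          using legb[of "Suc s" A e] s' l by (simp add: abs_mult mult_left_mono)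
        moreover have "real (Suc i) * (6 * l * ?La) = real i * (6 * l * ?La) + 6 * l * ?La"
          by (simp add: algebra_simps)
        ultimately show ?case
          using Suc.IH[OF s'] by linarith
      qed
      have "real (n - 1 - s) * (6 * l * ?La) \<le> real n * (6 * l * ?La)"
        using l La0 by (intro mult_right_mono) auto
      also have "\<dots> \<le> kap l * (2 * real n * l * ?La)"
      proof -
        have "3 * (2 * real n * l * ?La) \<le> kap l * (2 * real n * l * ?La)"
          using k(1) l M0 by (intro mult_right_mono mult_nonneg_nonneg) auto
        then show ?thesis
          by (simp add: algebra_simps)
      qed
      finally have "\<bar>leg l p A (Suc s) e - leg l p A s e\<bar>
          \<le> kap l * (3 / 4 * (w + vs_rho n * l * M)) + kap l * (2 * real n * l * ?La)"
        using step[of "n - 1 - s" s] s dn[OF A e] by linarith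
      also have "\<dots> = kap l * (3 / 4 * w + 3 / 4 * (vs_rho n * l * M) + 2 * real n * l * ?La)"
        by (simp add: algebra_simps)
      also have "\<dots> \<le> kap l * ?D"
      proof (rule mult_left_mono)
        have "0 \<le> vs_rho n * l * M"
          using rho_pos l M0 by simp
        moreover have "osc_const * l * M = vs_rho n * l * M + 2 * real n * l * ?La"
          by (simp add: osc_const_def algebra_simps)
        ultimately show "3 / 4 * w + 3 / 4 * (vs_rho n * l * M) + 2 * real n * l * ?La \<le> ?D"
          by linarith
      qed (use k in simp)
      finally show ?thesis .
    qed
    have kp: "0 < kap l"
      using k by simp
    have half: "\<bar>(leg l p A (Suc s) e + leg l p A s e) / (2 * kap l) - leg l p A s e / kap l\<bar> \<le> ?D / 2"
      "\<bar>(leg l p A (Suc s) e + leg l p A s e) / (2 * kap l) - leg l p A (Suc s) e / kap l\<bar> \<le> ?D / 2"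
      if "A \<in> cel m" "e \<in> cor" "s < n" for A e s
    proof -
      let ?d = "leg l p A (Suc s) e - leg l p A s e"
      have "(leg l p A (Suc s) e + leg l p A s e) / (2 * kap l) - leg l p A s e / kap l = ?d / (2 * kap l)"
        "(leg l p A (Suc s) e + leg l p A s e) / (2 * kap l) - leg l p A (Suc s) e / kap l = - (?d / (2 * kap l))"
        using kp by (simp_all add: field_simps)
      moreover have "\<bar>?d / (2 * kap l)\<bar> \<le> ?D / 2"
        using ds[OF that] kp by (simp add: abs_divide divide_le_eq mult_ac)
      ultimately show "\<bar>(leg l p A (Suc s) e + leg l p A s e) / (2 * kap l) - leg l p A s e / kap l\<bar> \<le> ?D / 2"
        "\<bar>(leg l p A (Suc s) e + leg l p A s e) / (2 * kap l) - leg l p A (Suc s) e / kap l\<bar> \<le> ?D / 2"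
        by simp_all
    qed
    have pe: "p (A + e) = (leg l p A n e + leg l p A (n - 1) e) / (2 * kap l)" for A e
      using leg_end[of l p A e] b kp by simp
    have near: "\<bar>ext m l p (sub A s e + f) - leg l p A s e / kap l\<bar> \<le> ?D / 2"
      if A: "A \<in> cel m" and s: "s < n" and e: "e \<in> cor" and f: "f \<in> cor" for A s e f
    proof (cases s)
      case 0
      have "leg l p A 0 f = leg l p A 0 e"
        using leg_0[of l p A] b by simp
      then show ?thesis
        using half(1)[OF A f, of 0] ext_center[OF A f, of l p e] n_ge_2 0 by (simp add: add.commute)
    next
      case (Suc s')
      consider "f = e" "Suc s < n" | "f = e" "s = n - 1" | "f = opp e" | "f \<noteq> e" "f \<noteq> opp e"
        using s by linarith
      then show ?thesis
      proof cases
        case 1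
        then show ?thesis
          using half(1)[OF A e s] ext_leg(1)[OF A e 1(2), of l p] by (simp add: add.commute)
      next
        case 2
        then have "Suc (n - 1) = n"
          using n_ge_2 by simp
        then show ?thesis
          using half(1)[OF A e s] ext_outer[OF e, of m l p A] 2 pe[of A e] by simp
      next
        case 3
        then show ?thesis
          using half(2)[OF A e, of s'] ext_leg(2)[OF A e, of s' l p] s Suc by (simp add: add.commute)
      next
        case 4
        then show ?thesis
          using ext_leg(3)[OF A e _ s f, of l p] Suc D0 by simp
      qed
    qed
    have far: "\<bar>leg l p A s e / kap l - p (A + e)\<bar> \<le> (real n + 1 / 2) * ?D"
      if A: "A \<in> cel m" and s: "s < n" and e: "e \<in> cor" for A s e
    proof -
      have "\<bar>leg l p A s e / kap l - leg l p A (n - 1) e / kap l\<bar> \<le> real i * ?D" if "i = n - 1 - s" "s < n" for i s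
        using that
      proof (induction i arbitrary: s)
        case 0
        then have "s = n - 1"
          by simp
        then show ?case
          by simp
      next
        case (Suc i)
        then have s': "i = n - 1 - Suc s" "Suc s < n"
          by auto
        have "\<bar>leg l p A s e / kap l - leg l p A (Suc s) e / kap l\<bar> \<le> ?D"
          using abs_diff_halves[OF half[OF A e Suc.prems(2)]] .
        moreover have "real (Suc i) * ?D = real i * ?D + ?D"
          by (simp add: algebra_simps)
        ultimately show ?case
          using Suc.IH[OF s'] by linarith
      qed
      from this[OF refl s] have "\<bar>leg l p A s e / kap l - leg l p A (n - 1) e / kap l\<bar> \<le> real (n - 1 - s) * ?D" .
      also have "\<dots> \<le> real n * ?D"
        using D0 by (intro mult_right_mono) auto
      finally have "\<bar>leg l p A s e / kap l - leg l p A (n - 1) e / kap l\<bar> \<le> real n * ?D" .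
      moreover have "\<bar>p (A + e) - leg l p A (n - 1) e / kap l\<bar> \<le> ?D / 2"
        using half(1)[OF A e, of "n - 1"] pe[of A e] n_ge_2 by simp
      moreover have "(real n + 1 / 2) * ?D = real n * ?D + ?D / 2"
        by (rule half_distrib)
      ultimately show ?thesis
        by linarith
    qed
    have "osc_on (Suc m) (ext m l p) ?D"
      unfolding osc_on_def
    proof (intro ballI)
      fix B f g assume B: "B \<in> cel (Suc m)" and fg: "f \<in> cor" "g \<in> cor"
      then obtain A s e where "B = sub A s e" "A \<in> cel m" "s < n" "e \<in> cor"
        unfolding cel.simps by blast
      then show "\<bar>ext m l p (B + f) - ext m l p (B + g)\<bar> \<le> ?D"
        using abs_diff_halves'[OF near near] fg by blast
    qed
    moreover have "\<bar>ext m l p (sub A s e + f) - p (A + e)\<bar> \<le> (real n + 1) * ?D"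
      if "A \<in> cel m" "s < n" "e \<in> cor" "f \<in> cor" for A s e f
    proof -
      have "(real n + 1) * ?D = (real n + 1 / 2) * ?D + ?D / 2"
        by (rule half_distrib')
      then show ?thesis
        using near[OF that] far[OF that(1-3)] by linarith
    qed
    ultimately show ?thesis
      by blast
  qed
  show ?thesis
    using that[OF r(1,2) main] .
qed

end

text \<open>Here \<open>w\<close> bounds oscillations and \<open>M\<close> absolute values. They
  feed each other, but the coupling coefficients \<open>x\<close> are summable, so \<open>M\<close>
  stays bounded, after which \<open>w\<close> decays geometrically.\<close>

lemma osc_sequence:
  fixes w M x :: "nat \<Rightarrow> real" and C k X :: real
  assumes C: "0 \<le> C" "0 \<le> k" and x: "\<And>j. 0 \<le> x j" "\<And>j. x j \<le> X * (1 / 8) ^ j"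
    and nn: "\<And>j. 0 \<le> w j" "\<And>j. 0 \<le> M j"
    and w: "\<And>j. w (Suc j) = 3 / 4 * w j + C * x j * M j"
    and M: "\<And>j. M (Suc j) = M j + k * w (Suc j)"
  obtains D where "0 \<le> D" "\<And>j. w j \<le> D * (7 / 8) ^ j"
proof -
  have X: "0 \<le> X"
    using x(1)[of 0] x(2)[of 0] by simp
  \<comment> \<open>The weight 3 k absorbs the term 3/4 w: it gives
    \<open>Q (Suc j) = Q j + 4 * k * C * x j * M j\<close>, so \<open>Q\<close> grows only through
    the summable coefficients.\<close>
  define Q where "Q j = M j + 3 * k * w j" for j
  have Q0: "0 \<le> Q j" for j
    using nn C by (simp add: Q_def)
  have MQ: "M j \<le> Q j" for j
    using nn C by (simp add: Q_def)
  have Q: "Q j \<le> Q 0 * exp (4 * k * C * (\<Sum>i<j. x i))" for j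
  proof (induction j)
    case (Suc j)
    have "Q (Suc j) = Q j + 4 * k * C * x j * M j"
      unfolding Q_def M w by (simp add: algebra_simps)
    also have "\<dots> \<le> Q j + 4 * k * C * x j * Q j"
      using C x MQ by (intro add_left_mono mult_left_mono) auto
    also have "\<dots> = Q j * (1 + 4 * k * C * x j)"
      by (simp add: algebra_simps)
    also have "\<dots> \<le> Q j * exp (4 * k * C * x j)"
      using Q0 by (intro mult_left_mono exp_ge_add_one_self)
    also have "\<dots> \<le> Q 0 * exp (4 * k * C * (\<Sum>i<j. x i)) * exp (4 * k * C * x j)"
      using Suc by (intro mult_right_mono) auto
    also have "\<dots> = Q 0 * exp (4 * k * C * (\<Sum>i<Suc j. x i))"
      by (simp add: exp_add[symmetric] algebra_simps)
    finally show ?case .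
  qed simp
  define B where "B = Q 0 * exp (4 * k * C * (2 * X))"
  have B: "Q j \<le> B" for j
  proof -
    have "(\<Sum>i<j. x i) \<le> (\<Sum>i<j. X * (1 / 8) ^ i)"
      by (intro sum_mono x)
    also have "\<dots> = X * ((1 - (1 / 8 :: real) ^ j) / (1 - 1 / 8))"
      unfolding sum_distrib_left[symmetric] by (subst sum_gp_strict) simp
    also have "\<dots> \<le> X * 2"
      using X by (intro mult_left_mono) (simp_all add: field_simps)
    finally have "4 * k * C * (\<Sum>i<j. x i) \<le> 4 * k * C * (2 * X)"
      using C by (intro mult_left_mono) auto
    then have "Q 0 * exp (4 * k * C * (\<Sum>i<j. x i)) \<le> B"
      unfolding B_def using Q0 by (intro mult_left_mono) auto
    then show ?thesis
      using Q[of j] by linarith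
  qed
  have B0: "0 \<le> B"
    using Q0 B by (metis order_trans)
  \<comment> \<open>Chosen such that the perturbation is at most D / 8; then 3/4 + 1/8 = 7/8 is the
    rate of decay.\<close>
  define D where "D = w 0 + 8 * (C * X * B)"
  have D0: "0 \<le> D" "C * X * B \<le> D / 8"
    using nn(1)[of 0] C X B0 by (simp_all add: D_def)
  have wD: "w j \<le> D * (7 / 8) ^ j" for j
  proof (induction j)
    case 0
    then show ?case
      using C X B0 by (simp add: D_def)
  next
    case (Suc j)
    have "C * x j * M j \<le> C * (X * (1 / 8) ^ j) * B"
      using C x nn X order_trans[OF MQ B] by (intro mult_mono) auto
    also have "\<dots> = (C * X * B) * (1 / 8) ^ j"
      by (simp add: algebra_simps)
    also have "\<dots> \<le> (D / 8) * (7 / 8) ^ j"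
      using D0 by (intro mult_mono power_mono) auto
    finally have "w (Suc j) \<le> 3 / 4 * (D * (7 / 8) ^ j) + (D / 8) * (7 / 8) ^ j"
      using Suc unfolding w by linarith
    then show ?case
      by simp
  qed
  show ?thesis
    using that[OF D0(1) wD] .
qed

text \<open>The majorants of oscillation and absolute value as a pair. At the start the oscillation
  is at most twice the bound of the values.\<close>

primrec bound_seq :: "real \<Rightarrow> real \<Rightarrow> (nat \<Rightarrow> real) \<Rightarrow> real \<Rightarrow> nat \<Rightarrow> real \<times> real" where
  "bound_seq C k x M0 0 = (2 * M0, M0)"
| "bound_seq C k x M0 (Suc j) =
     (let w = 3 / 4 * fst (bound_seq C k x M0 j) + C * x j * snd (bound_seq C k x M0 j)
      in (w, snd (bound_seq C k x M0 j) + k * w))"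

context vicsek
begin

primrec Wf :: "nat \<Rightarrow> real \<Rightarrow> (pt2 \<Rightarrow> real) \<Rightarrow> nat \<Rightarrow> pt2 \<Rightarrow> real" where
  "Wf m z p 0 = p"
| "Wf m z p (Suc i) = ext (m + i) (zeta (Suc i) z) (Wf m z p i)"

lemma Wf_E:
  assumes "0 < z" "z < 4 / 3" "p \<in> E m z"
  shows "Wf m z p i \<in> E (m + i) (zeta i z)"
proof (induction i)
  case 0
  then show ?case
    using assms by simp
next
  case (Suc i)
  have "nonsing (zeta (Suc i) z)"
    using zeta_strict(3,4)[OF assms(1,2), of i] by (intro first_band_nonsing) auto
  moreover have "Wf m z p i \<in> E (m + i) (dec (zeta (Suc i) z))"
    using Suc zeta_range(5)[of z i] assms by simp
  ultimately show ?case
    using ext_E by simp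
qed

lemma Wf_osc:
  assumes z: "0 < z" "z < 4 / 3" "p \<in> E m z"
  obtains i0 D where "0 \<le> D"
    "\<And>j. osc_on (m + (i0 + j)) (Wf m z p (i0 + j)) (D * (7 / 8) ^ j)"
    "\<And>j A s e f. A \<in> cel (m + (i0 + j)) \<Longrightarrow> s < n \<Longrightarrow> e \<in> cor \<Longrightarrow> f \<in> cor \<Longrightarrow>
      \<bar>Wf m z p (Suc (i0 + j)) (sub A s e + f) - Wf m z p (i0 + j) (A + e)\<bar> \<le> (real n + 1) * (D * (7 / 8) ^ j)"
proof -
  let ?W = "Wf m z p"
  obtain r where r: "0 < r" "r \<le> tp 0"
    "\<And>m l p w M. 0 \<le> l \<Longrightarrow> l \<le> r \<Longrightarrow> (\<And>q. \<bar>p q\<bar> \<le> M) \<Longrightarrow> osc_on m p w \<Longrightarrow> 0 \<le> w \<Longrightarrow>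
      osc_on (Suc m) (ext m l p) (3 / 4 * w + osc_const * l * M) \<and>
      (\<forall>A\<in>cel m. \<forall>s<n. \<forall>e\<in>cor. \<forall>f\<in>cor.
        \<bar>ext m l p (sub A s e + f) - p (A + e)\<bar> \<le> (real n + 1) * (3 / 4 * w + osc_const * l * M))"
    using ext_osc by metis
  have zl: "zeta i z \<le> (4 / 3) * (1 / 8) ^ i" for i
    using zeta_le[of z i] z by simp
  have "(\<lambda>i. (4 / 3) * (1 / 8 :: real) ^ i) \<longlonglongrightarrow> (4 / 3) * 0"
    by (intro tendsto_mult_left LIMSEQ_power_zero) simp
  then have "\<forall>\<^sub>F i in sequentially. (4 / 3) * (1 / 8 :: real) ^ i < r"
    using r(1) by (intro order_tendstoD(2)) auto
  \<comment> \<open>The contraction of oscillations holds only for small parameters, so the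
    estimates begin i0 levels later.\<close>
  then obtain i0 where i0: "\<And>i. i0 \<le> i \<Longrightarrow> (4 / 3) * (1 / 8 :: real) ^ i < r"
    unfolding eventually_sequentially by blast
  define x where "x j = zeta (Suc (i0 + j)) z" for j
  have x: "0 \<le> x j" "x j \<le> r" "x j \<le> (4 / 3) * (1 / 8) ^ j" for j
  proof -
    show "0 \<le> x j"
      using zeta_range(3)[of z "i0 + j"] z by (simp add: x_def del: zeta.simps)
    have "x j \<le> (4 / 3) * (1 / 8) ^ Suc (i0 + j)"
      unfolding x_def by (rule zl)
    moreover have "(4 / 3) * (1 / 8 :: real) ^ Suc (i0 + j) < r"
      by (rule i0) simp
    moreover have "(1 / 8 :: real) ^ Suc (i0 + j) \<le> (1 / 8) ^ j"
      by (intro power_decreasing) auto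
    ultimately show "x j \<le> r" "x j \<le> (4 / 3) * (1 / 8) ^ j"
      by linarith+
  qed
  define M0 where "M0 = (\<Sum>q\<in>vert (m + i0). \<bar>?W i0 q\<bar>)"
  have sup: "?W i q = 0" if "q \<notin> vert (m + i)" for i q
    using Wf_E[OF z, of i] that by (cases q) (simp add: E_def supp_def)
  have M0: "\<bar>?W i0 q\<bar> \<le> M0" for q
  proof (cases "q \<in> vert (m + i0)")
    case True
    then show ?thesis
      unfolding M0_def by (intro member_le_sum) auto
  next
    case False
    then show ?thesis
      using sup[OF False] by (simp add: M0_def sum_nonneg)
  qed
  have M00: "0 \<le> M0"
    by (simp add: M0_def sum_nonneg)
  define w where "w j = fst (bound_seq osc_const (real n + 1) x M0 j)" for j
  define M where "M j = snd (bound_seq osc_const (real n + 1) x M0 j)" for j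
  have rec: "w (Suc j) = 3 / 4 * w j + osc_const * x j * M j" "M (Suc j) = M j + (real n + 1) * w (Suc j)"
    "w 0 = 2 * M0" "M 0 = M0" for j
    by (simp_all add: w_def M_def Let_def)
  have nn: "0 \<le> w j \<and> 0 \<le> M j" for j
    by (induction j) (use rec M00 x osc_const_pos in simp_all)
  have main: "(\<forall>q. \<bar>?W (i0 + j) q\<bar> \<le> M j) \<and> osc_on (m + (i0 + j)) (?W (i0 + j)) (w j)" for j
  proof (induction j)
    case 0
    have "osc_on (m + i0) (?W i0) (2 * M0)"
      unfolding osc_on_def
    proof (intro ballI)
      fix A e f
      show "\<bar>?W i0 (A + e) - ?W i0 (A + f)\<bar> \<le> 2 * M0"
        using M0[of "A + e"] M0[of "A + f"] by linarith
    qed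
    then show ?case
      using M0 rec by simp
  next
    case (Suc j)
    have st: "osc_on (Suc (m + (i0 + j))) (ext (m + (i0 + j)) (x j) (?W (i0 + j))) (w (Suc j)) \<and>
      (\<forall>A\<in>cel (m + (i0 + j)). \<forall>s<n. \<forall>e\<in>cor. \<forall>f\<in>cor.
        \<bar>ext (m + (i0 + j)) (x j) (?W (i0 + j)) (sub A s e + f) - ?W (i0 + j) (A + e)\<bar> \<le> (real n + 1) * w (Suc j))"
      unfolding rec(1) using Suc x nn by (intro r(3)) auto
    have W: "?W (i0 + Suc j) = ext (m + (i0 + j)) (x j) (?W (i0 + j))"
      by (simp add: x_def)
    have "\<bar>?W (i0 + Suc j) q\<bar> \<le> M (Suc j)" for q
    proof (cases "q \<in> vert (m + (i0 + Suc j))")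
      case True
      then obtain B f where q: "q = B + f" "B \<in> cel (Suc (m + (i0 + j)))" "f \<in> cor"
        by (auto simp: vert_def simp del: cel.simps)
      then obtain A s e where "B = sub A s e" "A \<in> cel (m + (i0 + j))" "s < n" "e \<in> cor"
        unfolding cel.simps by blast
      then have "\<bar>?W (i0 + Suc j) q - ?W (i0 + j) (A + e)\<bar> \<le> (real n + 1) * w (Suc j)"
        using st q W by simp
      moreover have "\<bar>?W (i0 + j) (A + e)\<bar> \<le> M j"
        using Suc by blast
      ultimately show ?thesis
        unfolding rec(2) by linarith
    next
      case False
      then show ?thesis
        using sup[of q "i0 + Suc j"] nn by simp
    qed
    then show ?case
      using st W by simp
  qed
  obtain D where DB: "0 \<le> D" "\<And>j. w j \<le> D * (7 / 8) ^ j"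
  proof (rule osc_sequence[of osc_const "real n + 1" x "4 / 3" w M])
    show "0 \<le> osc_const" by (rule osc_const_pos)
  qed (use x nn rec in auto)
  show ?thesis
  proof
    have dec: "D * (7 / 8) ^ Suc j \<le> D * (7 / 8) ^ j" for j
      using DB(1) by (intro mult_left_mono) auto
    show "0 \<le> D"
      by (rule DB)
    show "osc_on (m + (i0 + j)) (?W (i0 + j)) (D * (7 / 8) ^ j)" for j
      using main[of j] DB(2)[of j] unfolding osc_on_def by (meson order_trans)
    show "\<bar>?W (Suc (i0 + j)) (sub A s e + f) - ?W (i0 + j) (A + e)\<bar> \<le> (real n + 1) * (D * (7 / 8) ^ j)"
      if "A \<in> cel (m + (i0 + j))" "s < n" "e \<in> cor" "f \<in> cor" for j A s e f
    proof -
      have "osc_on (Suc (m + (i0 + j))) (ext (m + (i0 + j)) (x j) (?W (i0 + j))) (3 / 4 * w j + osc_const * x j * M j) \<and>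
      (\<forall>A\<in>cel (m + (i0 + j)). \<forall>s<n. \<forall>e\<in>cor. \<forall>f\<in>cor.
        \<bar>ext (m + (i0 + j)) (x j) (?W (i0 + j)) (sub A s e + f) - ?W (i0 + j) (A + e)\<bar> \<le> (real n + 1) * (3 / 4 * w j + osc_const * x j * M j))"
        using main[of j] x nn by (intro r(3)) auto
      then have "\<bar>ext (m + (i0 + j)) (x j) (?W (i0 + j)) (sub A s e + f) - ?W (i0 + j) (A + e)\<bar> \<le> (real n + 1) * w (Suc j)"
        using that unfolding rec(1) by blast
      moreover have "(real n + 1) * w (Suc j) \<le> (real n + 1) * (D * (7 / 8) ^ j)"
        using DB(2)[of "Suc j"] dec[of j] by (intro mult_left_mono) auto
      ultimately have "\<bar>ext (m + (i0 + j)) (x j) (?W (i0 + j)) (sub A s e + f) - ?W (i0 + j) (A + e)\<bar> \<le> (real n + 1) * (D * (7 / 8) ^ j)"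
        by (rule order_trans)
      then show ?thesis
        by (simp add: x_def)
    qed
  qed
qed

lemma shift_simps: "shift 0 Q = Q" "shift (Suc k) Q = lat (shift k Q)"
  by (simp_all add: shift_def lat_def mult.assoc)

lemma pt_shift: "pt (m + k) (shift k Q) = pt m Q"
  by (induction k) (simp_all add: shift_simps pt_lat)

lemma Wf_shift: "Wf m z p (i + k) (shift k Q) = Wf m z p i Q"
  by (induction k) (simp_all add: shift_simps)

lemma Wf_consistent:
  assumes "pt (m + i) Q = pt (m + i') Q'"
  shows "Wf m z p i Q = Wf m z p i' Q'"
proof -
  have *: "Wf m z p i Q = Wf m z p i' Q'" if le: "i \<le> i'" and eq: "pt (m + i) Q = pt (m + i') Q'" for i i' Q Q'
  proof -
    obtain k where k: "i' = i + k"
      using le_Suc_ex[OF le] ..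
    have "pt (m + i + k) (shift k Q) = pt (m + i + k) Q'"
      unfolding pt_shift using eq k by (simp add: add.assoc)
    then have "Q' = shift k Q"
      using pt_inj by simp
    then show ?thesis
      using Wf_shift k by simp
  qed
  show ?thesis
    using *[of i i' Q Q'] *[of i' i Q' Q] assms by (cases "i \<le> i'") auto
qed

definition Ff :: "nat \<Rightarrow> real \<Rightarrow> (pt2 \<Rightarrow> real) \<Rightarrow> real \<times> real \<Rightarrow> real" where
  "Ff m z p x = (case (SOME (i, Q). x = pt (m + i) Q) of (i, Q) \<Rightarrow> Wf m z p i Q)"

lemma Ff_pt: "Ff m z p (pt (m + i) Q) = Wf m z p i Q"
proof -
  define c where "c = (SOME (i', Q'). pt (m + i) Q = pt (m + i') Q')"
  have "case c of (i', Q') \<Rightarrow> pt (m + i) Q = pt (m + i') Q'"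
    unfolding c_def by (rule someI[of _ "(i, Q)"]) simp
  then obtain i' Q' where c: "c = (i', Q')" "pt (m + i) Q = pt (m + i') Q'"
    by (cases c) auto
  show ?thesis
    unfolding Ff_def c_def[symmetric] c(1) using Wf_consistent[OF c(2)] by simp
qed

lemma sub_range:
  assumes "s < n" "e \<in> cor"
  shows "L * fst A \<le> fst (sub A s e)" "fst (sub A s e) \<le> L * fst A + L - 1"
    "L * snd A \<le> snd (sub A s e)" "snd (sub A s e) \<le> L * snd A + L - 1"
proof -
  have s: "int s \<le> mid"
    using assms(1) by (simp add: mid_def)
  obtain a b i j where eqs: "A = (a, b)" "e = (i, j)"
    by (metis surj_pair)
  then have ij: "i \<in> {0, 1}" "j \<in> {0, 1}"
    using assms(2) by (auto simp: cor_def)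
  show "L * fst A \<le> fst (sub A s e)" "fst (sub A s e) \<le> L * fst A + L - 1"
    "L * snd A \<le> snd (sub A s e)" "snd (sub A s e) \<le> L * snd A + L - 1"
    using coord_offset[OF s ij(1)] coord_offset[OF s ij(2)] by (simp_all add: eqs sub.simps)
qed

text \<open>The cell \<open>B\<close> lies in the square of the cell \<open>A\<close> from k levels
  before. Containment of squares, rather than descent in the construction, is all that the distance
  estimates use.\<close>

definition below :: "nat \<Rightarrow> pt2 \<Rightarrow> pt2 \<Rightarrow> bool" where
  "below k B A \<longleftrightarrow> L ^ k * fst A \<le> fst B \<and> fst B \<le> L ^ k * fst A + L ^ k - 1 \<and>
     L ^ k * snd A \<le> snd B \<and> snd B \<le> L ^ k * snd A + L ^ k - 1"

lemma below_Suc: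
  assumes "below k A' A" "s < n" "e \<in> cor"
  shows "below (Suc k) (sub A' s e) A"
proof -
  have *: "L ^ Suc k * a \<le> x \<and> x \<le> L ^ Suc k * a + L ^ Suc k - 1"
    if "L ^ k * a \<le> b" "b \<le> L ^ k * a + L ^ k - 1" "L * b \<le> x" "x \<le> L * b + L - 1" for a b x
  proof -
    have "L * (L ^ k * a) \<le> L * b" "L * b \<le> L * (L ^ k * a + L ^ k - 1)"
      using that L_mid(3) by (auto intro: mult_left_mono)
    moreover have "L ^ Suc k * a = L * (L ^ k * a)" "L * (L ^ k * a + L ^ k - 1) = L * (L ^ k * a) + L ^ Suc k - L"
      by (simp_all add: algebra_simps)
    ultimately show ?thesis
      using that by linarith
  qed
  show ?thesis
    using assms(1) *[OF _ _ sub_range(1,2)[OF assms(2,3)]] *[OF _ _ sub_range(3,4)[OF assms(2,3)]]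
    unfolding below_def by blast
qed

text \<open>The checkerboard colouring rules out squares adjacent along a side, so close cells are
  equal or meet at a corner.\<close>

lemma common_corner:
  assumes "A \<in> cel m" "A' \<in> cel m" "\<bar>fst A - fst A'\<bar> \<le> 1" "\<bar>snd A - snd A'\<bar> \<le> 1"
  obtains e e' where "e \<in> cor" "e' \<in> cor" "A + e = A' + e'"
proof -
  define d1 where "d1 = fst A' - fst A"
  define d2 where "d2 = snd A' - snd A"
  have ev: "even (fst A + snd A)" "even (fst A' + snd A')"
    using cel_even assms by auto
  then have ev2: "even (d1 + d2)"
    unfolding d1_def d2_def by presburger
  have d: "d1 \<in> {-1, 0, 1}" "d2 \<in> {-1, 0, 1}"
    using assms(3,4) by (auto simp: d1_def d2_def)
  define e :: pt2 where "e = (if d1 = 1 then 1 else 0, if d2 = 1 then 1 else 0)"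
  define e' :: pt2 where "e' = (fst e - d1, snd e - d2)"
  have "e \<in> cor" "e' \<in> cor"
    using d ev2 by (auto simp: cor_def e_def e'_def)
  moreover have "A + e = A' + e'"
    by (simp add: prod_eq_iff d1_def d2_def e'_def)
  ultimately show ?thesis
    using that by blast
qed

lemma close_cells:
  assumes "below k B A" "below k B' A'" "f \<in> cor" "f' \<in> cor"
    and "\<bar>fst (B + f) - fst (B' + f')\<bar> < L ^ k" "\<bar>snd (B + f) - snd (B' + f')\<bar> < L ^ k"
  shows "\<bar>fst A - fst A'\<bar> \<le> 1" "\<bar>snd A - snd A'\<bar> \<le> 1"
proof -
  have *: "a - a' \<le> 1" if "L ^ k * a \<le> x" "x' \<le> L ^ k * a' + L ^ k" "x - x' < L ^ k" for a a' x x'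
  proof (rule ccontr)
    assume "\<not> a - a' \<le> 1"
    then have "L ^ k * (a' + 2) \<le> L ^ k * a"
      using L_mid(3) by (intro mult_left_mono) auto
    then show False
      using that by (simp add: algebra_simps)
  qed
  have f: "0 \<le> fst f" "fst f \<le> 1" "0 \<le> snd f" "snd f \<le> 1" "0 \<le> fst f'" "fst f' \<le> 1" "0 \<le> snd f'" "snd f' \<le> 1"
    using assms(3,4) by (auto simp: cor_def)
  have b: "L ^ k * fst A \<le> fst (B + f)" "fst (B + f) \<le> L ^ k * fst A + L ^ k"
    "L ^ k * snd A \<le> snd (B + f)" "snd (B + f) \<le> L ^ k * snd A + L ^ k"
    "L ^ k * fst A' \<le> fst (B' + f')" "fst (B' + f') \<le> L ^ k * fst A' + L ^ k"
    "L ^ k * snd A' \<le> snd (B' + f')" "snd (B' + f') \<le> L ^ k * snd A' + L ^ k"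
    using assms(1,2) f unfolding below_def by auto
  show "\<bar>fst A - fst A'\<bar> \<le> 1"
    using *[OF b(1,6)] *[OF b(5,2)] assms(5) by linarith
  show "\<bar>snd A - snd A'\<bar> \<le> 1"
    using *[OF b(3,8)] *[OF b(7,4)] assms(6) by linarith
qed

lemma Wf_deep:
  assumes D: "0 \<le> D"
    and osc: "\<And>j. osc_on (m + (i0 + j)) (Wf m z p (i0 + j)) (D * (7 / 8) ^ j)"
    and st: "\<And>j A s e f. A \<in> cel (m + (i0 + j)) \<Longrightarrow> s < n \<Longrightarrow> e \<in> cor \<Longrightarrow> f \<in> cor \<Longrightarrow>
      \<bar>Wf m z p (Suc (i0 + j)) (sub A s e + f) - Wf m z p (i0 + j) (A + e)\<bar> \<le> (real n + 1) * (D * (7 / 8) ^ j)"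
    and B: "B \<in> cel (m + (i0 + (j + k)))" "f \<in> cor"
  shows "\<exists>A\<in>cel (m + (i0 + j)). below k B A \<and>
    (\<forall>e\<in>cor. \<bar>Wf m z p (i0 + (j + k)) (B + f) - Wf m z p (i0 + j) (A + e)\<bar> \<le> (8 * real n + 9) * D * (7 / 8) ^ j)"
proof -
  have main: "\<exists>A\<in>cel (m + (i0 + j)). below k B A \<and>
    (\<forall>e\<in>cor. \<bar>Wf m z p (i0 + (j + k)) (B + f) - Wf m z p (i0 + j) (A + e)\<bar>
       \<le> D * (7 / 8) ^ j + (\<Sum>r<k. (real n + 1) * (D * (7 / 8) ^ (j + r))))"
    if "B \<in> cel (m + (i0 + (j + k)))" "f \<in> cor" for B f
    using that
  proof (induction k arbitrary: B f)
    case 0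
    have "below 0 B B"
      by (simp add: below_def)
    then show ?case
      using 0 osc[of j] by (intro bexI[of _ B]) (auto simp: osc_on_def)
  next
    case (Suc k)
    have "B \<in> cel (Suc (m + (i0 + (j + k))))"
      using Suc.prems by simp
    then obtain A' s e' where A': "B = sub A' s e'" "A' \<in> cel (m + (i0 + (j + k)))" "s < n" "e' \<in> cor"
      unfolding cel.simps by blast
    obtain A where A: "A \<in> cel (m + (i0 + j))" "below k A' A"
      "\<And>e. e \<in> cor \<Longrightarrow> \<bar>Wf m z p (i0 + (j + k)) (A' + e') - Wf m z p (i0 + j) (A + e)\<bar>
       \<le> D * (7 / 8) ^ j + (\<Sum>r<k. (real n + 1) * (D * (7 / 8) ^ (j + r)))"
      using Suc.IH[OF A'(2,4)] by blast
    have "\<bar>Wf m z p (Suc (i0 + (j + k))) (B + f) - Wf m z p (i0 + (j + k)) (A' + e')\<bar> \<le> (real n + 1) * (D * (7 / 8) ^ (j + k))"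
      unfolding A'(1) using A' Suc.prems(2) by (intro st)
    then have "\<bar>Wf m z p (i0 + (j + Suc k)) (B + f) - Wf m z p (i0 + j) (A + e)\<bar>
       \<le> D * (7 / 8) ^ j + (\<Sum>r<Suc k. (real n + 1) * (D * (7 / 8) ^ (j + r)))" if "e \<in> cor" for e
      using A(3)[OF that] unfolding sum.lessThan_Suc add_Suc_right by linarith
    moreover have "below (Suc k) B A"
      unfolding A'(1) using A(2) A'(3,4) by (rule below_Suc)
    ultimately show ?case
      using A(1) by blast
  qed
  \<comment> \<open>The geometric series with ratio 7/8 contributes the factor 8, whence 1 + 8 (n +
    1) = 8 n + 9.\<close>
  have "(\<Sum>r<k. (real n + 1) * (D * (7 / 8) ^ (j + r))) = (real n + 1) * D * (7 / 8) ^ j * (\<Sum>r<k. (7 / 8) ^ r)"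
    by (simp add: sum_distrib_left power_add mult_ac)
  also have "\<dots> \<le> (real n + 1) * D * (7 / 8) ^ j * 8"
  proof (rule mult_left_mono)
    have "(\<Sum>r<k. (7 / 8 :: real) ^ r) = (1 - (7 / 8) ^ k) / (1 - 7 / 8)"
      by (subst sum_gp_strict) simp
    also have "\<dots> \<le> 8"
      by (simp add: field_simps)
    finally show "(\<Sum>r<k. (7 / 8 :: real) ^ r) \<le> 8" .
  qed (use D in auto)
  finally have "D * (7 / 8) ^ j + (\<Sum>r<k. (real n + 1) * (D * (7 / 8) ^ (j + r))) \<le> (8 * real n + 9) * D * (7 / 8) ^ j"
    by (simp add: algebra_simps)
  then show ?thesis
    using main[OF B] order_trans by meson
qed

lemma Ver_point:
  assumes "x \<in> Ver"
  obtains k where "\<And>i. k \<le> i \<Longrightarrow> x \<in> pt i ` vert i"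
proof -
  obtain k where "x \<in> vs_vertices n k"
    using assms by (auto simp: Ver_def)
  then show ?thesis
    using that[of k] vs_vertices_mono_le vs_vertices_eq by blast
qed

text \<open>Two vertices closer than the side of a cell lie in squares of cells with a common
  corner, and both values are close to the value at that corner.\<close>

lemma Ff_uniformly_continuous:
  assumes z: "0 < z" "z < 4 / 3" "p \<in> E m z"
  shows "uniformly_continuous_on Ver (Ff m z p)"
proof -
  obtain i0 D where h: "0 \<le> D"
    "\<And>j. osc_on (m + (i0 + j)) (Wf m z p (i0 + j)) (D * (7 / 8) ^ j)"
    "\<And>j A s e f. A \<in> cel (m + (i0 + j)) \<Longrightarrow> s < n \<Longrightarrow> e \<in> cor \<Longrightarrow> f \<in> cor \<Longrightarrow>
      \<bar>Wf m z p (Suc (i0 + j)) (sub A s e + f) - Wf m z p (i0 + j) (A + e)\<bar> \<le> (real n + 1) * (D * (7 / 8) ^ j)"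
    by (rule Wf_osc[OF z]) (rule that; assumption)
  let ?D = "(8 * real n + 9) * D"
  have main: "\<bar>Ff m z p x - Ff m z p y\<bar> \<le> 2 * (?D * (7 / 8) ^ j)"
    if x: "x \<in> Ver" and y: "y \<in> Ver" and d: "dist x y < 1 / real_of_int L ^ (m + (i0 + j))" for x y j
  proof -
    obtain a where a: "\<And>i. a \<le> i \<Longrightarrow> x \<in> pt i ` vert i"
      using Ver_point[OF x] by blast
    obtain b where b: "\<And>i. b \<le> i \<Longrightarrow> y \<in> pt i ` vert i"
      using Ver_point[OF y] by blast
    define k where "k = a + b"
    let ?N = "m + (i0 + (j + k))"
    have "x \<in> pt ?N ` vert ?N" "y \<in> pt ?N ` vert ?N"
      by (rule a, simp add: k_def) (rule b, simp add: k_def)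
    then obtain C f C' f' where x: "x = pt ?N (C + f)" "C \<in> cel ?N" "f \<in> cor"
      and y: "y = pt ?N (C' + f')" "C' \<in> cel ?N" "f' \<in> cor"
      unfolding vert_def by blast
    obtain A where A: "A \<in> cel (m + (i0 + j))" "below k C A"
      "\<And>e. e \<in> cor \<Longrightarrow> \<bar>Wf m z p (i0 + (j + k)) (C + f) - Wf m z p (i0 + j) (A + e)\<bar> \<le> ?D * (7 / 8) ^ j"
      using Wf_deep[OF h x(2,3)] by blast
    obtain A' where A': "A' \<in> cel (m + (i0 + j))" "below k C' A'"
      "\<And>e. e \<in> cor \<Longrightarrow> \<bar>Wf m z p (i0 + (j + k)) (C' + f') - Wf m z p (i0 + j) (A' + e)\<bar> \<le> ?D * (7 / 8) ^ j"
      using Wf_deep[OF h y(2,3)] by blast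
    have close: "\<bar>u - v\<bar> < L ^ k"
      if "dist (real_of_int u / real_of_int L ^ ?N) (real_of_int v / real_of_int L ^ ?N) < 1 / real_of_int L ^ (m + (i0 + j))" for u v
    proof -
      have p: "0 < real_of_int L ^ ?N" "0 < real_of_int L ^ (m + (i0 + j))"
        using Lr_pos by simp_all
      have "\<bar>real_of_int u - real_of_int v\<bar> / real_of_int L ^ ?N < 1 / real_of_int L ^ (m + (i0 + j))"
        using that p by (simp add: dist_real_def diff_divide_distrib[symmetric] abs_divide)
      then have "\<bar>real_of_int u - real_of_int v\<bar> < real_of_int L ^ ?N / real_of_int L ^ (m + (i0 + j))"
        using p by (simp add: pos_divide_less_eq)
      also have "\<dots> = real_of_int L ^ k"
        using p Lr_pos by (simp add: power_add)
      finally have "real_of_int \<bar>u - v\<bar> < real_of_int (L ^ k)"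
        by simp
      then show ?thesis
        by linarith
    qed
    have "\<bar>fst (C + f) - fst (C' + f')\<bar> < L ^ k"
      by (rule close) (use le_less_trans[OF dist_fst_le d] x(1) y(1) in \<open>simp add: pt_def\<close>)
    moreover have "\<bar>snd (C + f) - snd (C' + f')\<bar> < L ^ k"
      by (rule close) (use le_less_trans[OF dist_snd_le d] x(1) y(1) in \<open>simp add: pt_def\<close>)
    ultimately obtain e e' where e: "e \<in> cor" "e' \<in> cor" "A + e = A' + e'"
      using close_cells[OF A(2) A'(2) x(3) y(3)] common_corner[OF A(1) A'(1)] by blast
    have "Ff m z p x = Wf m z p (i0 + (j + k)) (C + f)" "Ff m z p y = Wf m z p (i0 + (j + k)) (C' + f')"
      unfolding x(1) y(1) by (rule Ff_pt)+
    then show ?thesis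
      using A(3)[OF e(1)] A'(3)[OF e(2)] e(3) by simp
  qed
  show ?thesis
    unfolding uniformly_continuous_on_def
  proof (intro allI impI)
    fix \<epsilon> :: real assume \<epsilon>: "0 < \<epsilon>"
    have "(\<lambda>j. 2 * (?D * (7 / 8) ^ j)) \<longlonglongrightarrow> 2 * (?D * 0)"
      by (intro tendsto_mult_left LIMSEQ_power_zero) simp
    then have "\<forall>\<^sub>F j in sequentially. 2 * (?D * (7 / 8) ^ j) < \<epsilon>"
      using \<epsilon> by (intro order_tendstoD(2)) auto
    then obtain j where j: "2 * (?D * (7 / 8) ^ j) < \<epsilon>"
      by (auto simp: eventually_sequentially)
    show "\<exists>d>0. \<forall>x\<in>Ver. \<forall>x'\<in>Ver. dist x' x < d \<longrightarrow> dist (Ff m z p x') (Ff m z p x) < \<epsilon>"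
    proof (intro exI conjI ballI impI)
      show "0 < 1 / real_of_int L ^ (m + (i0 + j))"
        using Lr_pos by simp
      fix x x' assume "x \<in> Ver" "x' \<in> Ver" "dist x' x < 1 / real_of_int L ^ (m + (i0 + j))"
      then show "dist (Ff m z p x') (Ff m z p x) < \<epsilon>"
        using main[of x' x j] j by (simp add: dist_real_def)
    qed
  qed
qed

text \<open>On every level m + i the continued function is an exact eigenfunction for
  \<open>zeta i z\<close>. The rescaled equation is therefore off by the convergence error of
  \<open>psi i z\<close> times a bounded function, which is uniform over the vertices.\<close>

lemma eigenfunction_exists:
  assumes z: "0 < z" "z < 4 / 3" and p: "p \<in> E m z"
  shows "\<exists>u\<in>eigenspace n (vs_rho n ^ m * Psi z). \<forall>Q\<in>vert m. u (pt m Q) = p Q"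
proof -
  let ?t = "vs_rho n ^ m * Psi z"
  obtain g where g: "uniformly_continuous_on (closure Ver) g" "\<And>x. x \<in> Ver \<Longrightarrow> Ff m z p x = g x"
    using uniformly_continuous_on_extension_on_closure[OF Ff_uniformly_continuous[OF z p]] by metis
  define u where "u x = (if x \<in> vicsek_set n then g x else 0)" for x
  have u_pt: "u (pt (m + i) Q) = Wf m z p i Q" if "Q \<in> vert (m + i)" for i Q
  proof -
    have "pt (m + i) Q \<in> Ver"
      using that unfolding Ver_def vs_vertices_eq by blast
    then show ?thesis
      using vertex_in_vicsek[OF that] g(2) Ff_pt by (metis u_def)
  qed
  have cont: "continuous_on (vicsek_set n) u"
  proof -
    have "continuous_on (vicsek_set n) g"
      using g(1) uniformly_continuous_imp_continuous by (simp add: vicsek_set_eq)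
    then show ?thesis
      by (rule continuous_on_eq) (simp add: u_def)
  qed
  have "compact (u ` vicsek_set n)"
    by (rule compact_continuous_image[OF cont compact_vicsek])
  then obtain M where M: "\<And>x. x \<in> vicsek_set n \<Longrightarrow> \<bar>u x\<bar> \<le> M"
    using compact_imp_bounded bounded_real by (metis imageI)
  have GL: "graph_laplacian n (m + i) u (pt (m + i) Q) = - zeta i z * u (pt (m + i) Q)" if Q: "Q \<in> vert (m + i)" for i Q
  proof -
    have "Lop (m + i) (zeta i z) (\<lambda>Q. u (pt (m + i) Q)) Q = Lop (m + i) (zeta i z) (Wf m z p i) Q"
      unfolding Lop_def cell_sum_def
      by (intro sum.cong refl arg_cong2[of _ _ _ _ "(-)"] arg_cong2[of _ _ _ _ "(*)"] u_pt Q vertI)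
         (auto simp: cells_at_def)
    also have "\<dots> = 0"
      using Wf_E[OF z p, of i] Q by (simp add: E_def)
    finally have "3 * card (cells_at (m + i) Q) * (graph_laplacian n (m + i) u (pt (m + i) Q) + zeta i z * u (pt (m + i) Q)) = 0"
      unfolding Lop_graph_laplacian[OF Q] .
    then have "graph_laplacian n (m + i) u (pt (m + i) Q) + zeta i z * u (pt (m + i) Q) = 0"
      using card_at_pos[OF Q] by (auto simp: card_gt_0_iff)
    then show ?thesis
      by simp
  qed
  have "neumann_laplacian n u (\<lambda>x. - ?t * u x)"
    unfolding neumann_laplacian_def
  proof (intro conjI allI impI)
    show "continuous_on (vicsek_set n) u" by (rule cont)
    show "continuous_on (vicsek_set n) (\<lambda>x. - ?t * u x)"
      by (intro continuous_intros cont)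
    fix e :: real assume e: "0 < e"
    have "(\<lambda>i. \<bar>?t - vs_rho n ^ m * psi i z\<bar> * M) \<longlonglongrightarrow> \<bar>?t - vs_rho n ^ m * Psi z\<bar> * M"
      using z by (intro tendsto_intros psi_tendsto) auto
    then have "\<forall>\<^sub>F i in sequentially. \<bar>?t - vs_rho n ^ m * psi i z\<bar> * M < e"
      using e by (intro order_tendstoD(2)) auto
    then obtain i0 where i0: "\<And>i. i0 \<le> i \<Longrightarrow> \<bar>?t - vs_rho n ^ m * psi i z\<bar> * M < e"
      by (auto simp: eventually_sequentially)
    show "\<forall>\<^sub>F k in sequentially. \<forall>x\<in>vs_vertices n k. \<bar>vs_rho n ^ k * graph_laplacian n k u x - - ?t * u x\<bar> < e"
      unfolding eventually_sequentially
    proof (intro exI allI impI ballI)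
      fix k x assume k: "m + i0 \<le> k" and x: "x \<in> vs_vertices n k"
      obtain i where i: "k = m + i" "i0 \<le> i"
        using k by (metis add.assoc add_leD1 le_Suc_ex le_add1)
      obtain Q where Q: "Q \<in> vert (m + i)" "x = pt (m + i) Q"
        using x unfolding vs_vertices_eq i(1) by blast
      have "vs_rho n ^ k * graph_laplacian n k u x - - ?t * u x = (?t - vs_rho n ^ m * psi i z) * u x"
        unfolding i(1) Q(2) GL[OF Q(1)] psi_def by (simp add: power_add algebra_simps)
      then have "\<bar>vs_rho n ^ k * graph_laplacian n k u x - - ?t * u x\<bar> = \<bar>?t - vs_rho n ^ m * psi i z\<bar> * \<bar>u x\<bar>"
        by (simp add: abs_mult)
      also have "\<dots> \<le> \<bar>?t - vs_rho n ^ m * psi i z\<bar> * M"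
        using M[OF vertex_in_vicsek[OF Q(1)]] Q(2) by (intro mult_left_mono) auto
      also have "\<dots> < e"
        by (rule i0[OF i(2)])
      finally show "\<bar>vs_rho n ^ k * graph_laplacian n k u x - - ?t * u x\<bar> < e" .
    qed
  qed
  then have "u \<in> eigenspace n ?t"
    by (auto simp: eigenspace_def u_def)
  moreover have "\<forall>Q\<in>vert m. u (pt m Q) = p Q"
    using u_pt[of _ 0] by simp
  ultimately show ?thesis
    by blast
qed

end

section \<open>Restriction of eigenfunctions\<close>

interpretation plp: vector_space_pair "\<lambda>(c::real) (u :: real \<times> real \<Rightarrow> real) x. c * u x"
  "\<lambda>(c::real) (u :: pt2 \<Rightarrow> real) x. c * u x"
  by unfold_locales

lemma enumeration_unique:
  fixes lam f :: "nat \<Rightarrow> real"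
  assumes lam: "strict_mono lam" and f: "\<And>i j. i < j \<Longrightarrow> j \<le> k \<Longrightarrow> f i < f j"
    and im: "f ` {..k} = range lam \<inter> {..f k}"
  shows "i \<le> k \<Longrightarrow> lam i = f i"
proof (induction i rule: less_induct)
  case (less i)
  have "f i \<in> range lam"
    using im less.prems by blast
  then obtain a where a: "f i = lam a"
    by blast
  have "i \<le> a"
  proof (rule ccontr)
    assume "\<not> i \<le> a"
    then have "lam a = f a" "f a < f i"
      using less f by auto
    then show False
      using a by simp
  qed
  then have le: "lam i \<le> f i"
    using a lam by (simp add: strict_mono_less_eq)
  also have "f i \<le> f k"
    using f[of i k] less.prems by (cases "i = k") auto
  finally have "lam i \<in> f ` {..k}"
    using im by auto
  then obtain b where b: "b \<le> k" "lam i = f b"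
    by auto
  have "i \<le> b"
  proof (rule ccontr)
    assume "\<not> i \<le> b"
    then have "b < i"
      by simp
    then have "lam b = lam i"
      using less.IH[of b] b by simp
    then show False
      using \<open>b < i\<close> lam by (metis less_irrefl strict_mono_less)
  qed
  then have "f i \<le> f b"
    using f[of i b] b(1) by (cases "i = b") auto
  then show ?case
    using le b by simp
qed

context vicsek
begin

text \<open>The factors R l / l of the single restrictions telescope along the iterates of the
  inverse branch.\<close>

lemma Lop_iterate:
  fixes \<eta> :: real
  assumes z: "0 < z" "z < 4 / 3"
    and err: "\<And>Q. Q \<in> vert (m + i) \<Longrightarrow>
      \<bar>Lop (m + i) (zeta i z) (\<lambda>Q. u (pt (m + i) Q)) Q\<bar> \<le> \<eta> * card (cells_at (m + i) Q)"
    and Q: "Q \<in> vert m"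
  shows "\<bar>Lop m z (\<lambda>Q. u (pt m Q)) Q\<bar> \<le> \<eta> * (z / zeta i z) * card (cells_at m Q)"
  using err
proof (induction i arbitrary: \<eta>)
  case 0
  then show ?case
    using Q z by simp
next
  case (Suc i)
  let ?l = "zeta (Suc i) z"
  note l = zeta_strict[OF z, of i]
  have d: "dec ?l = zeta i z"
    using zeta_range(5)[of z i] z by simp
  have "\<bar>Lop (m + i) (zeta i z) (\<lambda>Q. u (pt (m + i) Q)) q\<bar> \<le> \<eta> * (zeta i z / ?l) * card (cells_at (m + i) q)"
    if "q \<in> vert (m + i)" for q
  proof -
    have "\<bar>Lop (m + i) (dec ?l) (\<lambda>q. u (pt (Suc (m + i)) (lat q))) q\<bar> \<le> \<eta> * (dec ?l / ?l) * card (cells_at (m + i) q)"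
      using l Suc.prems that by (intro Lop_restrict_error) auto
    then show ?thesis
      unfolding d pt_lat .
  qed
  then have "\<bar>Lop m z (\<lambda>Q. u (pt m Q)) Q\<bar> \<le> \<eta> * (zeta i z / ?l) * (z / zeta i z) * card (cells_at m Q)"
    by (rule Suc.IH)
  then show ?case
    using l by simp
qed

lemma eigenspace_bounded:
  assumes "u \<in> eigenspace n t"
  obtains M where "0 \<le> M" "\<And>x. x \<in> vicsek_set n \<Longrightarrow> \<bar>u x\<bar> \<le> M"
proof -
  have "continuous_on (vicsek_set n) u"
    using assms by (simp add: eigenspace_def neumann_laplacian_def)
  then have "compact (u ` vicsek_set n)"
    using compact_continuous_image compact_vicsek by blast
  then obtain M where M: "\<And>x. x \<in> vicsek_set n \<Longrightarrow> \<bar>u x\<bar> \<le> M"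
    using compact_imp_bounded bounded_real by (metis imageI)
  obtain q where "q \<in> vert 0"
    using vert_nonempty by blast
  then have "\<bar>u (pt 0 q)\<bar> \<le> M"
    using M vertex_in_vicsek by blast
  then have "0 \<le> M"
    by linarith
  then show ?thesis
    using that M by blast
qed

text \<open>If the rescaled equation has error e on level m + i, \<open>Lop_iterate\<close> bounds
  the defect on level m by a quantity that tends to a multiple of e as i grows, because rho^(m+i)
  \<open>zeta i z\<close> converges to the eigenvalue. As e is arbitrary, the defect is 0.\<close>

lemma eigenfunction_restrict:
  assumes z: "0 < z" "z < 4 / 3" and u: "u \<in> eigenspace n (vs_rho n ^ m * Psi z)" and Q: "Q \<in> vert m"
  shows "Lop m z (\<lambda>Q. u (pt m Q)) Q = 0"
proof -
  let ?t = "vs_rho n ^ m * Psi z" and ?X = "\<bar>Lop m z (\<lambda>Q. u (pt m Q)) Q\<bar>"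
  let ?c = "real (card (cells_at m Q))"
  obtain M where M: "0 \<le> M" "\<And>x. x \<in> vicsek_set n \<Longrightarrow> \<bar>u x\<bar> \<le> M"
    using eigenspace_bounded[OF u] by blast
  have t: "0 < ?t"
    using rho_pos Psi_ge[of z] z by simp
  define y where "y i = vs_rho n ^ m * psi i z" for i
  have y: "y \<longlonglongrightarrow> ?t"
    unfolding y_def using z by (intro tendsto_intros psi_tendsto) auto
  have ypos: "0 < y i" for i
    using rho_pos zeta_strict(1)[OF z, of i] by (simp add: y_def psi_def)
  have ye: "y i = vs_rho n ^ (m + i) * zeta i z" for i
    by (simp add: y_def psi_def power_add)
  have le: "?X \<le> 3 * z * e / ?t * ?c" if e: "0 < e" for e
  proof -
    have "\<forall>\<^sub>F k in sequentially. \<forall>x\<in>vs_vertices n k. \<bar>vs_rho n ^ k * graph_laplacian n k u x - - ?t * u x\<bar> < e"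
      using u e by (simp add: eigenspace_def neumann_laplacian_def)
    then obtain k0 where k0: "\<And>k x. k0 \<le> k \<Longrightarrow> x \<in> vs_vertices n k \<Longrightarrow>
        \<bar>vs_rho n ^ k * graph_laplacian n k u x - - ?t * u x\<bar> < e"
      unfolding eventually_sequentially by blast
    have bd: "?X \<le> 3 * z * (e + \<bar>y i - ?t\<bar> * M) / y i * ?c" if i: "k0 \<le> i" for i
    proof -
      let ?k = "m + i"
      let ?r = "vs_rho n ^ ?k"
      have r: "0 < ?r"
        using rho_pos by simp
      let ?eta = "3 * (e + \<bar>y i - ?t\<bar> * M) / ?r"
      have "?X \<le> ?eta * (z / zeta i z) * ?c"
      proof (rule Lop_iterate[OF z _ Q])
        fix P assume P: "P \<in> vert ?k"
        let ?x = "pt ?k P"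
        have "\<bar>?r * graph_laplacian n ?k u ?x - - ?t * u ?x\<bar> < e"
          using P i by (intro k0) (auto simp: vs_vertices_eq)
        moreover have "\<bar>(y i - ?t) * u ?x\<bar> \<le> \<bar>y i - ?t\<bar> * M"
          unfolding abs_mult using M(2)[OF vertex_in_vicsek[OF P]] by (intro mult_left_mono) auto
        moreover have "?r * (graph_laplacian n ?k u ?x + zeta i z * u ?x)
            = (?r * graph_laplacian n ?k u ?x - - ?t * u ?x) + (y i - ?t) * u ?x"
          unfolding ye by (simp add: algebra_simps)
        ultimately have "\<bar>?r * (graph_laplacian n ?k u ?x + zeta i z * u ?x)\<bar> \<le> e + \<bar>y i - ?t\<bar> * M"
          by (smt (verit) abs_triangle_ineq)
        then have "\<bar>graph_laplacian n ?k u ?x + zeta i z * u ?x\<bar> \<le> (e + \<bar>y i - ?t\<bar> * M) / ?r"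
          using r by (simp add: abs_mult pos_le_divide_eq mult.commute)
        then have "3 * real (card (cells_at ?k P)) * \<bar>graph_laplacian n ?k u ?x + zeta i z * u ?x\<bar>
            \<le> 3 * real (card (cells_at ?k P)) * ((e + \<bar>y i - ?t\<bar> * M) / ?r)"
          by (intro mult_left_mono) auto
        moreover have "3 * c * (X / r) = 3 * X / r * c" for c X r :: real
          by simp
        moreover have "\<bar>Lop ?k (zeta i z) (\<lambda>Q. u (pt ?k Q)) P\<bar>
            = 3 * real (card (cells_at ?k P)) * \<bar>graph_laplacian n ?k u ?x + zeta i z * u ?x\<bar>"
          unfolding Lop_graph_laplacian[OF P] by (simp add: abs_mult)
        ultimately show "\<bar>Lop ?k (zeta i z) (\<lambda>Q. u (pt ?k Q)) P\<bar> \<le> ?eta * card (cells_at ?k P)"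
          by metis
      qed
      also have "?eta * (z / zeta i z) * ?c = 3 * z * (e + \<bar>y i - ?t\<bar> * M) / y i * ?c"
        unfolding ye by simp
      finally show ?thesis .
    qed
    have "(\<lambda>i. 3 * z * (e + \<bar>y i - ?t\<bar> * M) / y i * ?c) \<longlonglongrightarrow> 3 * z * (e + \<bar>?t - ?t\<bar> * M) / ?t * ?c"
      by (intro tendsto_intros y) (use t in linarith)
    then have "(\<lambda>i. 3 * z * (e + \<bar>y i - ?t\<bar> * M) / y i * ?c) \<longlonglongrightarrow> 3 * z * e / ?t * ?c"
      by simp
    then show ?thesis
      using bd by (intro LIMSEQ_le_const) auto
  qed
  have "?X \<le> 0"
  proof (rule field_le_epsilon)
    fix d :: real assume d: "0 < d"
    \<comment> \<open>Solves the final bound for the prescribed \<open>d\<close>; the summand 1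
      serves for the comparison of c / (c + 1) with 1.\<close>
    let ?e = "d * ?t / (3 * z * (?c + 1))"
    have "0 < 3 * z * (?c + 1)"
      using z by (simp add: add_nonneg_pos)
    with mult_pos_pos[OF d t] have "0 < ?e"
      by (rule divide_pos_pos)
    from le[OF this] have "?X \<le> 3 * z * ?e / ?t * ?c" .
    also have "\<dots> = d * (?c / (?c + 1))"
    proof -
      have "3 * w * (d * s / (3 * w * (c + 1))) / s * c = d * (c / (c + 1))"
        if "0 < s" "0 < w" "0 \<le> c" for s w c :: real
        using that by simp
      from this[OF t z(1)] show ?thesis
        by simp
    qed
    also have "\<dots> \<le> d"
      using d by (simp add: pos_divide_le_eq add_nonneg_pos algebra_simps)
    finally show "?X \<le> 0 + d"
      by simp
  qed
  then show ?thesis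
    by simp
qed

definition res :: "nat \<Rightarrow> (real \<times> real \<Rightarrow> real) \<Rightarrow> pt2 \<Rightarrow> real" where
  "res m u = (\<lambda>Q. if Q \<in> vert m then u (pt m Q) else 0)"

lemma Lop_res: "Q \<in> vert m \<Longrightarrow> Lop m z (res m u) Q = Lop m z (\<lambda>Q. u (pt m Q)) Q"
  unfolding Lop_def
proof (intro sum.cong refl)
  fix A assume Q: "Q \<in> vert m" and "A \<in> cells_at m Q"
  then have "A \<in> cel m"
    by (simp add: cells_at_def)
  then have "cell_sum (res m u) A = cell_sum (\<lambda>Q. u (pt m Q)) A"
    unfolding cell_sum_def by (intro sum.cong) (auto simp: res_def intro: vertI)
  then show "cell_sum (res m u) A - (4 - 3 * z) * res m u Q
      = cell_sum (\<lambda>Q. u (pt m Q)) A - (4 - 3 * z) * u (pt m Q)"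
    using Q by (simp add: res_def)
qed

lemma res_E:
  assumes "0 < z" "z < 4 / 3" "u \<in> eigenspace n (vs_rho n ^ m * Psi z)"
  shows "res m u \<in> E m z"
  using eigenfunction_restrict[OF assms] Lop_res by (simp add: E_def supp_def res_def)

lemma zeta_zeta: "zeta j (zeta i z) = zeta (i + j) z"
  by (induction j) auto

lemma Psi_zeta:
  assumes "0 < z" "z < 4 / 3"
  shows "vs_rho n ^ i * Psi (zeta i z) = Psi z"
proof -
  have "(\<lambda>j. vs_rho n ^ i * psi j (zeta i z)) \<longlonglongrightarrow> vs_rho n ^ i * Psi (zeta i z)"
    using zeta_strict[OF assms, of i] by (intro tendsto_intros psi_tendsto) auto
  moreover have "vs_rho n ^ i * psi j (zeta i z) = psi (j + i) z" for j
    by (simp add: psi_def zeta_zeta power_add add.commute)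
  moreover have "(\<lambda>j. psi (j + i) z) \<longlonglongrightarrow> Psi z"
    using assms by (intro LIMSEQ_ignore_initial_segment psi_tendsto) auto
  ultimately show ?thesis
    using LIMSEQ_unique by simp
qed

text \<open>On the first band multiplicities are preserved, so extension maps onto the next
  eigenspace. Hence each restriction is the extension of the previous one and vanishes with
  it.\<close>

lemma res_zero_step:
  assumes z: "0 < z" "z < 4 / 3" and u: "u \<in> eigenspace n (vs_rho n ^ m * Psi z)" and 0: "res m u = 0"
  shows "res (m + i) u = 0"
proof (induction i)
  case 0
  then show ?case
    using assms by simp
next
  case (Suc i)
  let ?l = "zeta (Suc i) z" and ?k = "m + i"
  note l = zeta_strict[OF z, of i]
  have d: "dec ?l = zeta i z"
    using zeta_range(5)[of z i] z by simp
  have ns: "nonsing ?l"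
    using l by (intro first_band_nonsing) auto
  have "vs_rho n ^ Suc ?k * Psi ?l = vs_rho n ^ m * Psi z"
    using Psi_zeta[OF z, of "Suc i"] by (simp add: power_add mult_ac)
  then have "res (Suc ?k) u \<in> E (Suc ?k) ?l"
    using res_E[of ?l u "Suc ?k"] u zeta_strict(1,2)[OF z, of "Suc i"] by simp
  moreover have "ext ?k ?l ` E ?k (zeta i z) = E (Suc ?k) ?l"
  proof (rule lf.eq_of_dim_eq_in_span[OF finite_Dbas E_span])
    show "ext ?k ?l ` E ?k (zeta i z) \<subseteq> E (Suc ?k) ?l"
      using ext_E[OF ns] d by auto
    show "lf.subspace (ext ?k ?l ` E ?k (zeta i z))"
      by (rule lfp.linear_subspace_image[OF linear_ext subspace_E])
    have "lf.dim (ext ?k ?l ` E ?k (zeta i z)) = mult ?k (zeta i z)"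
      unfolding mult_def using lfp.dim_eq_of_bij[OF linear_ext inj_ext subspace_E] by simp
    then show "lf.dim (E (Suc ?k) ?l) \<le> lf.dim (ext ?k ?l ` E ?k (zeta i z))"
      using mult_first_band[OF l(3,4), of ?k] d by (simp add: mult_def)
  qed
  ultimately obtain p where p: "p \<in> E ?k (zeta i z)" "res (Suc ?k) u = ext ?k ?l p"
    by blast
  have "p q = 0" for q
  proof (cases "q \<in> vert ?k")
    case True
    have "p q = res (Suc ?k) u (lat q)"
      unfolding p(2) by simp
    also have "\<dots> = res ?k u q"
      using True by (simp add: res_def lat_vert_iff pt_lat)
    finally show ?thesis
      using Suc by simp
  next
    case False
    then show ?thesis
      using p(1) by (cases q) (simp add: E_def supp_def)
  qed
  then have "p = (\<lambda>x. 0 * p x)"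
    by (simp add: fun_eq_iff)
  then have "ext ?k ?l p = (\<lambda>Q. 0 * ext ?k ?l p Q)"
    using ext_linear(2)[of ?k ?l 0 p] by metis
  then show ?case
    using p(2) by (simp add: fun_eq_iff)
qed

lemma res_zero:
  assumes z: "0 < z" "z < 4 / 3" and u: "u \<in> eigenspace n (vs_rho n ^ m * Psi z)" and 0: "res m u = 0"
  shows "u = 0"
proof -
  have "u x = 0" if x: "x \<in> Ver" for x
  proof -
    obtain k where k: "\<And>i. k \<le> i \<Longrightarrow> x \<in> pt i ` vert i"
      using Ver_point[OF x] by blast
    then obtain Q where Q: "Q \<in> vert (m + k)" "x = pt (m + k) Q"
      using le_add2 by blast
    have "res (m + k) u Q = 0"
      using res_zero_step[OF assms, of k] by simp
    then show ?thesis
      using Q by (simp add: res_def)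
  qed
  moreover have "continuous_on (closure Ver) u"
    using u by (simp add: eigenspace_def neumann_laplacian_def vicsek_set_eq)
  ultimately have "u x = 0" if "x \<in> closure Ver" for x
    using continuous_constant_on_closure[of Ver u 0 x] that by blast
  moreover have "u x = 0" if "x \<notin> closure Ver" for x
    using u that unfolding eigenspace_def vicsek_set_eq by blast
  ultimately have "u x = 0" for x
    by blast
  then show ?thesis
    by (simp add: fun_eq_iff)
qed

section \<open>Linearity and the isomorphism of the eigenspaces\<close>

lemma graph_laplacian_linear:
  "graph_laplacian n m (\<lambda>x. u x + v x) x = graph_laplacian n m u x + graph_laplacian n m v x"
  "graph_laplacian n m (\<lambda>x. c * u x) x = c * graph_laplacian n m u x"
proof -
  have "(\<Sum>y\<in>Y. u y + v y - (u x + v x)) = (\<Sum>y\<in>Y. u y - u x) + (\<Sum>y\<in>Y. v y - v x)" for Y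
    unfolding sum.distrib[symmetric] by (rule sum.cong) auto
  then show "graph_laplacian n m (\<lambda>x. u x + v x) x = graph_laplacian n m u x + graph_laplacian n m v x"
    by (simp add: graph_laplacian_def add_divide_distrib)
  have "(\<Sum>y\<in>Y. c * u y - c * u x) = c * (\<Sum>y\<in>Y. u y - u x)" for Y
    by (simp add: sum_distrib_left right_diff_distrib)
  then show "graph_laplacian n m (\<lambda>x. c * u x) x = c * graph_laplacian n m u x"
    by (simp add: graph_laplacian_def)
qed

lemma neumann_add:
  assumes "neumann_laplacian n u f" "neumann_laplacian n v g"
  shows "neumann_laplacian n (\<lambda>x. u x + v x) (\<lambda>x. f x + g x)"
  unfolding neumann_laplacian_def
proof (intro conjI allI impI)
  fix e :: real assume "0 < e"
  then have "0 < e / 2"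
    by simp
  then have "\<forall>\<^sub>F m in sequentially. \<forall>x\<in>vs_vertices n m. \<bar>vs_rho n ^ m * graph_laplacian n m u x - f x\<bar> < e / 2"
    "\<forall>\<^sub>F m in sequentially. \<forall>x\<in>vs_vertices n m. \<bar>vs_rho n ^ m * graph_laplacian n m v x - g x\<bar> < e / 2"
    using assms unfolding neumann_laplacian_def by blast+
  then show "\<forall>\<^sub>F m in sequentially. \<forall>x\<in>vs_vertices n m.
      \<bar>vs_rho n ^ m * graph_laplacian n m (\<lambda>x. u x + v x) x - (f x + g x)\<bar> < e"
  proof eventually_elim
    case (elim m)
    show ?case
    proof
      fix x assume "x \<in> vs_vertices n m"
      then have "\<bar>vs_rho n ^ m * graph_laplacian n m u x - f x\<bar> < e / 2"
        "\<bar>vs_rho n ^ m * graph_laplacian n m v x - g x\<bar> < e / 2"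
        using elim by auto
      then show "\<bar>vs_rho n ^ m * graph_laplacian n m (\<lambda>x. u x + v x) x - (f x + g x)\<bar> < e"
        unfolding graph_laplacian_linear distrib_left by linarith
    qed
  qed
qed (use assms in \<open>auto simp: neumann_laplacian_def intro: continuous_on_add\<close>)

lemma neumann_scale:
  assumes "neumann_laplacian n u f"
  shows "neumann_laplacian n (\<lambda>x. c * u x) (\<lambda>x. c * f x)"
  unfolding neumann_laplacian_def
proof (intro conjI allI impI)
  fix e :: real assume "0 < e"
  then have e: "0 < e / (\<bar>c\<bar> + 1)"
    by (intro divide_pos_pos) auto
  then have "\<forall>\<^sub>F m in sequentially. \<forall>x\<in>vs_vertices n m. \<bar>vs_rho n ^ m * graph_laplacian n m u x - f x\<bar> < e / (\<bar>c\<bar> + 1)"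
    using assms unfolding neumann_laplacian_def by blast
  then show "\<forall>\<^sub>F m in sequentially. \<forall>x\<in>vs_vertices n m.
      \<bar>vs_rho n ^ m * graph_laplacian n m (\<lambda>x. c * u x) x - c * f x\<bar> < e"
  proof eventually_elim
    case (elim m)
    show ?case
    proof
      fix x assume "x \<in> vs_vertices n m"
      then have "\<bar>vs_rho n ^ m * graph_laplacian n m u x - f x\<bar> < e / (\<bar>c\<bar> + 1)"
        using elim by auto
      then have "(\<bar>c\<bar> + 1) * \<bar>vs_rho n ^ m * graph_laplacian n m u x - f x\<bar> < e"
        by (subst (asm) pos_less_divide_eq) (auto simp: mult.commute)
      moreover have "\<bar>vs_rho n ^ m * graph_laplacian n m (\<lambda>x. c * u x) x - c * f x\<bar>
          = \<bar>c\<bar> * \<bar>vs_rho n ^ m * graph_laplacian n m u x - f x\<bar>"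
        unfolding graph_laplacian_linear abs_mult[symmetric] by (simp add: algebra_simps)
      moreover have "0 \<le> \<bar>vs_rho n ^ m * graph_laplacian n m u x - f x\<bar>"
        by simp
      ultimately show "\<bar>vs_rho n ^ m * graph_laplacian n m (\<lambda>x. c * u x) x - c * f x\<bar> < e"
        by (simp add: distrib_right)
    qed
  qed
qed (use assms in \<open>auto simp: neumann_laplacian_def intro: continuous_on_mult_left\<close>)

lemma subspace_eigenspace: "plane_fun.subspace (eigenspace n t)"
  unfolding plane_fun.subspace_def
proof (intro conjI ballI allI)
  show "0 \<in> eigenspace n t"
  proof -
    have "neumann_laplacian n (\<lambda>x. 0) (\<lambda>x. - t * 0)"
      by (auto simp: neumann_laplacian_def graph_laplacian_def)
    then show ?thesis
      by (simp add: eigenspace_def zero_fun_def)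
  qed
  fix u assume u: "u \<in> eigenspace n t"
  show "u + v \<in> eigenspace n t" if v: "v \<in> eigenspace n t" for v
    using neumann_add[of u "\<lambda>x. - t * u x" v "\<lambda>x. - t * v x"] u v
    by (simp add: eigenspace_def plus_fun_def algebra_simps)
  show "(\<lambda>x. c * u x) \<in> eigenspace n t" for c
    using neumann_scale[of u "\<lambda>x. - t * u x" c] u
    by (simp add: eigenspace_def algebra_simps)
qed

lemma linear_res: "Vector_Spaces.linear (\<lambda>(c::real) u x. c * u x) (\<lambda>(c::real) u x. c * u x) (res m)"
  by unfold_locales (auto simp: res_def fun_eq_iff)

lemma res_image:
  assumes z: "0 < z" "z < 4 / 3"
  shows "res m ` eigenspace n (vs_rho n ^ m * Psi z) = E m z"
proof (intro equalityI subsetI)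
  fix p assume "p \<in> res m ` eigenspace n (vs_rho n ^ m * Psi z)"
  then show "p \<in> E m z"
    using res_E[OF z] by blast
next
  fix p assume p: "p \<in> E m z"
  then obtain u where u: "u \<in> eigenspace n (vs_rho n ^ m * Psi z)" "\<forall>Q\<in>vert m. u (pt m Q) = p Q"
    using eigenfunction_exists[OF z] by blast
  have "res m u = p"
    using u(2) p by (auto simp: res_def E_def supp_def fun_eq_iff)
  then show "p \<in> res m ` eigenspace n (vs_rho n ^ m * Psi z)"
    using u(1) by blast
qed

lemma inj_res:
  assumes z: "0 < z" "z < 4 / 3"
  shows "inj_on (res m) (eigenspace n (vs_rho n ^ m * Psi z))"
proof -
  have "\<forall>u\<in>eigenspace n (vs_rho n ^ m * Psi z). res m u = 0 \<longrightarrow> u = 0"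
    using res_zero[OF z] by blast
  then show ?thesis
    using plp.linear_inj_on_iff_eq_0[OF linear_res subspace_eigenspace] by blast
qed

lemma eig_multiplicity_eq:
  assumes z: "0 < z" "z < 4 / 3"
  shows "eig_multiplicity n (vs_rho n ^ m * Psi z) = mult m z"
  unfolding eig_multiplicity_def mult_def
  using plp.dim_eq_of_bij[OF linear_res inj_res[OF z] subspace_eigenspace] res_image[OF z] by simp

lemma spec_iff: "z \<in> spec m \<longleftrightarrow> (\<exists>p\<in>E m z. p \<noteq> 0)"
proof
  assume "z \<in> spec m"
  show "\<exists>p\<in>E m z. p \<noteq> 0"
  proof (rule ccontr)
    assume "\<not> ?thesis"
    then have "E m z \<subseteq> lf.span {}"
      by auto
    then have "mult m z \<le> card ({} :: (pt2 \<Rightarrow> real) set)"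
      unfolding mult_def by (rule lf.dim_le_card) simp
    then show False
      using \<open>z \<in> spec m\<close> by (simp add: spec_def)
  qed
next
  assume "\<exists>p\<in>E m z. p \<noteq> 0"
  then obtain p where p: "p \<in> E m z" "p \<noteq> 0"
    by blast
  have "lf.independent {p}"
    using lf.dependent_single p(2) by blast
  then have "card {p} \<le> mult m z"
    unfolding mult_def using lf.independent_card_le_dim_in_span(2)[OF finite_Dbas E_span, of "{p}" m z] p(1) by simp
  then show "z \<in> spec m"
    by (simp add: spec_def)
qed

lemma eigenvalue_iff:
  assumes z: "0 < z" "z < 4 / 3"
  shows "vs_rho n ^ m * Psi z \<in> eigenvalues n \<longleftrightarrow> z \<in> spec m"
proof -
  have "vs_rho n ^ m * Psi z \<in> eigenvalues n \<longleftrightarrow> (\<exists>u\<in>eigenspace n (vs_rho n ^ m * Psi z). u \<noteq> 0)"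
    by (auto simp: eigenvalues_def fun_eq_iff)
  also have "\<dots> \<longleftrightarrow> (\<exists>u\<in>eigenspace n (vs_rho n ^ m * Psi z). res m u \<noteq> 0)"
  proof -
    have "res m 0 = 0"
      by (simp add: res_def fun_eq_iff)
    then have "u \<noteq> 0 \<longleftrightarrow> res m u \<noteq> 0" if "u \<in> eigenspace n (vs_rho n ^ m * Psi z)" for u
      using res_zero[OF z that] by auto
    then show ?thesis
      by (rule bex_cong[OF refl])
  qed
  also have "\<dots> \<longleftrightarrow> (\<exists>p\<in>E m z. p \<noteq> 0)"
    unfolding res_image[OF z, symmetric] by blast
  finally show ?thesis
    using spec_iff by simp
qed

section \<open>Counting eigenvalues\<close>

text \<open>Every positive number up to the bound has the form \<open>vs_rho n ^ m * Psi x\<close>,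
  so positive eigenvalues are recognised on level m. Eigenvalues at or below 0 are outside the range
  of this transfer and enter through the first two hypotheses.\<close>

lemma eigenvalues_upto:
  assumes nn: "\<And>t. t \<in> eigenvalues n \<Longrightarrow> 0 \<le> t" and 0: "0 \<in> eigenvalues n"
    and z: "0 < z" "z < 4 / 3"
  shows "{s \<in> eigenvalues n. s \<le> vs_rho n ^ m * Psi z}
    = insert 0 ((\<lambda>x. vs_rho n ^ m * Psi x) ` (spec m \<inter> {0<..z}))"
proof (intro equalityI subsetI)
  fix s assume s: "s \<in> {s \<in> eigenvalues n. s \<le> vs_rho n ^ m * Psi z}"
  show "s \<in> insert 0 ((\<lambda>x. vs_rho n ^ m * Psi x) ` (spec m \<inter> {0<..z}))"
  proof (cases "s = 0")
    case False
    then have "0 < s"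
      using nn s by force
    moreover have "s / vs_rho n ^ m \<le> Psi z"
      using s rho_pos by (simp add: pos_divide_le_eq mult.commute)
    ultimately obtain x where x: "0 < x" "x \<le> z" "Psi x = s / vs_rho n ^ m"
      using Psi_surj[of "s / vs_rho n ^ m" z] z rho_pos by (metis divide_pos_pos less_imp_le zero_less_power)
    then have eq: "s = vs_rho n ^ m * Psi x"
      using rho_pos by simp
    have "s \<in> eigenvalues n"
      using s by simp
    then have "x \<in> spec m"
      using eigenvalue_iff[of x m] x(1,2) z unfolding eq by simp
    then have "x \<in> spec m \<inter> {0<..z}"
      using x(1,2) by simp
    then have "vs_rho n ^ m * Psi x \<in> (\<lambda>x. vs_rho n ^ m * Psi x) ` (spec m \<inter> {0<..z})"
      by (rule imageI)
    then show ?thesis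
      unfolding eq[symmetric] by (rule insertI2)
  qed simp
next
  fix s assume "s \<in> insert 0 ((\<lambda>x. vs_rho n ^ m * Psi x) ` (spec m \<inter> {0<..z}))"
  then consider "s = 0" | x where "x \<in> spec m" "0 < x" "x \<le> z" "s = vs_rho n ^ m * Psi x"
    by auto
  then show "s \<in> {s \<in> eigenvalues n. s \<le> vs_rho n ^ m * Psi z}"
  proof cases
    case 1
    then show ?thesis
      using 0 Psi_ge[of z] z rho_pos by simp
  next
    case 2
    have "Psi x \<le> Psi z"
      using Psi_less_iff[of z x] 2 z by force
    then have "s \<le> vs_rho n ^ m * Psi z"
      unfolding 2(4) using rho_pos by (intro mult_left_mono) auto
    then show ?thesis
      using eigenvalue_iff[of x m] 2 z by simp
  qed
qed

lemma eig_counting_eq: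
  assumes nn: "\<And>t. t \<in> eigenvalues n \<Longrightarrow> 0 \<le> t" and 0: "0 \<in> eigenvalues n"
    and z: "0 < z" "z < 4 / 3"
  shows "eig_counting n (vs_rho n ^ m * Psi z) = eig_multiplicity n 0 + mass m {0<..z}"
proof -
  let ?g = "\<lambda>x. vs_rho n ^ m * Psi x" and ?Z = "spec m \<inter> {0<..z}"
  have inj: "inj_on ?g ?Z"
  proof (rule inj_onI)
    fix x y assume "x \<in> ?Z" "y \<in> ?Z" "?g x = ?g y"
    then show "x = y"
      using Psi_less_iff[of x y] Psi_less_iff[of y x] z rho_pos by (auto simp: linorder_neq_iff)
  qed
  have "0 \<notin> ?g ` ?Z"
  proof
    assume "0 \<in> ?g ` ?Z"
    then obtain x where x: "0 < x" "x \<le> z" "0 = ?g x"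
      by auto
    then show False
      using Psi_ge[of x] z rho_pos by auto
  qed
  then have "eig_counting n (?g z) = eig_multiplicity n 0 + (\<Sum>s\<in>?g ` ?Z. eig_multiplicity n s)"
  proof -
    have "eig_counting n (?g z) = (\<Sum>s\<in>insert 0 (?g ` ?Z). eig_multiplicity n s)"
      unfolding eig_counting_def by (rule sum.cong[OF eigenvalues_upto[OF nn 0 z] refl])
    also have "\<dots> = eig_multiplicity n 0 + (\<Sum>s\<in>?g ` ?Z. eig_multiplicity n s)"
      using \<open>0 \<notin> ?g ` ?Z\<close> by (intro sum.insert) auto
    finally show ?thesis .
  qed
  also have "(\<Sum>s\<in>?g ` ?Z. eig_multiplicity n s) = (\<Sum>x\<in>?Z. eig_multiplicity n (?g x))"
    unfolding sum.reindex[OF inj] o_def ..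
  also have "\<dots> = (\<Sum>x\<in>?Z. mult m x)"
    using z by (intro sum.cong refl eig_multiplicity_eq) auto
  finally show ?thesis
    by (simp add: mass_def)
qed

lemma rho_powr_alpha: "vs_rho n powr vs_alpha n = 4 * real n - 3"
proof -
  have "ln (vs_rho n) > 0"
    using rho_pos by simp
  then show ?thesis
    using rho_pos n_ge_2 by (simp add: powr_def vs_alpha_def)
qed

text \<open>Replacing the argument t by rho^k t multiplies t^alpha by (4 n - 3)^k, the same factor
  as in the count on level k + 1. The offset d and the multiplicity of 0 are bounded and disappear.
  The count is asked for only from k = 1 on, as the gaps used for left limits appear from level 2
  on.\<close>

lemma weyl_limit_eq:
  assumes nn: "\<And>t. t \<in> eigenvalues n \<Longrightarrow> 0 \<le> t" and 0: "0 \<in> eigenvalues n"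
    and z: "0 < z" "z < 4 / 3" and c: "\<And>k. 1 \<le> k \<Longrightarrow> mass (Suc k) {..z} = c * NN k + d"
  shows "weyl_limit n (vs_rho n * Psi z) = real c / (vs_rho n * Psi z) powr vs_alpha n"
proof -
  let ?s = "vs_rho n * Psi z" and ?N = "4 * real n - 3"
  have N: "1 < ?N"
    using n_ge_2 by simp
  have s: "0 < ?s"
    using Psi_ge[of z] z rho_pos by simp
  have NN: "real (NN k) = ?N ^ k" for k
    using n_ge_2 by (simp add: of_nat_diff)
  have "weyl_ratio n (vs_rho n ^ k * ?s)
      = (real c + (real (eig_multiplicity n 0) + real d - 1) / ?N ^ k) / ?s powr vs_alpha n" if k: "1 \<le> k" for k
  proof -
    have "mass (Suc k) {..z} = mass (Suc k) {..<0} + (mass (Suc k) {0} + mass (Suc k) {0<..z})"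
    proof -
      have "{..z} = {..<0} \<union> ({0} \<union> {0<..z})"
        using z by auto
      then show ?thesis
        by (simp only:) (subst mass_Un; (auto; fail)?)+
    qed
    then have m: "mass (Suc k) {0<..z} + 1 = c * NN k + d"
      unfolding mass_singleton masses(1,2) c[OF k, symmetric] by simp
    have "real (mass (Suc k) {0<..z}) = real c * ?N ^ k + real d - 1"
    proof -
      have "real (mass (Suc k) {0<..z} + 1) = real (c * NN k + d)"
        unfolding m ..
      then show ?thesis
        using NN[of k] by simp
    qed
    moreover have "eig_counting n (vs_rho n ^ k * ?s) = eig_multiplicity n 0 + mass (Suc k) {0<..z}"
      using eig_counting_eq[OF nn 0 z, of "Suc k"] by (simp only: power_Suc mult_ac)
    ultimately have "real (eig_counting n (vs_rho n ^ k * ?s)) = real (eig_multiplicity n 0) + (real c * ?N ^ k + real d - 1)"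
      by simp
    moreover have "(vs_rho n ^ k * ?s) powr vs_alpha n = ?N ^ k * ?s powr vs_alpha n"
    proof -
      have "(vs_rho n ^ k) powr vs_alpha n = (vs_rho n powr vs_alpha n) ^ k"
        using rho_pos by (simp add: powr_realpow[symmetric] powr_powr mult.commute)
      then show ?thesis
        using s rho_pos by (simp add: powr_mult rho_powr_alpha)
    qed
    ultimately show ?thesis
      unfolding weyl_ratio_def using N by (simp add: field_simps)
  qed
  then have ev: "\<forall>\<^sub>F k in sequentially. (real c + (real (eig_multiplicity n 0) + real d - 1) / ?N ^ k) / ?s powr vs_alpha n
      = weyl_ratio n (vs_rho n ^ k * ?s)"
    unfolding eventually_sequentially by (intro exI[of _ 1]) auto
  have "(\<lambda>k. (real c + (real (eig_multiplicity n 0) + real d - 1) / ?N ^ k) / ?s powr vs_alpha n)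
      \<longlonglongrightarrow> (real c + 0) / ?s powr vs_alpha n"
  proof (intro tendsto_intros)
    show "(\<lambda>k. (real (eig_multiplicity n 0) + real d - 1) / ?N ^ k) \<longlonglongrightarrow> 0"
      using N by (rule LIMSEQ_divide_realpow_zero)
  qed (use s in auto)
  then have "(\<lambda>k. weyl_ratio n (vs_rho n ^ k * ?s)) \<longlonglongrightarrow> (real c + 0) / ?s powr vs_alpha n"
    by (rule Lim_transform_eventually[OF _ ev])
  then show ?thesis
    unfolding weyl_limit_def by (simp add: limI)
qed

text \<open>Near \<open>tp j\<close> the values of R exceed \<open>tp (n - 1)\<close>, and no
  eigenvalue of a level k \<ge> 1 lies between that and 4/3. So the preimages left of c already
  exhaust the band, with one c for all levels.\<close>

lemma left_gap:
  assumes j: "j < n - 1"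
  obtains c where "zp j < c" "c < tp j" "\<And>k z. 1 \<le> k \<Longrightarrow> c \<le> z \<Longrightarrow> z < tp j \<Longrightarrow> mass (Suc k) {..z} = (4 * j + 1) * NN k"
proof -
  have jl: "j \<le> n - 1"
    using j by simp
  have "zp j < tp j"
    by (rule zp_less_tp[OF jl])
  have "dec \<midarrow>tp j\<rightarrow> dec (tp j)"
    using continuous_on_combos(5)[of UNIV] by (simp add: continuous_on_eq_continuous_at isCont_def)
  then have "\<forall>\<^sub>F x in at (tp j). tp (n - 1) < dec x"
    using dec_tp[OF jl] tp_last_props(2) by (intro order_tendstoD(1)) auto
  then have "\<forall>\<^sub>F x in at_left (tp j). tp (n - 1) < dec x"
    by (rule filter_leD[OF at_le[OF subset_UNIV]])
  moreover have "\<forall>\<^sub>F x in at_left (tp j). zp j < x \<and> x < tp j"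
    using eventually_at_left_real[OF \<open>zp j < tp j\<close>] by (simp add: eventually_mono)
  ultimately have "\<forall>\<^sub>F x in at_left (tp j). tp (n - 1) < dec x \<and> (zp j < x \<and> x < tp j)"
    by (rule eventually_conj)
  then obtain c where c: "tp (n - 1) < dec c" "zp j < c" "c < tp j"
    using eventually_happens'[OF trivial_limit_at_left_real] by blast
  show ?thesis
  proof
    show "zp j < c" "c < tp j"
      using c by auto
    fix k :: nat and z assume k: "1 \<le> k" and z: "c \<le> z" "z < tp j"
    obtain k' where k': "k = Suc k'"
      using k by (cases k) auto
    have "mass k {0<..<4/3} \<le> mass (Suc k) {zp j<..<c}"
    proof (rule mass_band)
      fix y assume y: "y \<in> spec k" "0 < y" "y < 4 / 3"
      have "y \<le> tp (n - 1)"
        using spec_gap[of y k'] y k' by simp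
      then show "\<exists>x>zp j. x < c \<and> dec x = y"
        using y c dec_zp[OF jl] by (intro IVT_strict) (auto intro: continuous_intros simp: mult_less_0_iff)
    next
      show "c \<le> 4 / 3"
        using c tp_less[OF jl] by simp
    qed
    moreover have "mass (Suc k) ({zp j<..<c} \<union> {c..<tp j}) = mass (Suc k) {zp j<..<c} + mass (Suc k) {c..<tp j}"
      by (rule mass_Un) auto
    moreover have "{zp j<..<c} \<union> {c..<tp j} = {zp j<..<tp j}"
      using c by auto
    ultimately have "mass (Suc k) {c..<tp j} = 0"
      using masses_tp(1)[OF j, of k] masses(3)[of k] by simp
    moreover have "mass (Suc k) {z<..<tp j} \<le> mass (Suc k) {c..<tp j}"
      using z by (intro mass_mono) auto
    moreover have "mass (Suc k) ({..z} \<union> {z<..<tp j}) = mass (Suc k) {..z} + mass (Suc k) {z<..<tp j}"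
      by (rule mass_Un) auto
    moreover have "{..z} \<union> {z<..<tp j} = {..<tp j}"
      using z by auto
    ultimately show "mass (Suc k) {..z} = (4 * j + 1) * NN k"
      using mass_below_tp[OF j, of k] by simp
  qed
qed

text \<open>The ends in increasing order, \<open>zp 0\<close>, \<open>tp 0\<close>,
  \<open>zp 1\<close>, up to \<open>zp (n - 1)\<close>: the eigenvalues of level 1 below
  4/3.\<close>

definition zs :: "nat \<Rightarrow> real" where "zs i = (if even i then zp (i div 2) else tp (i div 2))"

lemma zs_Suc: "Suc i \<le> 2 * (n - 1) \<Longrightarrow> zs i < zs (Suc i)"
  using zp_less_tp[of "i div 2"] tp_less_zp[of "i div 2"] by (auto simp: zs_def elim!: evenE oddE)

lemma zs_less: "i < j \<Longrightarrow> j \<le> 2 * (n - 1) \<Longrightarrow> zs i < zs j"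
proof (induction j)
  case (Suc j)
  then show ?case
    using zs_Suc[of j] by (cases "i = j") (auto intro: less_trans)
qed simp

lemma zs_0: "zs 0 = 0"
  by (simp add: zs_def zp_0)

lemma zs_bounds: "0 < i \<Longrightarrow> i \<le> 2 * (n - 1) \<Longrightarrow> 0 < zs i \<and> zs i < 4 / 3"
proof -
  assume i: "0 < i" "i \<le> 2 * (n - 1)"
  then have "i div 2 \<le> n - 1"
    by simp
  then show ?thesis
    using zs_less[of 0 i] i zs_0 zp_le[of "i div 2"] tp_less[of "i div 2"] by (simp add: zs_def)
qed

text \<open>The multiplicities 1 at \<open>zp\<close> and 3 at \<open>tp\<close> add up to 4 (n -
  1), the full number of eigenvalues of level 1 strictly between 0 and 4/3.\<close>

lemma spec_1: "spec 1 \<inter> {0<..<4/3} = zs ` {1..2 * (n - 1)}"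
proof
  have mz: "mult 1 (zs i) = (if even i then 1 else 3)" if i: "1 \<le> i" "i \<le> 2 * (n - 1)" for i
  proof (cases "even i")
    case True
    then show ?thesis
      using masses_zp(2)[of "i div 2" 0] i by (simp add: zs_def)
  next
    case False
    then have "i div 2 < n - 1"
      using i by (auto elim!: oddE)
    then show ?thesis
      using masses_tp(2)[of "i div 2" 0] False by (simp add: zs_def)
  qed
  show sub: "zs ` {1..2 * (n - 1)} \<subseteq> spec 1 \<inter> {0<..<4/3}"
    using mz zs_bounds by (auto simp: spec_def split: if_splits)
  have inj: "inj_on zs {1..2 * (n - 1)}"
    using zs_less by (intro linorder_inj_onI) (auto dest: less_imp_neq)
  have "(\<Sum>i\<in>{1..2 * k}. if even i then 1 else 3) = 4 * k" for k :: nat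
    by (induction k) auto
  moreover have "(\<Sum>i\<in>{1..2 * (n - 1)}. mult 1 (zs i)) = (\<Sum>i\<in>{1..2 * (n - 1)}. if even i then 1 else 3)"
    by (rule sum.cong[OF refl]) (use mz in auto)
  ultimately have "(\<Sum>i\<in>{1..2 * (n - 1)}. mult 1 (zs i)) = 4 * (n - 1)"
    by simp
  then have s: "(\<Sum>z\<in>zs ` {1..2 * (n - 1)}. mult 1 z) = 4 * (n - 1)"
    unfolding sum.reindex[OF inj] o_def .
  have t: "(\<Sum>z\<in>spec 1 \<inter> {0<..<4/3}. mult 1 z) = 4 * (n - 1)"
    using masses(3)[of 1] n_ge_2 by (simp add: mass_def)
  show "spec 1 \<inter> {0<..<4/3} \<subseteq> zs ` {1..2 * (n - 1)}"
  proof (rule ccontr)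
    assume "\<not> ?thesis"
    then obtain z where z: "z \<in> spec 1 \<inter> {0<..<4/3}" "z \<notin> zs ` {1..2 * (n - 1)}"
      by blast
    have "(\<Sum>z\<in>zs ` {1..2 * (n - 1)}. mult 1 z) < (\<Sum>z\<in>spec 1 \<inter> {0<..<4/3}. mult 1 z)"
      by (rule sum_strict_mono2[OF finite_subset[OF Int_lower1 finite_spec] sub, of z])
        (use z in \<open>auto simp: spec_def\<close>)
    then show False
      using s t by simp
  qed
qed

lemma lam_eq:
  assumes lam: "strict_mono lam" "range lam = eigenvalues n" "lam 0 = 0"
    and i: "i \<le> 2 * (n - 1)"
  shows "lam i = vs_rho n * Psi (zs i)"
proof (rule enumeration_unique[OF lam(1) _ _ i])
  let ?K = "2 * (n - 1)"
  let ?f = "\<lambda>i. vs_rho n * Psi (zs i)"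
  have K: "0 < ?K"
    using n_ge_2 by simp
  have b: "0 \<le> zs i" "zs i \<le> 4 / 3" if "i \<le> ?K" for i
    using zs_bounds[of i] that zs_0 by (cases "i = 0"; force)+
  show "?f i < ?f j" if "i < j" "j \<le> ?K" for i j
    using Psi_strict_mono[of "zs i" "zs j"] zs_less[OF that] b[of i] b[of j] that rho_pos by simp
  have nn: "0 \<le> t" if t: "t \<in> eigenvalues n" for t
  proof -
    have "t \<in> range lam"
      using t lam(2) by simp
    then obtain i where "t = lam i"
      by blast
    then show ?thesis
      using lam(1,3) by (metis strict_mono_less_eq zero_le)
  qed
  have 0: "0 \<in> eigenvalues n"
    using lam(2,3) by (metis rangeI)
  have "range lam \<inter> {..?f ?K} = {s \<in> eigenvalues n. s \<le> vs_rho n ^ 1 * Psi (zs ?K)}"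
    unfolding lam(2) by auto
  also have "\<dots> = insert 0 ((\<lambda>x. vs_rho n ^ 1 * Psi x) ` (spec 1 \<inter> {0<..zs ?K}))"
    using zs_bounds[OF K] by (intro eigenvalues_upto nn 0) auto
  also have "spec 1 \<inter> {0<..zs ?K} = zs ` {1..?K}"
  proof -
    have "zs i \<le> zs ?K" if "i \<le> ?K" for i
      using zs_less[of i ?K] that by (cases "i = ?K") auto
    then have "zs ` {1..?K} \<subseteq> {..zs ?K}"
      by auto
    moreover have "spec 1 \<inter> {0<..zs ?K} = (spec 1 \<inter> {0<..<4/3}) \<inter> {..zs ?K}"
      using zs_bounds[OF K] by auto
    ultimately show ?thesis
      unfolding spec_1 by blast
  qed
  also have "insert 0 ((\<lambda>x. vs_rho n ^ 1 * Psi x) ` zs ` {1..?K}) = ?f ` {..?K}"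
  proof -
    have "{..?K} = insert 0 {1..?K}"
      by auto
    then have "?f ` {..?K} = insert (?f 0) (?f ` {1..?K})"
      by (simp only: image_insert)
    also have "?f 0 = 0"
      by (simp add: zs_0 Psi_0)
    finally show ?thesis
      by (simp only: image_image power_one_right)
  qed
  finally show "?f ` {..?K} = range lam \<inter> {..?f ?K}" ..
qed

lemma weyl_values:
  assumes lam: "strict_mono lam" "range lam = eigenvalues n" "lam 0 = 0" and j: "1 \<le> j" "j \<le> n - 1"
  shows "(weyl_limit n \<longlongrightarrow> (4 * real j - 3) / lam (2 * j - 1) powr vs_alpha n) (at_left (lam (2 * j - 1)))"
    "weyl_limit n (lam (2 * j - 1)) = (4 * real j - 1) / lam (2 * j - 1) powr vs_alpha n"
    "weyl_limit n (lam (2 * j)) = 4 * real j / lam (2 * j) powr vs_alpha n"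
proof -
  have nn: "0 \<le> t" if t: "t \<in> eigenvalues n" for t
  proof -
    have "t \<in> range lam"
      using t lam(2) by simp
    then obtain i where "t = lam i"
      by blast
    then show ?thesis
      using lam(1,3) by (metis strict_mono_less_eq zero_le)
  qed
  have 0: "0 \<in> eigenvalues n"
    using lam(2,3) by (metis rangeI)
  \<comment> \<open>The odd eigenvalue with index 2 j - 1 belongs to the top of band number i = j -
    1; accordingly 4 i + 1 = 4 j - 3 and 4 i + 3 = 4 j - 1.\<close>
  obtain i where i: "j = Suc i" "i < n - 1"
    using j by (cases j) auto
  have l1: "lam (2 * j - 1) = vs_rho n * Psi (tp i)"
    using lam_eq[OF lam, of "2 * j - 1"] j i by (simp add: zs_def)
  have l2: "lam (2 * j) = vs_rho n * Psi (zp j)"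
    using lam_eq[OF lam, of "2 * j"] j by (simp add: zs_def)
  have t: "0 < tp i" "tp i < 4 / 3"
    using zs_bounds[of "2 * i + 1"] i by (auto simp: zs_def)
  have z: "0 < zp j" "zp j < 4 / 3"
    using zs_bounds[of "2 * j"] j by (auto simp: zs_def)
  show "weyl_limit n (lam (2 * j)) = 4 * real j / lam (2 * j) powr vs_alpha n"
    unfolding l2 using weyl_limit_eq[OF nn 0 z mass_upto_zp[OF j(2)]] by simp
  show "weyl_limit n (lam (2 * j - 1)) = (4 * real j - 1) / lam (2 * j - 1) powr vs_alpha n"
    unfolding l1 using weyl_limit_eq[OF nn 0 t mass_upto_tp[OF i(2)]] i(1) by (simp add: algebra_simps)
  obtain c where c: "zp i < c" "c < tp i" "\<And>k z. 1 \<le> k \<Longrightarrow> c \<le> z \<Longrightarrow> z < tp i \<Longrightarrow> mass (Suc k) {..z} = (4 * i + 1) * NN k"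
    using left_gap[OF i(2)] by blast
  have c0: "0 \<le> c"
    using c(1) zs_bounds[of "2 * i"] i zp_0 by (cases "i = 0") (auto simp: zs_def)
  let ?t = "vs_rho n * Psi (tp i)"
  have tpos: "0 < ?t"
    using Psi_ge[of "tp i"] t rho_pos by simp
  \<comment> \<open>On a left neighbourhood the numerator is constant, so the left limit is that of
    a continuous function.\<close>
  have lim: "weyl_limit n s = (4 * real j - 3) / s powr vs_alpha n" if s: "vs_rho n * Psi c < s" "s < ?t" for s
  proof -
    have "0 \<le> vs_rho n * Psi c"
      using Psi_ge[of c] c0 c(2) t rho_pos by simp
    then have "0 < s / vs_rho n" "s / vs_rho n \<le> Psi (tp i)"
      using s rho_pos by (auto simp: pos_divide_le_eq mult.commute)
    then obtain x where x: "0 < x" "x \<le> tp i" "Psi x = s / vs_rho n"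
      using Psi_surj[of "s / vs_rho n" "tp i"] t by (metis less_imp_le)
    have sx: "s = vs_rho n * Psi x"
      using x rho_pos by simp
    have "x < tp i" "c < x"
      using Psi_less_iff[of x "tp i"] Psi_less_iff[of c x] x s t c0 c(2) rho_pos unfolding sx by auto
    then have m: "mass (Suc k) {..x} = (4 * i + 1) * NN k + 0" if "1 \<le> k" for k
      using c(3)[OF that, of x] by simp
    show ?thesis
      unfolding sx using weyl_limit_eq[OF nn 0 x(1) _ m] \<open>x < tp i\<close> t i(1) by (simp add: algebra_simps)
  qed
  have "vs_rho n * Psi c < ?t"
    using Psi_strict_mono[of c "tp i"] c0 c(2) t rho_pos by simp
  then have "\<forall>\<^sub>F s in at_left ?t. (4 * real j - 3) / s powr vs_alpha n = weyl_limit n s"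
    using eventually_at_left_real[of "vs_rho n * Psi c" ?t] lim by (auto elim: eventually_mono)
  moreover have "((\<lambda>s. (4 * real j - 3) / s powr vs_alpha n) \<longlongrightarrow> (4 * real j - 3) / ?t powr vs_alpha n) (at_left ?t)"
    using tpos by (intro tendsto_intros) auto
  ultimately show "(weyl_limit n \<longlongrightarrow> (4 * real j - 3) / lam (2 * j - 1) powr vs_alpha n) (at_left (lam (2 * j - 1)))"
    unfolding l1 using Lim_transform_eventually by blast
qed

end

theorem lemma11p1:
  fixes n j :: nat and lam :: "nat \<Rightarrow> real"
  assumes "n \<ge> 2"
    and "strict_mono lam" and "range lam = eigenvalues n" and "lam 0 = 0"
    and "1 \<le> j" and "j \<le> n - 1"
  shows "(weyl_limit n \<longlongrightarrow> (4 * real j - 3) / lam (2 * j - 1) powr vs_alpha n)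
           (at_left (lam (2 * j - 1)))
    \<and> weyl_limit n (lam (2 * j - 1)) = (4 * real j - 1) / lam (2 * j - 1) powr vs_alpha n
    \<and> weyl_limit n (lam (2 * j)) = 4 * real j / lam (2 * j) powr vs_alpha n"
proof -
  interpret vicsek n
    using assms(1) by unfold_locales
  show ?thesis
    using weyl_values[OF assms(2-6)] by blast
qed

end
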